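(* Let $X=\mathbb{P}^1_{\mathbb{Z}}$ and let $\mathcal{E}$ be a locally free sheaf of rank two on $X$. Then there exist integers $a,b\in\mathbb{Z}$ with $a\geq b$, a local complete intersection $Z$ of codimension two in $X$, and an exact sequence of $\mathcal{O}_X$-modules $$0\longrightarrow \mathcal{O}_X(a)\longrightarrow \mathcal{E}\longrightarrow \mathcal{I}_Z(b)\longrightarrow 0 .$$
   Context: A local complete intersection of codimension two in $X$ is a closed subscheme $Z\subset X$ (possibly empty) whose ideal sheaf $\mathcal{I}_Z\subset\mathcal{O}_X$ is, at every point of $Z$, generated by a regular sequence of length two. $\mathcal{I}_Z(b):=\mathcal{I}_Z\otimes\mathcal{O}_X(b)$; if $Z=\emptyset$ then $\mathcal{I}_Z=\mathcal{O}_X$. *)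

theory Defs
  imports
    "HOL-Analysis.Abstract_Topology"
    "HOL-Algebra.Module"
    "HOL-Algebra.QuotRing"
    "HOL-Algebra.Free_Abelian_Groups"
    "HOL-Algebra.Generated_Groups"
    "HOL-Algebra.Algebraic_Closure_Type"
    "HOL-Computational_Algebra.Polynomial_Factorial"
    "HOL-Computational_Algebra.Fraction_Field"
begin

text \<open>HOL-Algebra reserves \<open>X\<close> for the indeterminate of a polynomial ring.\<close>

no_notation var (\<open>X\<index>\<close>)

section \<open>Ringed spaces and sheaves of modules\<close>

text \<open>
  A presheaf on a topological space is given by its sections on open sets and its restriction
  maps; \<open>Res F U V\<close> is the restriction from \<open>U\<close> to \<open>V\<close>, meaningful for open \<open>V \<subseteq> U\<close>. Values on
  sets that are not open play no role. Sections on an open set form a ring or module record of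
  HOL-Algebra.
\<close>

record ('p, 's, 'a) presheaf =
  Sec :: "'p set \<Rightarrow> 's"
  Res :: "'p set \<Rightarrow> 'p set \<Rightarrow> 'a \<Rightarrow> 'a"

type_synonym ('p, 'r, 'a) mod_presheaf = "('p, ('r, 'a) module, 'a) presheaf"

record ('p, 'r) ringed_space =
  Top :: "'p topology"
  Str :: "('p, 'r ring, 'r) presheaf"

abbreviation is_open :: "('p, 'r) ringed_space \<Rightarrow> 'p set \<Rightarrow> bool" where
  "is_open X U \<equiv> openin (Top X) U"

abbreviation points :: "('p, 'r) ringed_space \<Rightarrow> 'p set" where
  "points X \<equiv> topspace (Top X)"

abbreviation ring_at :: "('p, 'r) ringed_space \<Rightarrow> 'p set \<Rightarrow> 'r ring" where
  "ring_at X U \<equiv> Sec (Str X) U"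

text \<open>
  The open subspace \<open>U\<close>. As the opens of \<open>U\<close> are the opens of \<open>X\<close> contained in \<open>U\<close>, the
  restriction to \<open>U\<close> of a presheaf \<open>F\<close> on \<open>X\<close> is \<open>F\<close> itself, regarded over \<open>open_subspace X U\<close>.
\<close>

definition open_subspace :: "('p, 'r) ringed_space \<Rightarrow> 'p set \<Rightarrow> ('p, 'r) ringed_space" where
  "open_subspace X U = X\<lparr>Top := subtopology (Top X) U\<rparr>"

definition presheaf_of_modules :: "('p, 'r) ringed_space \<Rightarrow> ('p, 'r, 'a) mod_presheaf \<Rightarrow> bool" where
  "presheaf_of_modules X F \<longleftrightarrow>
     (\<forall>U. is_open X U \<longrightarrow> Module.module (ring_at X U) (Sec F U)) \<and>
     (\<forall>U V. is_open X U \<longrightarrow> is_open X V \<longrightarrow> V \<subseteq> U \<longrightarrow>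
        Res F U V \<in> hom (add_monoid (Sec F U)) (add_monoid (Sec F V)) \<and>
        (\<forall>r \<in> carrier (ring_at X U). \<forall>s \<in> carrier (Sec F U).
           Res F U V (r \<odot>\<^bsub>Sec F U\<^esub> s) = Res (Str X) U V r \<odot>\<^bsub>Sec F V\<^esub> Res F U V s)) \<and>
     (\<forall>U. is_open X U \<longrightarrow> (\<forall>s \<in> carrier (Sec F U). Res F U U s = s)) \<and>
     (\<forall>U V W. is_open X U \<longrightarrow> is_open X V \<longrightarrow> is_open X W \<longrightarrow> W \<subseteq> V \<longrightarrow> V \<subseteq> U \<longrightarrow>
        (\<forall>s \<in> carrier (Sec F U). Res F V W (Res F U V s) = Res F U W s))"

definition sheaf_of_modules :: "('p, 'r) ringed_space \<Rightarrow> ('p, 'r, 'a) mod_presheaf \<Rightarrow> bool" where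
  "sheaf_of_modules X F \<longleftrightarrow>
     presheaf_of_modules X F \<and>
     (\<forall>\<U>. (\<forall>U \<in> \<U>. is_open X U) \<longrightarrow>
        (\<forall>s \<in> carrier (Sec F (\<Union>\<U>)). \<forall>t \<in> carrier (Sec F (\<Union>\<U>)).
           (\<forall>U \<in> \<U>. Res F (\<Union>\<U>) U s = Res F (\<Union>\<U>) U t) \<longrightarrow> s = t)) \<and>
     (\<forall>\<U> \<sigma>. (\<forall>U \<in> \<U>. is_open X U) \<longrightarrow>
        (\<forall>U \<in> \<U>. \<sigma> U \<in> carrier (Sec F U)) \<longrightarrow>
        (\<forall>U \<in> \<U>. \<forall>V \<in> \<U>. Res F U (U \<inter> V) (\<sigma> U) = Res F V (U \<inter> V) (\<sigma> V)) \<longrightarrow>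
        (\<exists>s \<in> carrier (Sec F (\<Union>\<U>)). \<forall>U \<in> \<U>. Res F (\<Union>\<U>) U s = \<sigma> U))"

definition mod_morphism ::
  "('p, 'r) ringed_space \<Rightarrow> ('p, 'r, 'a) mod_presheaf \<Rightarrow> ('p, 'r, 'b) mod_presheaf \<Rightarrow>
   ('p set \<Rightarrow> 'a \<Rightarrow> 'b) \<Rightarrow> bool" where
  "mod_morphism X F G \<phi> \<longleftrightarrow>
     (\<forall>U. is_open X U \<longrightarrow>
        \<phi> U \<in> hom (add_monoid (Sec F U)) (add_monoid (Sec G U)) \<and>
        (\<forall>r \<in> carrier (ring_at X U). \<forall>s \<in> carrier (Sec F U).
           \<phi> U (r \<odot>\<^bsub>Sec F U\<^esub> s) = r \<odot>\<^bsub>Sec G U\<^esub> \<phi> U s)) \<and>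
     (\<forall>U V. is_open X U \<longrightarrow> is_open X V \<longrightarrow> V \<subseteq> U \<longrightarrow>
        (\<forall>s \<in> carrier (Sec F U). Res G U V (\<phi> U s) = \<phi> V (Res F U V s)))"

definition mod_isomorphism ::
  "('p, 'r) ringed_space \<Rightarrow> ('p, 'r, 'a) mod_presheaf \<Rightarrow> ('p, 'r, 'b) mod_presheaf \<Rightarrow>
   ('p set \<Rightarrow> 'a \<Rightarrow> 'b) \<Rightarrow> bool" where
  "mod_isomorphism X F G \<phi> \<longleftrightarrow>
     mod_morphism X F G \<phi> \<and>
     (\<forall>U. is_open X U \<longrightarrow> bij_betw (\<phi> U) (carrier (Sec F U)) (carrier (Sec G U)))"

text \<open>
  The image sheaf: the sections of \<open>G\<close> that lie locally in the image of \<open>\<phi>\<close>. The kernel presheaf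
  of a morphism of sheaves is already a sheaf.
\<close>

definition image_sheaf ::
  "('p, 'r) ringed_space \<Rightarrow> ('p, 'r, 'a) mod_presheaf \<Rightarrow> ('p, 'r, 'b) mod_presheaf \<Rightarrow>
   ('p set \<Rightarrow> 'a \<Rightarrow> 'b) \<Rightarrow> 'p set \<Rightarrow> 'b set" where
  "image_sheaf X F G \<phi> U =
     {t \<in> carrier (Sec G U). \<forall>p \<in> U. \<exists>V. is_open X V \<and> p \<in> V \<and> V \<subseteq> U \<and>
        Res G U V t \<in> \<phi> V ` carrier (Sec F V)}"

definition kernel_sheaf ::
  "('p, 'r, 'a) mod_presheaf \<Rightarrow> ('p, 'r, 'b) mod_presheaf \<Rightarrow>
   ('p set \<Rightarrow> 'a \<Rightarrow> 'b) \<Rightarrow> 'p set \<Rightarrow> 'a set" where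
  "kernel_sheaf F G \<phi> U = a_kernel (Sec F U) (Sec G U) (\<phi> U)"

definition right_exact_seq ::
  "('p, 'r) ringed_space \<Rightarrow> ('p, 'r, 'a) mod_presheaf \<Rightarrow> ('p, 'r, 'b) mod_presheaf \<Rightarrow>
   ('p, 'r, 'c) mod_presheaf \<Rightarrow> ('p set \<Rightarrow> 'a \<Rightarrow> 'b) \<Rightarrow> ('p set \<Rightarrow> 'b \<Rightarrow> 'c) \<Rightarrow> bool" where
  "right_exact_seq X F G H \<phi> \<psi> \<longleftrightarrow>
     mod_morphism X F G \<phi> \<and> mod_morphism X G H \<psi> \<and>
     (\<forall>U. is_open X U \<longrightarrow> image_sheaf X F G \<phi> U = kernel_sheaf G H \<psi> U) \<and>
     (\<forall>U. is_open X U \<longrightarrow> image_sheaf X G H \<psi> U = carrier (Sec H U))"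

definition short_exact_seq ::
  "('p, 'r) ringed_space \<Rightarrow> ('p, 'r, 'a) mod_presheaf \<Rightarrow> ('p, 'r, 'b) mod_presheaf \<Rightarrow>
   ('p, 'r, 'c) mod_presheaf \<Rightarrow> ('p set \<Rightarrow> 'a \<Rightarrow> 'b) \<Rightarrow> ('p set \<Rightarrow> 'b \<Rightarrow> 'c) \<Rightarrow> bool" where
  "short_exact_seq X F G H \<phi> \<psi> \<longleftrightarrow>
     right_exact_seq X F G H \<phi> \<psi> \<and>
     (\<forall>U. is_open X U \<longrightarrow> kernel_sheaf F G \<phi> U = {\<zero>\<^bsub>Sec F U\<^esub>})"


section \<open>Locally free and quasi-coherent sheaves\<close>

text \<open>
  The direct sum of copies of the structure sheaf indexed by \<open>J\<close>, that is, the sheaf associated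
  with the presheaf of finitely supported families: its sections are the families of sections
  that are locally finitely supported. The fields \<open>mult\<close> and \<open>one\<close>, which module records inherit
  from ring records, are irrelevant for modules.
\<close>

definition free_sheaf :: "('p, 'r) ringed_space \<Rightarrow> 'j set \<Rightarrow> ('p, 'r, 'j \<Rightarrow> 'r) mod_presheaf" where
  "free_sheaf X J =
     \<lparr> Sec = (\<lambda>U. \<lparr> carrier = {c \<in> J \<rightarrow>\<^sub>E carrier (ring_at X U).
                       \<forall>p \<in> U. \<exists>V. is_open X V \<and> p \<in> V \<and> V \<subseteq> U \<and>
                         finite {j \<in> J. Res (Str X) U V (c j) \<noteq> \<zero>\<^bsub>ring_at X V\<^esub>}},
                    monoid.mult = undefined, one = undefined,
                    ring.zero = (\<lambda>j\<in>J. \<zero>\<^bsub>ring_at X U\<^esub>),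
                    add = (\<lambda>c d. \<lambda>j\<in>J. c j \<oplus>\<^bsub>ring_at X U\<^esub> d j),
                    module.smult = (\<lambda>r c. \<lambda>j\<in>J. r \<otimes>\<^bsub>ring_at X U\<^esub> c j) \<rparr>),
       Res = (\<lambda>U V c. \<lambda>j\<in>J. Res (Str X) U V (c j)) \<rparr>"

definition locally_free_sheaf ::
  "('p, 'r) ringed_space \<Rightarrow> nat \<Rightarrow> ('p, 'r, 'a) mod_presheaf \<Rightarrow> bool" where
  "locally_free_sheaf X n F \<longleftrightarrow>
     sheaf_of_modules X F \<and>
     (\<forall>p \<in> points X. \<exists>U. is_open X U \<and> p \<in> U \<and>
        (\<exists>\<phi>. mod_isomorphism (open_subspace X U) (free_sheaf (open_subspace X U) {..<n}) F \<phi>))"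

text \<open>
  Locally there is a presentation \<open>\<O>\<^sup>(\<^sup>K\<^sup>) \<rightarrow> \<O>\<^sup>(\<^sup>J\<^sup>) \<rightarrow> F \<rightarrow> 0\<close> with arbitrary index sets. It is no
  restriction to index generators by sections of \<open>F\<close> and relations by families of sections of the
  structure sheaf, since repetitions among the generators or among the relations can be dropped.
\<close>

definition quasi_coherent_sheaf ::
  "('p, 'r) ringed_space \<Rightarrow> ('p, 'r, 'a) mod_presheaf \<Rightarrow> bool" where
  "quasi_coherent_sheaf X F \<longleftrightarrow>
     sheaf_of_modules X F \<and>
     (\<forall>p \<in> points X. \<exists>U. is_open X U \<and> p \<in> U \<and>
        (\<exists>(K :: ('a \<Rightarrow> 'r) set) (J :: 'a set) \<phi> \<psi>.
           right_exact_seq (open_subspace X U)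
             (free_sheaf (open_subspace X U) K) (free_sheaf (open_subspace X U) J) F \<phi> \<psi>))"


section \<open>Stalks\<close>

definition germ ::
  "'p topology \<Rightarrow> ('p, ('a, 'm) partial_object_scheme, 'a) presheaf \<Rightarrow> 'p \<Rightarrow> 'p set \<Rightarrow> 'a \<Rightarrow>
   ('p set \<times> 'a) set" where
  "germ T F p U s =
     {(V, t). openin T V \<and> p \<in> V \<and> t \<in> carrier (Sec F V) \<and>
        (\<exists>W. openin T W \<and> p \<in> W \<and> W \<subseteq> U \<inter> V \<and> Res F U W s = Res F V W t)}"

text \<open>
  Operations on germs are computed on representatives; the unions below are unions of copies of
  one and the same germ.
\<close>

definition germ_add ::
  "'p topology \<Rightarrow> ('p, ('a, 'm) ring_scheme, 'a) presheaf \<Rightarrow> 'p \<Rightarrow>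
   ('p set \<times> 'a) set \<Rightarrow> ('p set \<times> 'a) set \<Rightarrow> ('p set \<times> 'a) set" where
  "germ_add T F p A B =
     (\<Union>(U, s) \<in> A. \<Union>(V, t) \<in> B.
        germ T F p (U \<inter> V) (Res F U (U \<inter> V) s \<oplus>\<^bsub>Sec F (U \<inter> V)\<^esub> Res F V (U \<inter> V) t))"

definition germ_mult ::
  "'p topology \<Rightarrow> ('p, ('a, 'm) ring_scheme, 'a) presheaf \<Rightarrow> 'p \<Rightarrow>
   ('p set \<times> 'a) set \<Rightarrow> ('p set \<times> 'a) set \<Rightarrow> ('p set \<times> 'a) set" where
  "germ_mult T F p A B =
     (\<Union>(U, s) \<in> A. \<Union>(V, t) \<in> B.
        germ T F p (U \<inter> V) (Res F U (U \<inter> V) s \<otimes>\<^bsub>Sec F (U \<inter> V)\<^esub> Res F V (U \<inter> V) t))"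

definition germ_smult ::
  "('p, 'r) ringed_space \<Rightarrow> ('p, 'r, 'a) mod_presheaf \<Rightarrow> 'p \<Rightarrow> 'p set \<Rightarrow> 'r \<Rightarrow>
   ('p set \<times> 'a) set \<Rightarrow> ('p set \<times> 'a) set" where
  "germ_smult X F p U r A =
     (\<Union>(V, t) \<in> A. germ (Top X) F p (U \<inter> V)
        (Res (Str X) U (U \<inter> V) r \<odot>\<^bsub>Sec F (U \<inter> V)\<^esub> Res F V (U \<inter> V) t))"

definition stalk_ring :: "('p, 'r) ringed_space \<Rightarrow> 'p \<Rightarrow> ('p set \<times> 'r) set ring" where
  "stalk_ring X p =
     \<lparr> carrier = {germ (Top X) (Str X) p U s | U s.
                    is_open X U \<and> p \<in> U \<and> s \<in> carrier (ring_at X U)},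
       monoid.mult = germ_mult (Top X) (Str X) p,
       one = germ (Top X) (Str X) p (points X) \<one>\<^bsub>ring_at X (points X)\<^esub>,
       ring.zero = germ (Top X) (Str X) p (points X) \<zero>\<^bsub>ring_at X (points X)\<^esub>,
       add = germ_add (Top X) (Str X) p \<rparr>"


section \<open>Closed subschemes and local complete intersections\<close>

definition ideal_as_module ::
  "('p, 'r) ringed_space \<Rightarrow> ('p set \<Rightarrow> 'r set) \<Rightarrow> ('p, 'r, 'r) mod_presheaf" where
  "ideal_as_module X I =
     \<lparr> Sec = (\<lambda>U. \<lparr> carrier = I U, monoid.mult = undefined, one = undefined,
                    ring.zero = \<zero>\<^bsub>ring_at X U\<^esub>,
                    add = (\<lambda>s t. s \<oplus>\<^bsub>ring_at X U\<^esub> t),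
                    module.smult = (\<lambda>r s. r \<otimes>\<^bsub>ring_at X U\<^esub> s) \<rparr>),
       Res = Res (Str X) \<rparr>"

text \<open>
  A closed subscheme of a scheme \<open>X\<close> is given by its ideal sheaf \<open>I\<close>, a quasi-coherent sheaf of
  ideals of the structure sheaf; its underlying set is the support of the quotient by \<open>I\<close>, and it
  is empty exactly when \<open>I\<close> is the whole structure sheaf.
\<close>

definition closed_subscheme :: "('p, 'r) ringed_space \<Rightarrow> ('p set \<Rightarrow> 'r set) \<Rightarrow> bool" where
  "closed_subscheme X I \<longleftrightarrow>
     (\<forall>U. is_open X U \<longrightarrow> ideal (I U) (ring_at X U)) \<and>
     quasi_coherent_sheaf X (ideal_as_module X I)"

definition ideal_stalk ::
  "('p, 'r) ringed_space \<Rightarrow> ('p set \<Rightarrow> 'r set) \<Rightarrow> 'p \<Rightarrow> ('p set \<times> 'r) set set" where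
  "ideal_stalk X I p = {germ (Top X) (Str X) p U s | U s. is_open X U \<and> p \<in> U \<and> s \<in> I U}"

definition subscheme_points :: "('p, 'r) ringed_space \<Rightarrow> ('p set \<Rightarrow> 'r set) \<Rightarrow> 'p set" where
  "subscheme_points X I = {p \<in> points X. ideal_stalk X I p \<noteq> carrier (stalk_ring X p)}"

text \<open>Each element is a nonzerodivisor modulo its predecessors, and the quotient is nonzero.\<close>

definition regular_sequence :: "('a, 'm) ring_scheme \<Rightarrow> 'a list \<Rightarrow> bool" where
  "regular_sequence R xs \<longleftrightarrow>
     set xs \<subseteq> carrier R \<and>
     (\<forall>i < length xs. \<forall>a \<in> carrier R.
        xs ! i \<otimes>\<^bsub>R\<^esub> a \<in> genideal R (set (take i xs)) \<longrightarrow> a \<in> genideal R (set (take i xs))) \<and>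
     genideal R (set xs) \<noteq> carrier R"

definition lci_codim_two :: "('p, 'r) ringed_space \<Rightarrow> ('p set \<Rightarrow> 'r set) \<Rightarrow> bool" where
  "lci_codim_two X I \<longleftrightarrow>
     closed_subscheme X I \<and>
     (\<forall>p \<in> subscheme_points X I. \<exists>f g.
        regular_sequence (stalk_ring X p) [f, g] \<and>
        ideal_stalk X I p = genideal (stalk_ring X p) {f, g})"


section \<open>Tensor products\<close>

text \<open>
  The tensor product of two modules over a commutative ring, as the quotient of the free abelian
  group on pairs by the usual bilinearity relations; its elements are cosets.
\<close>

definition tensor_relations ::
  "('r, 'k) ring_scheme \<Rightarrow> ('r, 'a) module \<Rightarrow> ('r, 'b) module \<Rightarrow> ('a \<times> 'b \<Rightarrow>\<^sub>0 int) set" where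
  "tensor_relations R M N =
     generate (free_Abelian_group (carrier M \<times> carrier N))
       ({frag_of (m \<oplus>\<^bsub>M\<^esub> m', n) - frag_of (m, n) - frag_of (m', n) | m m' n.
           m \<in> carrier M \<and> m' \<in> carrier M \<and> n \<in> carrier N} \<union>
        {frag_of (m, n \<oplus>\<^bsub>N\<^esub> n') - frag_of (m, n) - frag_of (m, n') | m n n'.
           m \<in> carrier M \<and> n \<in> carrier N \<and> n' \<in> carrier N} \<union>
        {frag_of (r \<odot>\<^bsub>M\<^esub> m, n) - frag_of (m, r \<odot>\<^bsub>N\<^esub> n) | r m n.
           r \<in> carrier R \<and> m \<in> carrier M \<and> n \<in> carrier N})"

definition tensor_group ::
  "('r, 'k) ring_scheme \<Rightarrow> ('r, 'a) module \<Rightarrow> ('r, 'b) module \<Rightarrow> ('a \<times> 'b \<Rightarrow>\<^sub>0 int) set monoid" where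
  "tensor_group R M N = free_Abelian_group (carrier M \<times> carrier N) Mod tensor_relations R M N"

text \<open>
  The map between two such quotients induced by \<open>h\<close> on pairs, where \<open>R\<close>, \<open>M\<close>, \<open>N\<close> belong to the
  target. All the cosets in the union coincide when \<open>h\<close> respects the relations.
\<close>

definition tensor_map ::
  "('r, 'k) ring_scheme \<Rightarrow> ('r, 'a) module \<Rightarrow> ('r, 'b) module \<Rightarrow> ('a \<times> 'b \<Rightarrow> 'a \<times> 'b) \<Rightarrow>
   ('a \<times> 'b \<Rightarrow>\<^sub>0 int) set \<Rightarrow> ('a \<times> 'b \<Rightarrow>\<^sub>0 int) set" where
  "tensor_map R M N h C =
     (\<Union>c \<in> C. tensor_relations R M N
        #>\<^bsub>free_Abelian_group (carrier M \<times> carrier N)\<^esub> frag_extend (\<lambda>x. frag_of (h x)) c)"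

definition tensor_module ::
  "('r, 'k) ring_scheme \<Rightarrow> ('r, 'a) module \<Rightarrow> ('r, 'b) module \<Rightarrow>
   ('r, ('a \<times> 'b \<Rightarrow>\<^sub>0 int) set) module" where
  "tensor_module R M N =
     \<lparr> carrier = carrier (tensor_group R M N), monoid.mult = undefined, one = undefined,
       ring.zero = \<one>\<^bsub>tensor_group R M N\<^esub>,
       add = (\<lambda>C D. C \<otimes>\<^bsub>tensor_group R M N\<^esub> D),
       module.smult = (\<lambda>r. tensor_map R M N (\<lambda>(m, n). (r \<odot>\<^bsub>M\<^esub> m, n))) \<rparr>"

definition tensor_presheaf ::
  "('p, 'r) ringed_space \<Rightarrow> ('p, 'r, 'a) mod_presheaf \<Rightarrow> ('p, 'r, 'b) mod_presheaf \<Rightarrow>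
   ('p, 'r, ('a \<times> 'b \<Rightarrow>\<^sub>0 int) set) mod_presheaf" where
  "tensor_presheaf X F G =
     \<lparr> Sec = (\<lambda>U. tensor_module (ring_at X U) (Sec F U) (Sec G U)),
       Res = (\<lambda>U V. tensor_map (ring_at X V) (Sec F V) (Sec G V)
                (\<lambda>(s, t). (Res F U V s, Res G U V t))) \<rparr>"

text \<open>
  The sheaf associated with a presheaf of modules: its sections on \<open>U\<close> are the functions that
  assign to each point of \<open>U\<close> a germ at that point and are locally given by sections.
\<close>

definition sheafification ::
  "('p, 'r) ringed_space \<Rightarrow> ('p, 'r, 'a) mod_presheaf \<Rightarrow>
   ('p, 'r, 'p \<Rightarrow> ('p set \<times> 'a) set) mod_presheaf" where
  "sheafification X F =
     \<lparr> Sec = (\<lambda>U. \<lparr> carrier = {s \<in> extensional U. \<forall>p \<in> U. \<exists>V t.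
                       is_open X V \<and> p \<in> V \<and> V \<subseteq> U \<and> t \<in> carrier (Sec F V) \<and>
                       (\<forall>q \<in> V. s q = germ (Top X) F q V t)},
                    monoid.mult = undefined, one = undefined,
                    ring.zero = (\<lambda>p\<in>U. germ (Top X) F p U \<zero>\<^bsub>Sec F U\<^esub>),
                    add = (\<lambda>s t. \<lambda>p\<in>U. germ_add (Top X) F p (s p) (t p)),
                    module.smult = (\<lambda>r s. \<lambda>p\<in>U. germ_smult X F p U r (s p)) \<rparr>),
       Res = (\<lambda>U V s. restrict s V) \<rparr>"

definition tensor_sheaf ::
  "('p, 'r) ringed_space \<Rightarrow> ('p, 'r, 'a) mod_presheaf \<Rightarrow> ('p, 'r, 'b) mod_presheaf \<Rightarrow>
   ('p, 'r, 'p \<Rightarrow> ('p set \<times> ('a \<times> 'b \<Rightarrow>\<^sub>0 int) set) set) mod_presheaf" where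
  "tensor_sheaf X F G = sheafification X (tensor_presheaf X F G)"


section \<open>The projective line over the integers\<close>

text \<open>
  The projective line is \<open>Proj S\<close> for \<open>S = \<int>[x, y]\<close>, graded by total degree. The ring \<open>S\<close> is
  \<^typ>\<open>int poly poly\<close>, the coefficient of \<open>x^j y^i\<close> in \<open>f\<close> being \<open>coeff (coeff f i) j\<close>.
\<close>

type_synonym zxy = "int poly poly"

abbreviation ZXY :: "zxy ring" where
  "ZXY \<equiv> ring_of_type_algebra"

definition homogeneous :: "nat \<Rightarrow> zxy \<Rightarrow> bool" where
  "homogeneous d f \<longleftrightarrow> (\<forall>i j. coeff (coeff f i) j \<noteq> 0 \<longrightarrow> i + j = d)"

definition homogeneous_ideal :: "zxy set \<Rightarrow> bool" where
  "homogeneous_ideal I \<longleftrightarrow> ideal I ZXY \<and> I = genideal ZXY {f \<in> I. \<exists>d. homogeneous d f}"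

definition irrelevant_ideal :: "zxy set" where
  "irrelevant_ideal = genideal ZXY {f. \<exists>d > 0. homogeneous d f}"

definition Proj_ZXY :: "zxy set set" where
  "Proj_ZXY = {P. primeideal P ZXY \<and> homogeneous_ideal P \<and> \<not> irrelevant_ideal \<subseteq> P}"

text \<open>The Zariski topology, generated by the distinguished open sets \<open>D\<^sub>+(f)\<close>.\<close>

definition Proj_topology :: "zxy set topology" where
  "Proj_topology =
     topology_generated_by {{P \<in> Proj_ZXY. f \<notin> P} | f. \<exists>d. homogeneous d f}"

text \<open>
  As \<open>S\<close> is a domain, the degree-\<open>n\<close> part of the localisation of \<open>S\<close> at the homogeneous elements
  outside \<open>P\<close> is a subgroup of the fraction field of \<open>S\<close>, consisting of the quotients \<open>g / h\<close> of
  homogeneous elements with \<open>h \<notin> P\<close> and \<open>deg g = deg h + n\<close>. A section over \<open>U\<close> of the sheaf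
  associated with the graded module \<open>S(n)\<close> is a function on \<open>U\<close> that is locally such a quotient.
\<close>

type_synonym zxy_section = "zxy set \<Rightarrow> zxy fract"

definition twist_sections :: "int \<Rightarrow> zxy set set \<Rightarrow> zxy_section set" where
  "twist_sections n U =
     {s \<in> extensional U. \<forall>P \<in> U. \<exists>V g h d e.
        openin Proj_topology V \<and> P \<in> V \<and> V \<subseteq> U \<and>
        homogeneous d g \<and> homogeneous e h \<and> int d = int e + n \<and>
        (\<forall>Q \<in> V. h \<notin> Q \<and> s Q = Fract g h)}"

definition P1Z :: "(zxy set, zxy_section) ringed_space" where
  "P1Z =
     \<lparr> Top = Proj_topology,
       Str = \<lparr> Sec = (\<lambda>U. \<lparr> carrier = twist_sections 0 U,
                            monoid.mult = (\<lambda>s t. \<lambda>P\<in>U. s P * t P),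
                            one = (\<lambda>P\<in>U. 1),
                            ring.zero = (\<lambda>P\<in>U. 0),
                            add = (\<lambda>s t. \<lambda>P\<in>U. s P + t P) \<rparr>),
               Res = (\<lambda>U V s. restrict s V) \<rparr> \<rparr>"

definition twisting_sheaf :: "int \<Rightarrow> (zxy set, zxy_section, zxy_section) mod_presheaf" where
  "twisting_sheaf n =
     \<lparr> Sec = (\<lambda>U. \<lparr> carrier = twist_sections n U, monoid.mult = undefined, one = undefined,
                    ring.zero = (\<lambda>P\<in>U. 0),
                    add = (\<lambda>s t. \<lambda>P\<in>U. s P + t P),
                    module.smult = (\<lambda>r s. \<lambda>P\<in>U. r P * s P) \<rparr>),
       Res = (\<lambda>U V s. restrict s V) \<rparr>"

definition twisted_ideal_sheaf ::
  "(zxy set set \<Rightarrow> zxy_section set) \<Rightarrow> int \<Rightarrow>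
   (zxy set, zxy_section,
    zxy set \<Rightarrow> (zxy set set \<times> (zxy_section \<times> zxy_section \<Rightarrow>\<^sub>0 int) set) set) mod_presheaf" where
  "twisted_ideal_sheaf I b = tensor_sheaf P1Z (ideal_as_module P1Z I) (twisting_sheaf b)"

end

theory Submission
  imports Defs "HOL-Library.Product_Plus"
begin

text \<open>
  A nonzero section \<open>s\<close> of \<open>E(-a)\<close> that is not divisible by any irreducible form vanishes in
  codimension two only. Wedging with \<open>s\<close> then identifies \<open>E / \<O>(a)\<close> with \<open>I\<^sub>Z(b)\<close>, where \<open>Z\<close> is the
  zero scheme of \<open>s\<close> and \<open>a + b\<close> is the degree of \<open>det E\<close>; the Koszul relation shows that \<open>Z\<close> is a
  local complete intersection. Any nonzero section becomes primitive after division by finitely many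
  irreducible forms, which only increases \<open>a\<close>, so it remains to find one with \<open>2a\<close> at least the
  degree of \<open>det E\<close>. To this end take two independent sections of \<open>E(m)\<close> and \<open>E(n)\<close> along whose
  degeneracy divisor the degree in \<open>y\<close>, and then the total degree, is minimal. If the divisor were not
  supported on vertical fibres, the two sections could be recombined, modulo a prime form in it, to
  a pair with smaller divisor; hence \<open>m + n\<close> is minus the degree of \<open>det E\<close>, and one of the two
  sections will do. Since \<open>\<int>[x, y]\<close> is factorial, regularity can be tested in codimension one
  throughout, and all sheaves are handled as families of lattices in their generic fibres.
\<close>

section \<open>Homogeneous polynomials\<close>

text \<open>Over a field every bundle on the projective line splits. Over \<int> the fibres above
  different primes may split differently, so no such normal form is at hand; \<open>Z\<close>
  absorbs what fails to split. The degree in \<open>y\<close> is minimised first because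
  recombination modulo a prime form \<open>p\<close> rests on division by \<open>p\<close> in the
  variable \<open>y\<close> over \<int>[x], which is not a field. Clearing leading coefficients
  brings in forms in \<open>x\<close>; these may raise the total degree of the divisor, but not its
  degree in \<open>y\<close>. A form of degree 0 in \<open>y\<close> is an integer times a power of
  \<open>x\<close>, so the only horizontal component left is \<open>x = 0\<close>, a copy of Spec
  \<int> on which forms are integers times powers of \<open>y\<close> and no division is called for.
  The remaining integer factors are vertical fibres; having degree 0, they do not affect the sum of
  the two twists. The fraction field of all of \<int>[x, y] serves as ambient field, so that the
  stalks of all twists lie in one field and differ only in the prescribed degree.\<close>

definition component :: "nat \<Rightarrow> zxy \<Rightarrow> zxy" where
  "component n f = (\<Sum>i\<le>n. monom (monom (coeff (coeff f i) (n - i)) (n - i)) i)"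

lemma coeff_component:
  "coeff (coeff (component n f) i) j = (if i + j = n then coeff (coeff f i) j else 0)"
proof -
  have "coeff (coeff (component n f) i) j =
      (\<Sum>k\<le>n. if k = i then (if n - k = j then coeff (coeff f k) (n - k) else 0) else 0)"
    unfolding component_def coeff_sum by (intro sum.cong) auto
  then show ?thesis by (auto simp: sum.delta)
qed

lemma zxy_eqI: "(\<And>i j. coeff (coeff f i) j = coeff (coeff g i) j) \<Longrightarrow> f = (g :: zxy)"
  by (intro poly_eqI) auto

lemma coeff_coeff_mult:
  "coeff (coeff (f * g) k) l =
     (\<Sum>i\<le>k. \<Sum>j\<le>l. coeff (coeff f i) j * coeff (coeff g (k - i)) (l - j))" for f g :: zxy
  by (simp add: coeff_mult coeff_sum)

lemma component_mult: "component n (f * g) = (\<Sum>m\<le>n. component m f * component (n - m) g)"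
proof (rule zxy_eqI)
  fix k l
  let ?F = "\<lambda>i j. coeff (coeff f i) j * coeff (coeff g (k - i)) (l - j)"
  have "coeff (coeff (\<Sum>m\<le>n. component m f * component (n - m) g) k) l =
     (\<Sum>m\<le>n. \<Sum>i\<le>k. \<Sum>j\<le>l. if i + j = m \<and> (k - i) + (l - j) = n - m then ?F i j else 0)"
    unfolding coeff_sum coeff_coeff_mult coeff_component by (intro sum.cong) auto
  also have "\<dots> = (\<Sum>i\<le>k. \<Sum>m\<le>n. \<Sum>j\<le>l. if i + j = m \<and> (k - i) + (l - j) = n - m then ?F i j else 0)"
    by (rule sum.swap)
  also have "\<dots> = (\<Sum>i\<le>k. \<Sum>j\<le>l. \<Sum>m\<le>n. if i + j = m \<and> (k - i) + (l - j) = n - m then ?F i j else 0)"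
    by (intro sum.cong sum.swap refl)
  also have "\<dots> = (\<Sum>i\<le>k. \<Sum>j\<le>l. if k + l = n then ?F i j else 0)"
  proof (intro sum.cong refl)
    fix i j assume ij: "i \<in> {..k}" "j \<in> {..l}"
    \<comment> \<open>Only \<open>m = i + j\<close> contributes, and for it the second condition
      becomes \<open>k + l = n\<close>.\<close>
    have "(\<Sum>m\<le>n. if i + j = m \<and> (k - i) + (l - j) = n - m then ?F i j else 0)
        = (\<Sum>m\<le>n. if i + j = m then (if k + l = n then ?F i j else 0) else 0)"
      using ij by (intro sum.cong) auto
    also have "\<dots> = (if k + l = n then ?F i j else 0)"
      using ij by (auto simp: sum.delta')
    finally show "(\<Sum>m\<le>n. if i + j = m \<and> (k - i) + (l - j) = n - m then ?F i j else 0)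
        = (if k + l = n then ?F i j else 0)" .
  qed
  also have "\<dots> = coeff (coeff (component n (f * g)) k) l"
    by (simp add: coeff_component coeff_coeff_mult)
  finally show "coeff (coeff (component n (f * g)) k) l =
    coeff (coeff (\<Sum>m\<le>n. component m f * component (n - m) g) k) l" by simp
qed

lemma homogeneous_iff_component: "homogeneous d f \<longleftrightarrow> component d f = f"
  unfolding homogeneous_def
proof
  assume "\<forall>i j. coeff (coeff f i) j \<noteq> 0 \<longrightarrow> i + j = d"
  then show "component d f = f" by (intro zxy_eqI) (auto simp: coeff_component)
next
  assume "component d f = f"
  then show "\<forall>i j. coeff (coeff f i) j \<noteq> 0 \<longrightarrow> i + j = d"
    by (metis coeff_component)
qed

lemma homogeneous_component_eq_0: "homogeneous d f \<Longrightarrow> m \<noteq> d \<Longrightarrow> component m f = 0"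
  unfolding homogeneous_def by (intro zxy_eqI) (auto simp: coeff_component)

lemma homogeneous_0 [simp]: "homogeneous d 0"
  by (auto simp: homogeneous_def)

lemma homogeneous_unique: "homogeneous d f \<Longrightarrow> homogeneous e f \<Longrightarrow> f \<noteq> 0 \<Longrightarrow> d = e"
  by (metis homogeneous_component_eq_0 homogeneous_iff_component)

lemma homogeneous_add: "homogeneous d f \<Longrightarrow> homogeneous d g \<Longrightarrow> homogeneous d (f + g)"
  unfolding homogeneous_def by (metis add.right_neutral coeff_add)

lemma homogeneous_uminus: "homogeneous d f \<Longrightarrow> homogeneous d (- f)"
  unfolding homogeneous_def by simp

lemma homogeneous_diff: "homogeneous d f \<Longrightarrow> homogeneous d g \<Longrightarrow> homogeneous d (f - g)"
  using homogeneous_add[OF _ homogeneous_uminus] by (metis diff_conv_add_uminus)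

lemma homogeneous_mult:
  assumes "homogeneous d f" "homogeneous e g" shows "homogeneous (d + e) (f * g)"
proof -
  have "component (d + e) (f * g) = (\<Sum>m\<le>d + e. if m = d then f * g else 0)"
    unfolding component_mult
  proof (intro sum.cong refl)
    fix m assume "m \<in> {..d + e}"
    show "component m f * component (d + e - m) g = (if m = d then f * g else 0)"
    proof (cases "m = d")
      case True
      have "component d f = f" "component e g = g"
        using assms by (auto simp: homogeneous_iff_component)
      then show ?thesis using True by simp
    qed (use assms homogeneous_component_eq_0 in auto)
  qed
  then show ?thesis by (simp add: homogeneous_iff_component)
qed

lemma homogeneous_1 [simp]: "homogeneous 0 1"
  unfolding homogeneous_def by (auto simp: one_pCons coeff_pCons split: nat.splits)

lemma homogeneous_power: "homogeneous d f \<Longrightarrow> homogeneous (n * d) (f ^ n)"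
  by (induction n) (auto intro: homogeneous_mult)

lemma homogeneous_of_int [simp]: "homogeneous 0 (of_int m)"
  unfolding homogeneous_def by (auto simp: of_int_poly coeff_pCons split: nat.splits)

lemma finite_components: "finite {m. component m f \<noteq> 0}"
proof -
  have "{m. component m f \<noteq> 0} \<subseteq> (\<lambda>(i, j). i + j) ` (SIGMA i:{..degree f}. {..degree (coeff f i)})"
  proof
    fix m assume "m \<in> {m. component m f \<noteq> 0}"
    then have "component m f \<noteq> 0" by simp
    then obtain i j where "coeff (coeff (component m f) i) j \<noteq> 0"
      using zxy_eqI[of "component m f" 0] by auto
    then have ij: "i + j = m" "coeff (coeff f i) j \<noteq> 0"
      by (auto simp: coeff_component split: if_splits)
    then have "i \<le> degree f" "j \<le> degree (coeff f i)" by (auto intro: le_degree)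
    then show "m \<in> (\<lambda>(i, j). i + j) ` (SIGMA i:{..degree f}. {..degree (coeff f i)})"
      using ij by force
  qed
  then show ?thesis by (rule finite_subset) auto
qed

lemma component_nonzero_ex: "f \<noteq> 0 \<Longrightarrow> \<exists>m. component m f \<noteq> 0"
proof (rule ccontr)
  assume f: "f \<noteq> 0" and "\<nexists>m. component m f \<noteq> 0"
  then have "coeff (coeff f i) j = 0" for i j
    using coeff_component[of "i + j" f i j] by simp
  then show False using f zxy_eqI[of f 0] by simp
qed

text \<open>The product of the lowest, as of the highest, components of two factors survives.\<close>

lemma homogeneous_factor:
  assumes fg: "homogeneous n (f * g)" "f * g \<noteq> 0"
  shows "\<exists>d. homogeneous d f"
proof -
  define S T where "S = {m. component m f \<noteq> 0}" and "T = {m. component m g \<noteq> 0}"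
  have fin: "finite S" "finite T" and ne: "S \<noteq> {}" "T \<noteq> {}"
    using finite_components component_nonzero_ex fg by (auto simp: S_def T_def)
  \<comment> \<open>If \<open>a + b\<close> arises in only one way as a sum of a degree of
    \<open>f\<close> and a degree of \<open>g\<close>, then component \<open>a + b\<close> of the
    product is a single nonzero product, so it must sit in degree \<open>n\<close>.\<close>
  have *: "a + b = n" if "a \<in> S" "b \<in> T"
    "\<And>m. m \<le> a + b \<Longrightarrow> m \<in> S \<Longrightarrow> a + b - m \<in> T \<Longrightarrow> m = a" for a b
  proof (rule ccontr)
    assume "a + b \<noteq> n"
    then have "0 = component (a + b) (f * g)"
      using fg homogeneous_component_eq_0 by metis
    also have "\<dots> = (\<Sum>m\<le>a + b. if m = a then component a f * component b g else 0)"
      unfolding component_mult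
    proof (intro sum.cong refl)
      fix m assume m: "m \<in> {..a + b}"
      show "component m f * component (a + b - m) g =
        (if m = a then component a f * component b g else 0)"
        using that(3)[of m] m by (auto simp: S_def T_def)
    qed
    also have "\<dots> = component a f * component b g" by simp
    finally show False using that(1,2) by (simp add: S_def T_def)
  qed
  have "Min S + Min T = n"
    using fin ne
  proof (intro *)
    fix m assume "m \<le> Min S + Min T" "m \<in> S" "Min S + Min T - m \<in> T"
    then have "Min S \<le> m" "Min T \<le> Min S + Min T - m" using fin by auto
    then show "m = Min S" using \<open>m \<le> Min S + Min T\<close> by arith
  qed auto
  moreover have "Max S + Max T = n"
    using fin ne
  proof (intro *)
    fix m assume "m \<le> Max S + Max T" "m \<in> S" "Max S + Max T - m \<in> T"
    then have "m \<le> Max S" "Max S + Max T - m \<le> Max T" using fin by auto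
    then show "m = Max S" using \<open>m \<le> Max S + Max T\<close> by arith
  qed auto
  moreover have "Min S \<le> Max S" "Min T \<le> Max T" using fin ne by auto
  \<comment> \<open>Both extreme sums equal \<open>n\<close>, which leaves no room for a second
    degree in \<open>f\<close>.\<close>
  ultimately have "Min S = Max S" by arith
  then have S: "S = {Min S}" using fin ne
    by (metis Max_ge Min_in Min_le insert_absorb is_singletonI' is_singleton_def le_antisym singletonD)
  have "homogeneous (Min S) f"
    unfolding homogeneous_def
  proof (intro allI impI)
    fix i j assume "coeff (coeff f i) j \<noteq> 0"
    then have "component (i + j) f \<noteq> 0" by (metis coeff_0 coeff_component)
    then show "i + j = Min S" using S by (auto simp: S_def)
  qed
  then show ?thesis ..
qed

lemma homogeneous_dvd:
  assumes "homogeneous n f" "f \<noteq> 0" "g dvd f"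
  obtains d where "homogeneous d g"
  using assms homogeneous_factor by (metis dvdE)

lemma homogeneous_cofactor:
  assumes "homogeneous n (f * g)" "f * g \<noteq> 0" "homogeneous d f"
  shows "d \<le> n" "homogeneous (n - d) g"
proof -
  obtain e where e: "homogeneous e g"
    using homogeneous_factor[of n g f] assms by (auto simp: mult.commute)
  have "homogeneous (d + e) (f * g)" using e assms by (intro homogeneous_mult)
  then have "n = d + e" using assms homogeneous_unique by blast
  then show "d \<le> n" "homogeneous (n - d) g" using e by auto
qed

definition xx :: zxy where "xx = [:[:0, 1:]:]"
definition yy :: zxy where "yy = [:0, 1:]"

lemma homogeneous_xx [simp]: "homogeneous (Suc 0) xx"
  by (auto simp: homogeneous_def xx_def coeff_pCons split: nat.splits)

lemma homogeneous_yy [simp]: "homogeneous (Suc 0) yy"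
  by (auto simp: homogeneous_def yy_def coeff_pCons one_pCons split: nat.splits)

lemma xx_nonzero [simp]: "xx \<noteq> 0" and yy_nonzero [simp]: "yy \<noteq> 0"
  by (auto simp: xx_def yy_def)

lemma xx_dvd_iff: "xx dvd f \<longleftrightarrow> (\<forall>i. coeff (coeff f i) 0 = 0)"
proof -
  have "xx dvd f \<longleftrightarrow> (\<forall>i. [:0, 1:] dvd coeff f i)"
    unfolding xx_def const_poly_dvd_iff ..
  also have "\<dots> \<longleftrightarrow> (\<forall>i. coeff (coeff f i) 0 = 0)"
    by (simp add: dvd_iff_poly_eq_0 poly_0_coeff_0 flip: minus_pCons)
  finally show ?thesis .
qed

lemma yy_dvd_iff: "yy dvd f \<longleftrightarrow> coeff f 0 = 0"
  unfolding yy_def using dvd_iff_poly_eq_0[of 0 f] by (simp add: poly_0_coeff_0)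

section \<open>Points and local rings of the projective line\<close>

lemma ZXY_simps [simp]:
  "carrier ZXY = UNIV" "a \<otimes>\<^bsub>ZXY\<^esub> b = a * b" "a \<oplus>\<^bsub>ZXY\<^esub> b = a + b" "\<one>\<^bsub>ZXY\<^esub> = 1" "\<zero>\<^bsub>ZXY\<^esub> = 0"
  by (simp_all add: ring_of_type_algebra_def)

lemma cring_ZXY: "cring ZXY" by (rule cring_from_type_algebra)
lemma ring_ZXY: "ring ZXY" by (rule ring_from_type_algebra)

lemma ideal_ZXY_iff:
  "ideal I ZXY \<longleftrightarrow> 0 \<in> I \<and> (\<forall>a\<in>I. \<forall>b\<in>I. a + b \<in> I) \<and> (\<forall>a\<in>I. \<forall>r. r * a \<in> I)"
proof
  assume "ideal I ZXY"
  then interpret ideal I ZXY .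
  show "0 \<in> I \<and> (\<forall>a\<in>I. \<forall>b\<in>I. a + b \<in> I) \<and> (\<forall>a\<in>I. \<forall>r. r * a \<in> I)"
    using additive_subgroup.zero_closed[OF additive_subgroup_axioms]
      additive_subgroup.a_closed[OF additive_subgroup_axioms] I_l_closed by auto
next
  assume I: "0 \<in> I \<and> (\<forall>a\<in>I. \<forall>b\<in>I. a + b \<in> I) \<and> (\<forall>a\<in>I. \<forall>r. r * a \<in> I)"
  have inv: "inv\<^bsub>add_monoid ZXY\<^esub> a = - a" for a
    by (rule group.inv_equality[OF abelian_group.a_group[OF ring.is_abelian_group[OF ring_ZXY]]]) auto
  show "ideal I ZXY"
  proof (rule idealI[OF ring_ZXY])
    show "subgroup I (add_monoid ZXY)"
    proof (unfold_locales, goal_cases)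
      case (4 x)
      then have "- 1 * x \<in> I" using I by blast
      then show ?case unfolding inv by simp
    qed (use I in auto)
  qed (use I in \<open>auto simp: mult.commute\<close>)
qed

lemma genideal_ZXY_minimal: "ideal I ZXY \<Longrightarrow> S \<subseteq> I \<Longrightarrow> genideal ZXY S \<subseteq> I"
  by (rule ring.genideal_minimal[OF ring_ZXY])

lemma genideal_ZXY_self: "S \<subseteq> genideal ZXY S"
  by (rule ring.genideal_self[OF ring_ZXY]) auto

lemma genideal_ZXY_ideal: "ideal (genideal ZXY S) ZXY"
  by (rule ring.genideal_ideal[OF ring_ZXY]) auto

lemma homogeneous_zero_coeff:
  "homogeneous d f \<Longrightarrow> i + j \<noteq> d \<Longrightarrow> coeff (coeff f i) j = 0"
  by (auto simp: homogeneous_def)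

text \<open>In positive degree the part of \<open>f\<close> free of \<open>y\<close> has no constant
  term, so it is a multiple of \<open>x\<close>; the rest is a multiple of \<open>y\<close>. Hence
  the two coordinates generate the irrelevant ideal.\<close>

lemma homogeneous_linear_combination:
  assumes f: "homogeneous d f" "d > 0"
  obtains a b where "f = a * xx + b * yy"
proof -
  have "xx dvd [:coeff f 0:]"
    using homogeneous_zero_coeff[OF f(1), of 0 0] f(2)
    by (auto simp: xx_dvd_iff coeff_pCons split: nat.splits)
  then obtain a where a: "[:coeff f 0:] = xx * a" by (rule dvdE)
  have "yy dvd f - [:coeff f 0:]" by (simp add: yy_dvd_iff)
  then obtain b where b: "f - [:coeff f 0:] = yy * b" by (rule dvdE)
  have "f = [:coeff f 0:] + (f - [:coeff f 0:])" by simp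
  also have "\<dots> = xx * a + yy * b" by (simp only: b, simp only: a)
  finally show ?thesis using that by (simp add: mult.commute)
qed

text \<open>The last fact says that the charts where \<open>x\<close> or \<open>y\<close> is
  invertible cover the projective line; it is the source of all local generators of twists
  below.\<close>

lemma Proj_ZXY_D:
  assumes "P \<in> Proj_ZXY"
  shows Proj_zero: "0 \<in> P" and Proj_one: "1 \<notin> P"
    and Proj_add: "a \<in> P \<Longrightarrow> b \<in> P \<Longrightarrow> a + b \<in> P"
    and Proj_mult: "a \<in> P \<Longrightarrow> r * a \<in> P"
    and Proj_prime: "a * b \<in> P \<Longrightarrow> a \<in> P \<or> b \<in> P"
    and Proj_coord: "xx \<notin> P \<or> yy \<notin> P"
proof -
  have prim: "primeideal P ZXY" and irr: "\<not> irrelevant_ideal \<subseteq> P"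
    using assms by (auto simp: Proj_ZXY_def)
  interpret primeideal P ZXY by fact
  have P: "0 \<in> P \<and> (\<forall>a\<in>P. \<forall>b\<in>P. a + b \<in> P) \<and> (\<forall>a\<in>P. \<forall>r. r * a \<in> P)"
    using is_ideal unfolding ideal_ZXY_iff by blast
  show "0 \<in> P" "a \<in> P \<Longrightarrow> b \<in> P \<Longrightarrow> a + b \<in> P" "a \<in> P \<Longrightarrow> r * a \<in> P"
    using P by auto
  show "1 \<notin> P" using I_notcarr P by simp (metis UNIV_eq_I mult.right_neutral)
  show "a * b \<in> P \<Longrightarrow> a \<in> P \<or> b \<in> P" using I_prime by simp
  show "xx \<notin> P \<or> yy \<notin> P"
  proof (rule ccontr)
    assume "\<not> (xx \<notin> P \<or> yy \<notin> P)"
    then have xy: "xx \<in> P" "yy \<in> P" by auto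
    have "f \<in> P" if f: "homogeneous d f" "d > 0" for f d
    proof -
      obtain a b where "f = a * xx + b * yy" using homogeneous_linear_combination[OF f] .
      then show ?thesis using P xy by auto
    qed
    then have "irrelevant_ideal \<subseteq> P"
      unfolding irrelevant_ideal_def by (intro genideal_ZXY_minimal is_ideal) auto
    then show False using irr by simp
  qed
qed

lemma Proj_dvd: "P \<in> Proj_ZXY \<Longrightarrow> a \<in> P \<Longrightarrow> a dvd b \<Longrightarrow> b \<in> P"
  by (metis Proj_mult dvdE mult.commute)

lemma Proj_nonzero: "P \<in> Proj_ZXY \<Longrightarrow> h \<notin> P \<Longrightarrow> h \<noteq> 0"
  using Proj_zero by auto

definition pri :: "zxy \<Rightarrow> zxy set" where "pri p = {f. p dvd f}"

lemma mem_pri [simp]: "f \<in> pri p \<longleftrightarrow> p dvd f"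
  by (simp add: pri_def)

text \<open>The case \<open>p = 0\<close> is the generic point.\<close>

lemma pri_in_Proj:
  assumes p: "p = 0 \<or> prime_elem p" and hom: "homogeneous d p"
  shows "pri p \<in> Proj_ZXY"
proof -
  have id: "ideal (pri p) ZXY" by (auto simp: ideal_ZXY_iff)
  have nu: "\<not> p dvd 1" using p by auto
  have "pri p \<noteq> UNIV" using nu by (metis UNIV_I mem_pri)
  then have "primeideal (pri p) ZXY"
    by (intro primeidealI[OF id cring_ZXY]) (use p prime_elem_dvd_mult_iff in auto)
  moreover have "homogeneous_ideal (pri p)"
  proof -
    have "pri p \<subseteq> genideal ZXY {f \<in> pri p. \<exists>d. homogeneous d f}"
    proof
      fix f assume "f \<in> pri p"
      then obtain r where f: "f = r * p" by (metis mem_pri dvdE mult.commute)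
      have "p \<in> genideal ZXY {f \<in> pri p. \<exists>d. homogeneous d f}"
        using genideal_ZXY_self hom by fastforce
      then show "f \<in> genideal ZXY {f \<in> pri p. \<exists>d. homogeneous d f}"
        using genideal_ZXY_ideal unfolding f ideal_ZXY_iff by blast
    qed
    then show ?thesis
      unfolding homogeneous_ideal_def
      by (intro conjI equalityI id genideal_ZXY_minimal[OF id] Collect_subset)
  qed
  moreover have "\<not> irrelevant_ideal \<subseteq> pri p"
  proof
    assume "irrelevant_ideal \<subseteq> pri p"
    moreover have "z \<in> irrelevant_ideal" if "homogeneous (Suc 0) z" for z
      unfolding irrelevant_ideal_def
      by (rule subsetD[OF genideal_ZXY_self]) (use that in \<open>auto intro!: exI[of _ "Suc 0"]\<close>)
    ultimately have "xx \<in> pri p" "yy \<in> pri p" using homogeneous_xx homogeneous_yy by blast+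
    then have "p dvd xx" "p dvd yy" by auto
    then have p0: "p \<noteq> 0" by auto
    \<comment> \<open>A divisor of \<open>x\<close> has degree 0 in \<open>y\<close>; if it also
      divides \<open>y\<close>, it divides the leading coefficient 1 of \<open>y\<close> and is a
      unit.\<close>
    obtain q where q: "xx = p * q" using \<open>p dvd xx\<close> by (rule dvdE)
    then have "degree (p * q) = 0" by (simp flip: q add: xx_def)
    then have "degree p = 0" using q xx_nonzero by (subst (asm) degree_mult_eq) auto
    then obtain c where c: "p = [:c:]" by (rule degree_eq_zeroE)
    have "c dvd coeff yy 1" using \<open>p dvd yy\<close> unfolding c const_poly_dvd_iff by blast
    then have "c dvd 1" by (simp add: yy_def)
    then obtain b where "1 = c * b" by (rule dvdE)
    then have "p * [:b:] = [:1:]" unfolding c by (simp add: mult.commute)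
    then show False using nu by (metis dvd_triv_left one_pCons)
  qed
  ultimately show ?thesis by (simp add: Proj_ZXY_def)
qed

abbreviation eta :: "zxy set" where "eta \<equiv> pri 0"

lemma eta_in_Proj: "eta \<in> Proj_ZXY"
  by (rule pri_in_Proj[where d = 0]) auto

lemma eta_subset: "P \<in> Proj_ZXY \<Longrightarrow> eta \<subseteq> P"
  using Proj_zero by auto

text \<open>The stalk of \<open>\<O>(n)\<close> at \<open>P\<close>, as a subset of the function field of the affine cone.\<close>

definition loc :: "int \<Rightarrow> zxy set \<Rightarrow> zxy fract set" where
  "loc n P = {Fract g h | g h. \<exists>d e. homogeneous d g \<and> homogeneous e h \<and> int d = int e + n \<and> h \<notin> P}"

lemma locI: "homogeneous d g \<Longrightarrow> homogeneous e h \<Longrightarrow> int d = int e + n \<Longrightarrow> h \<notin> P \<Longrightarrow> Fract g h \<in> loc n P"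
  unfolding loc_def by blast

lemma locE:
  assumes "c \<in> loc n P"
  obtains g h d e where "c = Fract g h" "homogeneous d g" "homogeneous e h" "int d = int e + n" "h \<notin> P"
  using assms unfolding loc_def by blast

lemma loc_mono: "Q \<subseteq> P \<Longrightarrow> loc n P \<subseteq> loc n Q"
  unfolding loc_def by blast

lemma loc_uminus: "c \<in> loc n P \<Longrightarrow> - c \<in> loc n P"
  by (elim locE) (auto intro!: locI homogeneous_uminus)

lemma loc_mult:
  assumes "P \<in> Proj_ZXY" "b \<in> loc m P" "c \<in> loc n P"
  shows "b * c \<in> loc (m + n) P"
  using assms(2)
proof (elim locE)
  fix g h d e assume 1: "b = Fract g h" "homogeneous d g" "homogeneous e h" "int d = int e + m" "h \<notin> P"
  obtain g' h' d' e' where 2: "c = Fract g' h'" "homogeneous d' g'" "homogeneous e' h'"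
      "int d' = int e' + n" "h' \<notin> P"
    using assms(3) by (rule locE)
  show ?thesis
    using 1 2 Proj_prime[OF assms(1)] by (auto intro!: locI[of "d + d'" _ "e + e'"] homogeneous_mult)
qed

lemma loc_to_fract: "P \<in> Proj_ZXY \<Longrightarrow> homogeneous d f \<Longrightarrow> to_fract f \<in> loc (int d) P"
  unfolding to_fract_def by (rule locI[of d _ 0]) (auto simp: Proj_one)

lemma loc_inverse_to_fract:
  "P \<in> Proj_ZXY \<Longrightarrow> homogeneous d f \<Longrightarrow> f \<notin> P \<Longrightarrow> inverse (to_fract f) \<in> loc (- int d) P"
  unfolding to_fract_def by (simp, rule locI[of 0 _ d]) auto

lemma loc_1: "P \<in> Proj_ZXY \<Longrightarrow> 1 \<in> loc 0 P"
  using loc_to_fract[of P 0 1] by simp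

text \<open>The numerator 0 counts as homogeneous of every degree, but for negative \<open>n\<close>
  a denominator of degree at least \<open>- n\<close> outside \<open>P\<close> is still required; a
  power of a coordinate provides it.\<close>

lemma loc_0: assumes "P \<in> Proj_ZXY" shows "0 \<in> loc n P"
proof -
  obtain z where z: "z \<in> {xx, yy}" "z \<notin> P" using Proj_coord[OF assms] by auto
  then have hz: "homogeneous (k * Suc 0) (z ^ k)" for k by (intro homogeneous_power) auto
  have nz: "z ^ k \<notin> P" for k
    using z(2) Proj_prime[OF assms] Proj_one[OF assms] by (induction k) auto
  have "Fract 0 (z ^ nat (- n)) \<in> loc n P"
    by (rule locI[of "nat n" _ "nat (- n)"]) (use hz[of "nat (- n)"] nz in auto)
  moreover have "Fract 0 (z ^ nat (- n)) = 0"
    using nz Proj_zero[OF assms] by (auto simp: Zero_fract_def eq_fract)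
  ultimately show ?thesis by simp
qed

lemma loc_add:
  assumes P: "P \<in> Proj_ZXY" and b: "b \<in> loc n P" and c: "c \<in> loc n P"
  shows "b + c \<in> loc n P"
  using b
proof (rule locE)
  fix g h d e assume 1: "b = Fract g h" "homogeneous d g" "homogeneous e h" "int d = int e + n" "h \<notin> P"
  obtain g' h' d' e' where 2: "c = Fract g' h'" "homogeneous d' g'" "homogeneous e' h'"
      "int d' = int e' + n" "h' \<notin> P"
    using c by (rule locE)
  have "d + e' = d' + e" using 1 2 by linarith
  then have "homogeneous (d + e') (g' * h)" using homogeneous_mult[OF 2(2) 1(3)] by simp
  then have "homogeneous (d + e') (g * h' + g' * h)"
    using 1 2 by (intro homogeneous_add) (auto intro: homogeneous_mult)
  moreover have "h * h' \<notin> P" using 1 2 Proj_prime[OF P] by auto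
  moreover have "b + c = Fract (g * h' + g' * h) (h * h')"
    using 1 2 Proj_nonzero[OF P] by simp
  ultimately show ?thesis
    using 1 2 by (auto intro!: locI[of "d + e'" _ "e + e'"] homogeneous_mult)
qed

lemma loc_diff: "P \<in> Proj_ZXY \<Longrightarrow> b \<in> loc n P \<Longrightarrow> c \<in> loc n P \<Longrightarrow> b - c \<in> loc n P"
  using loc_add[OF _ _ loc_uminus] by (metis diff_conv_add_uminus)

lemma loc_mult0: "P \<in> Proj_ZXY \<Longrightarrow> b \<in> loc 0 P \<Longrightarrow> c \<in> loc n P \<Longrightarrow> b * c \<in> loc n P"
  using loc_mult[of P b 0 c n] by simp

section \<open>Factoriality and regularity in codimension one\<close>

text \<open>Divisors of a nonzero form are forms, so cancelling the greatest common divisor keeps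
  numerator and denominator homogeneous. Here factoriality of \<int>[x, y] enters.\<close>

lemma loc_lowest:
  assumes "c \<in> loc n eta" "c \<noteq> 0"
  obtains g h d e where "c = Fract g h" "homogeneous d g" "homogeneous e h" "int d = int e + n"
    "g \<noteq> 0" "h \<noteq> 0" "coprime g h"
proof -
  obtain g h d e where 1: "c = Fract g h" "homogeneous d g" "homogeneous e h" "int d = int e + n" "h \<noteq> 0"
    using assms(1) by (rule locE) (use that in auto)
  then have g0: "g \<noteq> 0" using assms(2) by (auto simp: Zero_fract_def eq_fract)
  define k where "k = gcd g h"
  have k0: "k \<noteq> 0" using g0 by (simp add: k_def)
  obtain g' h' where g': "g = k * g'" and h': "h = k * h'" 
    unfolding k_def by (meson dvdE gcd_dvd1 gcd_dvd2)
  obtain m where m: "homogeneous m k"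
    using homogeneous_dvd[OF 1(2) g0, of k] k_def by auto
  have "coprime g' h'" 
    using gcd_coprime[of g h g' h'] g' h' g0 k_def by (metis gcd_eq_0_iff mult.commute)
  moreover have "m \<le> d" "homogeneous (d - m) g'" "m \<le> e" "homogeneous (e - m) h'"
    using homogeneous_cofactor 1 g0 m g' h' by metis+
  moreover have "c = Fract g' h'" using 1(1) k0 unfolding g' h' by (simp add: mult_fract_cancel)
  ultimately show ?thesis
    using that[of g' h' "d - m" "e - m"] 1 g0 g' h' by auto
qed

text \<open>A denominator in lowest terms divides every other denominator of the same fraction, so
  this one decides regularity at all points simultaneously.\<close>

lemma loc_lowest_iff:
  assumes P: "P \<in> Proj_ZXY" and gh: "homogeneous d g" "homogeneous e h" "int d = int e + n"
    "h \<noteq> 0" "coprime g h"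
  shows "Fract g h \<in> loc n P \<longleftrightarrow> h \<notin> P"
proof
  assume "Fract g h \<in> loc n P"
  then obtain g' h' where "Fract g h = Fract g' h'" "h' \<notin> P" by (rule locE)
  then have "g * h' = g' * h" "h' \<notin> P" using gh Proj_nonzero[OF P] by (auto simp: eq_fract)
  then have "h dvd h'" using gh(5) by (metis coprime_commute coprime_dvd_mult_right_iff dvd_triv_right)
  then show "h \<notin> P" using \<open>h' \<notin> P\<close> Proj_dvd[OF P] by blast
qed (use gh locI in blast)

lemma prime_factor_in_point:
  assumes P: "P \<in> Proj_ZXY" and h: "homogeneous e h" "h \<noteq> 0" "h \<in> P"
  obtains p d where "prime_elem p" "homogeneous d p" "p dvd h" "p \<in> P"
proof -
  have "\<exists>p. prime_elem p \<and> p dvd h \<and> p \<in> P"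
    using h(2,3)
  proof (induction h rule: prime_divisors_induct)
    case (unit x)
    then show ?case using Proj_dvd[OF P, of x 1] Proj_one[OF P] by auto
  next
    case (factor p x)
    then show ?case using Proj_prime[OF P, of p x] by (auto intro: dvd_mult prime_imp_prime_elem)
  qed auto
  then show ?thesis using homogeneous_dvd[OF h(1,2)] that by metis
qed

text \<open>The locus where a fraction is not regular is the divisor of its reduced denominator. If
  that denominator lies in \<open>P\<close>, so does one of its prime factors, and along this factor
  the fraction already has a pole.\<close>

lemma loc_Hartogs:
  assumes P: "P \<in> Proj_ZXY" and c: "c \<in> loc n eta"
    and codim1: "\<And>p d. prime_elem p \<Longrightarrow> homogeneous d p \<Longrightarrow> p \<in> P \<Longrightarrow> c \<in> loc n (pri p)"
  shows "c \<in> loc n P"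
proof (cases "c = 0")
  case False
  obtain g h d e where gh: "c = Fract g h" "homogeneous d g" "homogeneous e h" "int d = int e + n"
    "g \<noteq> 0" "h \<noteq> 0" "coprime g h" using c False by (rule loc_lowest)
  have "h \<notin> P"
  proof
    assume "h \<in> P"
    then obtain p k where p: "prime_elem p" "homogeneous k p" "p dvd h" "p \<in> P"
      using prime_factor_in_point[OF P gh(3,6)] by metis
    then have "c \<in> loc n (pri p)" using codim1 by blast
    then have "h \<notin> pri p" using loc_lowest_iff[OF pri_in_Proj] p gh by metis
    then show False using p by simp
  qed
  then show ?thesis using gh locI by metis
qed (use P loc_0 in auto)

text \<open>A prime factor of the reduced denominator would be a pole at the corresponding
  codimension-one point, so the denominator is a unit. Thus global sections of \<O>(n) are forms of
  degree \<open>n\<close>, and for negative \<open>n\<close> only zero is left.\<close>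

lemma global_loc:
  assumes c: "\<And>P. P \<in> Proj_ZXY \<Longrightarrow> c \<in> loc n P" "c \<noteq> 0"
  obtains d f where "homogeneous d f" "int d = n" "c = to_fract f"
proof -
  obtain g h d e where gh: "c = Fract g h" "homogeneous d g" "homogeneous e h" "int d = int e + n"
    "g \<noteq> 0" "h \<noteq> 0" "coprime g h" using c eta_in_Proj by (metis loc_lowest)
  have "is_unit h"
  proof (rule ccontr)
    assume "\<not> is_unit h"
    then obtain p where p: "prime_elem p" "p dvd h"
      using prime_divisor_exists[OF gh(6)] by (auto intro: prime_imp_prime_elem)
    obtain k where k: "homogeneous k p" using homogeneous_dvd[OF gh(3,6) p(2)] .
    have "h \<notin> pri p" using loc_lowest_iff[OF pri_in_Proj] p gh k c(1)[OF pri_in_Proj] by metis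
    then show False using p by simp
  qed
  then obtain u where u: "1 = h * u" by (rule dvdE)
  have u0: "u \<noteq> 0" using u by auto
  have "homogeneous (0 - e) u" "e \<le> 0" using homogeneous_cofactor[of 0 h u e] u gh by auto
  then have "homogeneous d (g * u)" using homogeneous_mult[OF gh(2), of 0 u] by simp
  moreover have "c = to_fract (g * u)"
    unfolding gh(1) to_fract_def using u gh(6) by (simp add: eq_fract algebra_simps) 
  ultimately show ?thesis using that gh \<open>e \<le> 0\<close> by auto
qed

section \<open>Local generators and orders of vanishing\<close>

text \<open>Such a \<open>c\<close> generates the stalk of \<O>(n) at \<open>P\<close>. The
  condition \<open>c \<noteq> 0\<close> is stated explicitly because the inverse of 0 is 0.\<close>

definition loc_unit :: "int \<Rightarrow> zxy set \<Rightarrow> zxy fract \<Rightarrow> bool" where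
  "loc_unit n P c \<longleftrightarrow> c \<noteq> 0 \<and> c \<in> loc n P \<and> inverse c \<in> loc (- n) P"

lemma loc_unit_1: "P \<in> Proj_ZXY \<Longrightarrow> loc_unit 0 P 1"
  by (simp add: loc_unit_def loc_1)

lemma loc_unit_mult:
  "P \<in> Proj_ZXY \<Longrightarrow> loc_unit m P b \<Longrightarrow> loc_unit n P c \<Longrightarrow> loc_unit (m + n) P (b * c)"
  unfolding loc_unit_def using loc_mult[of P "inverse b" "- m" "inverse c" "- n"]
  by (auto intro: loc_mult)

lemma loc_unit_inverse: "loc_unit n P c \<Longrightarrow> loc_unit (- n) P (inverse c)"
  by (auto simp: loc_unit_def)

lemma loc_unit_divide:
  "P \<in> Proj_ZXY \<Longrightarrow> loc_unit m P b \<Longrightarrow> loc_unit n P c \<Longrightarrow> loc_unit (m - n) P (b / c)"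
  using loc_unit_mult[OF _ _ loc_unit_inverse] by (simp add: divide_inverse)

lemma loc_unit_powi: "P \<in> Proj_ZXY \<Longrightarrow> loc_unit m P b \<Longrightarrow> loc_unit (k * m) P (b powi k)"
proof (induction k rule: int_induct[where k = 0])
  case base
  then show ?case by (simp add: loc_unit_1)
next
  case (step1 i)
  then show ?case using loc_unit_mult[of P "i * m" "b powi i" m b]
    by (simp add: power_int_add_1 loc_unit_def[of m P b] distrib_right)
next
  case (step2 i)
  then show ?case using loc_unit_divide[of P "i * m" "b powi i" m b]
    by (simp add: power_int_diff loc_unit_def[of m P b] left_diff_distrib)
qed

lemma loc_unit_to_fract:
  "P \<in> Proj_ZXY \<Longrightarrow> homogeneous d f \<Longrightarrow> f \<notin> P \<Longrightarrow> loc_unit (int d) P (to_fract f)"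
  unfolding loc_unit_def using loc_to_fract loc_inverse_to_fract Proj_zero by auto

lemma loc_unit_cancel:
  assumes "P \<in> Proj_ZXY" "loc_unit m P b"
  shows "b * c \<in> loc (m + n) P \<longleftrightarrow> c \<in> loc n P"
proof
  assume "b * c \<in> loc (m + n) P"
  then have "inverse b * (b * c) \<in> loc (- m + (m + n)) P"
    using assms by (intro loc_mult[OF assms(1) _ \<open>b * c \<in> _\<close>]) (auto simp: loc_unit_def)
  moreover have "inverse b * (b * c) = c" using assms by (simp add: loc_unit_def flip: mult.assoc)
  ultimately show "c \<in> loc n P" by simp
qed (use assms loc_mult loc_unit_def in blast)

text \<open>On the chart of a coordinate \<open>z\<close> the power of \<open>z\<close> with
  exponent \<open>n\<close>, possibly negative, generates \<O>(n). As the two charts cover, every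
  twist has a generator at every point.\<close>

lemma loc_unit_gen:
  assumes "P \<in> Proj_ZXY" "z \<in> {xx, yy}" "z \<notin> P"
  shows "loc_unit n P (to_fract z powi n)"
  using loc_unit_powi[OF assms(1) loc_unit_to_fract[OF assms(1), of 1 z], of n] assms by auto

lemma ex_loc_unit: "P \<in> Proj_ZXY \<Longrightarrow> \<exists>g. loc_unit n P g"
  using loc_unit_gen Proj_coord by blast

text \<open>The local ring at \<open>pri p\<close> only sees divisibility by \<open>p\<close>: after
  cross-multiplication \<open>p\<close> divides the product of \<open>g\<close> with a denominator
  outside the prime ideal, hence \<open>g\<close>.\<close>

lemma loc_divide_prime_iff:
  assumes p: "prime_elem p" "homogeneous k p"
    and gh: "homogeneous d g" "homogeneous e h" "int d = int e + n" "h \<noteq> 0" "\<not> p dvd h"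
  shows "Fract g h / to_fract p \<in> loc (n - int k) (pri p) \<longleftrightarrow> p dvd g"
proof
  have PP: "pri p \<in> Proj_ZXY" using p pri_in_Proj by blast
  have p0: "p \<noteq> 0" using p by auto
  {
    assume "Fract g h / to_fract p \<in> loc (n - int k) (pri p)"
    then obtain g' h' where 1: "Fract g h / to_fract p = Fract g' h'" "h' \<notin> pri p" by (rule locE)
    moreover have "h' \<noteq> 0" "h * p \<noteq> 0" using 1 gh p0 by auto
    moreover have "Fract g h / to_fract p = Fract g (h * p)" by (simp add: to_fract_def)
    ultimately have "g * h' = g' * (h * p)" by (simp add: eq_fract)
    then have "p dvd g * h'" by simp
    then show "p dvd g" using p 1 prime_elem_dvd_mult_iff by auto
  }
  assume "p dvd g"
  then obtain g' where g': "g = p * g'" by (rule dvdE)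
  show "Fract g h / to_fract p \<in> loc (n - int k) (pri p)"
  proof (cases "g = 0")
    case True
    then show ?thesis using loc_0[OF PP] by (simp add: fract_collapse)
  next
    case False
    have "Fract g h / to_fract p = Fract g' h"
      unfolding g' to_fract_def using gh p0 by (simp add: eq_fract)
    moreover have "homogeneous (d - k) g'" "k \<le> d"
      using homogeneous_cofactor[of d p g' k] gh p g' False by auto
    ultimately show ?thesis using gh by (auto intro!: locI[of "d - k" _ e])
  qed
qed

lemma to_fract_power: "to_fract (a ^ n) = to_fract a ^ n"
  by (induction n) simp_all

text \<open>The point \<open>pri p\<close> behaves like a discrete valuation ring with uniformiser
  \<open>p\<close>, and \<open>v\<close> is the order of \<open>c\<close> there, found by removing
  the full power of \<open>p\<close> from numerator and denominator. Each factor \<open>p\<close>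
  shifts the degree by \<open>k\<close>.\<close>

lemma ex_valuation:
  assumes p: "prime_elem p" "homogeneous k p" and c: "c \<in> loc n eta" "c \<noteq> 0"
  shows "\<exists>v. loc_unit (n - v * int k) (pri p) (c * to_fract p powi (- v))"
proof -
  have PP: "pri p \<in> Proj_ZXY" using p pri_in_Proj by blast
  have p0: "p \<noteq> 0" using p by auto
  obtain g h d e where gh: "c = Fract g h" "homogeneous d g" "homogeneous e h" "int d = int e + n" "h \<noteq> 0" "g \<noteq> 0"
    using c by (metis loc_lowest)
  have dec: "\<exists>i f'. f = p ^ i * f' \<and> \<not> p dvd f' \<and> i * k \<le> d \<and> homogeneous (d - i * k) f'"
    if f: "homogeneous d f" "f \<noteq> 0" for f d
  proof -
    obtain f' where f': "f = p ^ multiplicity p f * f'" "\<not> p dvd f'"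
      using multiplicity_decompose'[OF f(2) prime_elem_not_unit[OF p(1)]] .
    have "homogeneous (multiplicity p f * k) (p ^ multiplicity p f)"
      using p by (intro homogeneous_power)
    then show ?thesis using homogeneous_cofactor[of d "p ^ multiplicity p f" f'] f f' by metis
  qed
  obtain i g' where i: "g = p ^ i * g'" "\<not> p dvd g'" "i * k \<le> d" "homogeneous (d - i * k) g'"
    using dec gh by metis
  obtain j h' where j: "h = p ^ j * h'" "\<not> p dvd h'" "j * k \<le> e" "homogeneous (e - j * k) h'"
    using dec gh by metis
  have c_eq: "c = to_fract p ^ i * to_fract g' / (to_fract p ^ j * to_fract h')"
    unfolding gh(1) i(1) j(1) Fract_conv_to_fract by (simp add: to_fract_power)
  have u: "loc_unit (int (d - i * k) - int (e - j * k)) (pri p) (to_fract g' / to_fract h')"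
    using i j PP by (intro loc_unit_divide loc_unit_to_fract) auto
  have "c * to_fract p powi (- (int i - int j)) = to_fract g' / to_fract h'"
    unfolding c_eq using p0 by (simp add: power_int_diff power_int_minus field_simps)
  moreover have "int (d - i * k) - int (e - j * k) = n - (int i - int j) * int k"
    using i j gh by (simp add: of_nat_diff algebra_simps)
  ultimately show ?thesis using u by metis
qed

section \<open>The Zariski topology\<close>

lemma topspace_Proj: "topspace Proj_topology = Proj_ZXY"
proof -
  have "{P \<in> Proj_ZXY. 1 \<notin> P} = Proj_ZXY" using Proj_one by auto
  then have "Proj_ZXY \<in> {{P \<in> Proj_ZXY. f \<notin> P} | f. \<exists>d. homogeneous d f}"
    using homogeneous_1 by blast
  then show ?thesis unfolding Proj_topology_def topology_generated_by_topspace by blast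
qed

definition Dplus :: "zxy \<Rightarrow> zxy set set" where
  "Dplus f = {P \<in> Proj_ZXY. f \<notin> P}"

lemma Dplus_mult: "Dplus (f * g) = Dplus f \<inter> Dplus g"
proof -
  have "f * g \<in> P \<longleftrightarrow> f \<in> P \<or> g \<in> P" if "P \<in> Proj_ZXY" for P
    using Proj_prime[OF that] Proj_mult[OF that, of f g] Proj_mult[OF that, of g f]
    by (auto simp: mult.commute)
  then show ?thesis by (auto simp: Dplus_def)
qed

lemma openin_Dplus: "homogeneous d f \<Longrightarrow> openin Proj_topology (Dplus f)"
  unfolding Proj_topology_def Dplus_def by (intro topology_generated_by_Basis) auto

text \<open>The sets \<open>Dplus f\<close> are closed under intersection by
  \<open>Dplus_mult\<close>, so the generating family is a basis and not only a subbasis.\<close>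

lemma openin_Proj_basis:
  assumes "openin Proj_topology U" "P \<in> U"
  shows "\<exists>f d. homogeneous d f \<and> P \<in> Dplus f \<and> Dplus f \<subseteq> U"
proof -
  have "generate_topology_on {{P \<in> Proj_ZXY. f \<notin> P} | f. \<exists>d. homogeneous d f} U"
    using assms(1) by (simp add: Proj_topology_def openin_topology_generated_by_iff)
  then show ?thesis using assms(2)
  proof (induction rule: generate_topology_on.induct)
    case (Int a b)
    then have "P \<in> a" "P \<in> b" by auto
    obtain f d where f: "homogeneous d f" "P \<in> Dplus f" "Dplus f \<subseteq> a"
      using Int.IH(1)[OF \<open>P \<in> a\<close>] by blast
    obtain g e where g: "homogeneous e g" "P \<in> Dplus g" "Dplus g \<subseteq> b"
      using Int.IH(2)[OF \<open>P \<in> b\<close>] by blast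
    have "Dplus (f * g) = Dplus f \<inter> Dplus g" by (rule Dplus_mult)
    then show ?case using f g homogeneous_mult[OF f(1) g(1)] by blast
  next
    case (UN K)
    then obtain k where "k \<in> K" "P \<in> k" by blast
    with UN.IH obtain f d where "homogeneous d f" "P \<in> Dplus f" "Dplus f \<subseteq> k" by metis
    then show ?case using \<open>k \<in> K\<close> by blast
  qed (auto simp: Dplus_def)
qed

lemma open_Proj_subset: "openin Proj_topology U \<Longrightarrow> U \<subseteq> Proj_ZXY"
  using openin_subset topspace_Proj by metis

text \<open>Distinguished open sets are defined by non-membership, which passes to smaller primes.
  In particular the generic point lies in every nonempty open set, and this is what allows all
  comparisons to be made in one generic fibre.\<close>

lemma open_generization:
  assumes "openin Proj_topology U" "P \<in> U" "Q \<in> Proj_ZXY" "Q \<subseteq> P" shows "Q \<in> U"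
  using openin_Proj_basis[OF assms(1,2)] assms(3,4) by (auto simp: Dplus_def)

lemma eta_in_open: "openin Proj_topology U \<Longrightarrow> P \<in> U \<Longrightarrow> eta \<in> U"
  using open_generization eta_in_Proj eta_subset open_Proj_subset by blast

lemma loc_open:
  assumes "P \<in> Proj_ZXY" "c \<in> loc n P"
  shows "\<exists>V. openin Proj_topology V \<and> P \<in> V \<and> (\<forall>Q\<in>V. c \<in> loc n Q)"
  using assms(2)
proof (rule locE)
  fix g h d e assume "c = Fract g h" "homogeneous d g" "homogeneous e h" "int d = int e + n" "h \<notin> P"
  then show ?thesis using assms(1) openin_Dplus
    by (intro exI[of _ "Dplus h"]) (auto simp: Dplus_def intro: locI)
qed

lemma loc_unit_open:
  assumes "P \<in> Proj_ZXY" "loc_unit n P c"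
  shows "\<exists>V. openin Proj_topology V \<and> P \<in> V \<and> (\<forall>Q\<in>V. loc_unit n Q c)"
proof -
  obtain V W where "openin Proj_topology V" "P \<in> V" "\<forall>Q\<in>V. c \<in> loc n Q"
    "openin Proj_topology W" "P \<in> W" "\<forall>Q\<in>W. inverse c \<in> loc (- n) Q"
    using loc_open assms unfolding loc_unit_def by metis
  then show ?thesis using assms(2)
    by (intro exI[of _ "V \<inter> W"]) (auto simp: loc_unit_def)
qed

section \<open>Lattices in the generic fibre\<close>

lemma loc_eta_inverse:
  assumes "c \<in> loc n eta" "c \<noteq> 0" shows "inverse c \<in> loc (- n) eta"
proof -
  obtain g h d e where "c = Fract g h" "homogeneous d g" "homogeneous e h" "int d = int e + n" "g \<noteq> 0"
    by (rule loc_lowest[OF assms])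
  then show ?thesis by (auto intro!: locI[of e _ d])
qed

section \<open>Linear algebra in the generic fibre\<close>

type_synonym kvec = "zxy fract \<times> zxy fract"

definition sv :: "zxy fract \<Rightarrow> kvec \<Rightarrow> kvec" where "sv c v = (c * fst v, c * snd v)"
text \<open>The coordinate of the wedge product; it vanishes exactly when the two vectors are
  linearly dependent.\<close>

definition wd :: "kvec \<Rightarrow> kvec \<Rightarrow> zxy fract" where "wd v w = fst v * snd w - snd v * fst w"

lemma fst_sv [simp]: "fst (sv c v) = c * fst v" and snd_sv [simp]: "snd (sv c v) = c * snd v"
  by (simp_all add: sv_def)

lemma vector_space_sv: "vector_space sv"
  by unfold_locales (auto simp: prod_eq_iff algebra_simps)

lemma sv_sv [simp]: "sv a (sv b v) = sv (a * b) v"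
  by (simp add: prod_eq_iff)

lemma sv_1 [simp]: "sv 1 v = v"
  by (simp add: prod_eq_iff)

lemma sv_add: "sv a (v + w) = sv a v + sv a w" and sv_add_left: "sv (a + b) v = sv a v + sv b v"
  by (simp_all add: prod_eq_iff algebra_simps)

lemma wd_simps:
  "wd (a + b) v = wd a v + wd b v" "wd v (a + b) = wd v a + wd v b"
  "wd (sv c a) v = c * wd a v" "wd v (sv c a) = c * wd v a" "wd v v = 0"
  by (simp_all add: wd_def algebra_simps)

lemma wd_commute: "wd v w = - wd w v"
  by (simp add: wd_def)

lemma wd_Cramer:
  assumes "wd a b \<noteq> 0"
  shows "v = sv (wd v b / wd a b) a + sv (wd a v / wd a b) b"
  using assms by (auto simp: prod_eq_iff wd_def divide_simps) (simp_all add: algebra_simps)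

text \<open>The degree \<open>n\<close> of the coefficients makes this the stalk at \<open>P\<close>
  of the \<open>n\<close>-th twist of the lattice spanned by \<open>a\<close> and
  \<open>b\<close>.\<close>

definition span2 :: "int \<Rightarrow> zxy set \<Rightarrow> kvec \<Rightarrow> kvec \<Rightarrow> kvec set" where
  "span2 n P a b = {sv \<alpha> a + sv \<beta> b | \<alpha> \<beta>. \<alpha> \<in> loc n P \<and> \<beta> \<in> loc n P}"

lemma span2I: "\<alpha> \<in> loc n P \<Longrightarrow> \<beta> \<in> loc n P \<Longrightarrow> sv \<alpha> a + sv \<beta> b \<in> span2 n P a b"
  unfolding span2_def by blast

lemma span2E:
  assumes "v \<in> span2 n P a b"
  obtains \<alpha> \<beta> where "v = sv \<alpha> a + sv \<beta> b" "\<alpha> \<in> loc n P" "\<beta> \<in> loc n P"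
  using assms unfolding span2_def by blast

text \<open>Cramer's rule turns membership in a lattice into two regularity conditions, through
  which statements about functions carry over to vectors.\<close>

lemma span2_iff:
  assumes "wd a b \<noteq> 0"
  shows "v \<in> span2 n P a b \<longleftrightarrow> wd v b / wd a b \<in> loc n P \<and> wd a v / wd a b \<in> loc n P"
proof
  assume "v \<in> span2 n P a b"
  then show "wd v b / wd a b \<in> loc n P \<and> wd a v / wd a b \<in> loc n P"
    using assms by (elim span2E) (simp add: wd_simps)
qed (subst wd_Cramer[OF assms], auto intro: span2I)

lemma span2_add:
  "P \<in> Proj_ZXY \<Longrightarrow> v \<in> span2 n P a b \<Longrightarrow> v' \<in> span2 n P a b \<Longrightarrow> v + v' \<in> span2 n P a b"
proof (elim span2E)
  fix \<alpha> \<beta> \<alpha>' \<beta>'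
  assume "P \<in> Proj_ZXY" "\<alpha> \<in> loc n P" "\<beta> \<in> loc n P" "\<alpha>' \<in> loc n P" "\<beta>' \<in> loc n P"
    "v = sv \<alpha> a + sv \<beta> b" "v' = sv \<alpha>' a + sv \<beta>' b"
  then have "v + v' = sv (\<alpha> + \<alpha>') a + sv (\<beta> + \<beta>') b" "\<alpha> + \<alpha>' \<in> loc n P" "\<beta> + \<beta>' \<in> loc n P"
    by (simp_all add: sv_add_left loc_add)
  then show ?thesis using span2I by metis
qed

lemma span2_sv:
  "P \<in> Proj_ZXY \<Longrightarrow> c \<in> loc m P \<Longrightarrow> v \<in> span2 n P a b \<Longrightarrow> sv c v \<in> span2 (m + n) P a b"
  by (elim span2E) (auto simp: sv_add intro!: span2I loc_mult)

lemma span2_0: "P \<in> Proj_ZXY \<Longrightarrow> 0 \<in> span2 n P a b"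
  unfolding span2_def by (auto simp: prod_eq_iff intro!: exI[of _ 0] loc_0)

lemma span2_basis: "P \<in> Proj_ZXY \<Longrightarrow> a \<in> span2 0 P a b" "P \<in> Proj_ZXY \<Longrightarrow> b \<in> span2 0 P a b"
  using span2I[of 1 0 P 0 a b] span2I[of 0 0 P 1 a b] loc_1[of P] loc_0[of P 0]
  by (auto simp: prod_eq_iff sv_def plus_prod_def)

lemma span2_subset:
  assumes "P \<in> Proj_ZXY" "a' \<in> span2 0 P a b" "b' \<in> span2 0 P a b"
  shows "span2 n P a' b' \<subseteq> span2 n P a b"
proof
  fix v assume "v \<in> span2 n P a' b'"
  then show "v \<in> span2 n P a b"
    using span2_add[OF assms(1)] span2_sv[OF assms(1) _ assms(2), of _ n]
      span2_sv[OF assms(1) _ assms(3), of _ n] by (elim span2E) simp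
qed

lemma span2_eq:
  assumes P: "P \<in> Proj_ZXY" and eq: "span2 0 P a b = span2 0 P a' b'"
  shows "span2 n P a b = span2 n P a' b'"
  using span2_subset[OF P] span2_basis[OF P] eq by blast

lemma wd_span2:
  assumes P: "P \<in> Proj_ZXY" and ab: "wd a b \<noteq> 0" and v: "v \<in> span2 m P a b" "v' \<in> span2 n P a b"
  shows "wd v v' / wd a b \<in> loc (m + n) P"
proof -
  obtain \<alpha> \<beta> where 1: "v = sv \<alpha> a + sv \<beta> b" "\<alpha> \<in> loc m P" "\<beta> \<in> loc m P" using v(1) by (rule span2E)
  obtain \<alpha>' \<beta>' where 2: "v' = sv \<alpha>' a + sv \<beta>' b" "\<alpha>' \<in> loc n P" "\<beta>' \<in> loc n P" using v(2) by (rule span2E)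
  have "wd v v' = (\<alpha> * \<beta>' - \<beta> * \<alpha>') * wd a b"
    unfolding 1 2 by (simp add: wd_simps wd_commute[of b a] algebra_simps)
  then show ?thesis using 1 2 ab P by (simp add: loc_diff loc_mult)
qed

text \<open>Each basis lies in the span of the other, so each of the two determinants is a multiple
  of the other by a function regular at \<open>P\<close>.\<close>

lemma span2_unit:
  assumes P: "P \<in> Proj_ZXY" and eq: "span2 0 P a b = span2 0 P a' b'"
    and nz: "wd a b \<noteq> 0" "wd a' b' \<noteq> 0"
  shows "loc_unit 0 P (wd a b / wd a' b')"
proof -
  have "a \<in> span2 0 P a' b'" "b \<in> span2 0 P a' b'" "a' \<in> span2 0 P a b" "b' \<in> span2 0 P a b"
    using span2_basis[OF P] eq by blast+
  then show ?thesis
    using wd_span2[OF P nz(2), of a 0 b 0] wd_span2[OF P nz(1), of a' 0 b' 0] nz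
    by (simp add: loc_unit_def)
qed

text \<open>
  A vector bundle of rank two, seen in its generic fibre: its stalk at \<open>P\<close> is the lattice with
  basis \<open>u P\<close>, \<open>w P\<close>, and this lattice is locally constant in the sense that one basis serves a
  whole neighbourhood. Below, \<open>lat n P\<close> is the stalk of the \<open>n\<close>-th twist.
\<close>

locale lattice_family =
  fixes u w :: "zxy set \<Rightarrow> kvec"
  assumes generic: "u eta = (1, 0)" "w eta = (0, 1)"
    and deg0: "P \<in> Proj_ZXY \<Longrightarrow> u P \<in> loc 0 eta \<times> loc 0 eta" "P \<in> Proj_ZXY \<Longrightarrow> w P \<in> loc 0 eta \<times> loc 0 eta"
    and basis: "P \<in> Proj_ZXY \<Longrightarrow> wd (u P) (w P) \<noteq> 0"
    and locally_constant: "P \<in> Proj_ZXY \<Longrightarrow> \<exists>U. openin Proj_topology U \<and> P \<in> U \<and>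
      (\<forall>Q\<in>U. span2 0 Q (u Q) (w Q) = span2 0 Q (u P) (w P))"
begin

definition lat :: "int \<Rightarrow> zxy set \<Rightarrow> kvec set" where
  "lat n P = span2 n P (u P) (w P)"

definition det :: "zxy set \<Rightarrow> zxy fract" where
  "det P = wd (u P) (w P)"

lemma lat_add: "P \<in> Proj_ZXY \<Longrightarrow> v \<in> lat n P \<Longrightarrow> v' \<in> lat n P \<Longrightarrow> v + v' \<in> lat n P"
  unfolding lat_def by (rule span2_add)

lemma lat_sv: "P \<in> Proj_ZXY \<Longrightarrow> c \<in> loc m P \<Longrightarrow> v \<in> lat n P \<Longrightarrow> sv c v \<in> lat (m + n) P"
  unfolding lat_def by (rule span2_sv)

lemma lat_0: "P \<in> Proj_ZXY \<Longrightarrow> 0 \<in> lat n P"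
  unfolding lat_def by (rule span2_0)

lemma det_nonzero: "P \<in> Proj_ZXY \<Longrightarrow> det P \<noteq> 0"
  unfolding det_def by (rule basis)

lemma lat_local:
  assumes "P \<in> Proj_ZXY"
  obtains U where "openin Proj_topology U" "P \<in> U"
    "\<And>Q n. Q \<in> U \<Longrightarrow> lat n Q = span2 n Q (u P) (w P)"
    "\<And>Q. Q \<in> U \<Longrightarrow> loc_unit 0 Q (det P / det Q)"
proof -
  obtain U where U: "openin Proj_topology U" "P \<in> U"
      "\<And>Q. Q \<in> U \<Longrightarrow> span2 0 Q (u Q) (w Q) = span2 0 Q (u P) (w P)"
    using locally_constant[OF assms] by blast
  have Proj: "Q \<in> Proj_ZXY" if "Q \<in> U" for Q using U(1) open_Proj_subset that by blast
  show ?thesis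
  proof (rule that[OF U(1,2)])
    fix Q assume "Q \<in> U"
    note Q = U(3)[OF this] Proj[OF this]
    show "lat n Q = span2 n Q (u P) (w P)" for n
      unfolding lat_def by (rule span2_eq[OF Q(2) Q(1)])
    show "loc_unit 0 Q (det P / det Q)"
      unfolding det_def by (rule span2_unit[OF Q(2) Q(1)[symmetric]]) (use basis assms Q in auto)
  qed
qed

text \<open>A neighbourhood of \<open>P\<close> contains every generization \<open>Q\<close> of
  \<open>P\<close>, so the basis chosen at \<open>P\<close> also serves at \<open>Q\<close>,
  although \<open>u Q\<close> and \<open>w Q\<close> may be different vectors.\<close>

lemma lat_generization:
  assumes "P \<in> Proj_ZXY" "Q \<in> Proj_ZXY" "Q \<subseteq> P"
  shows "lat n Q = span2 n Q (u P) (w P)" "loc_unit 0 Q (det P / det Q)"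
  using lat_local[OF assms(1)] open_generization assms(2,3) by metis+

lemma lat_mono:
  assumes "P \<in> Proj_ZXY" "Q \<in> Proj_ZXY" "Q \<subseteq> P" "v \<in> lat n P"
  shows "v \<in> lat n Q"
  using assms(4) unfolding lat_generization[OF assms(1-3)] unfolding lat_def
  using loc_mono[OF assms(3)] by (fastforce simp: span2_def)

lemma lat_eta: "v \<in> lat n eta \<longleftrightarrow> fst v \<in> loc n eta \<and> snd v \<in> loc n eta"
  unfolding lat_def by (subst span2_iff) (auto simp: generic wd_def)

text \<open>The basis at \<open>P\<close> serves at all codimension-one points through
  \<open>P\<close>, so \<open>loc_Hartogs\<close> can be applied to the two Cramer coordinates with
  respect to it.\<close>

lemma lat_Hartogs:
  assumes P: "P \<in> Proj_ZXY" and v: "v \<in> lat n eta"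
    and codim1: "\<And>p d. prime_elem p \<Longrightarrow> homogeneous d p \<Longrightarrow> p \<in> P \<Longrightarrow> v \<in> lat n (pri p)"
  shows "v \<in> lat n P"
proof -
  have sub: "pri p \<subseteq> P" if "p \<in> P" for p using Proj_dvd[OF P that] by auto
  have gen: "wd v (w P) / wd (u P) (w P) \<in> loc n Q" "wd (u P) v / wd (u P) (w P) \<in> loc n Q"
    if "v \<in> lat n Q" "Q \<in> Proj_ZXY" "Q \<subseteq> P" for Q
    using that span2_iff[OF basis[OF P], of v n Q] lat_generization(1)[OF P that(2,3)] by auto
  have 1: "wd v (w P) / wd (u P) (w P) \<in> loc n P"
    by (rule loc_Hartogs[OF P gen(1)[OF v eta_in_Proj eta_subset[OF P]]])
      (use codim1 sub gen(1) pri_in_Proj in blast)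
  have 2: "wd (u P) v / wd (u P) (w P) \<in> loc n P"
    by (rule loc_Hartogs[OF P gen(2)[OF v eta_in_Proj eta_subset[OF P]]])
      (use codim1 sub gen(2) pri_in_Proj in blast)
  show ?thesis unfolding lat_def using 1 2 span2_iff[OF basis[OF P]] by blast
qed

text \<open>Away from the divisor of one form \<open>f\<close> the lattice is the standard one.
  Hence only the finitely many prime factors of \<open>f\<close> are exceptional in codimension one,
  which keeps the later constructions finite.\<close>

lemma generic_open:
  obtains f d where "f \<noteq> 0" "homogeneous d f"
    "\<And>Q n. Q \<in> Proj_ZXY \<Longrightarrow> f \<notin> Q \<Longrightarrow> lat n Q = span2 n Q (1, 0) (0, 1)"
    "\<And>Q. Q \<in> Proj_ZXY \<Longrightarrow> f \<notin> Q \<Longrightarrow> loc_unit 0 Q (det Q)"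
proof -
  obtain U where U: "openin Proj_topology U" "eta \<in> U"
    "\<And>Q n. Q \<in> U \<Longrightarrow> lat n Q = span2 n Q (u eta) (w eta)"
    "\<And>Q. Q \<in> U \<Longrightarrow> loc_unit 0 Q (det eta / det Q)"
    using lat_local[OF eta_in_Proj] by metis
  obtain f d where f: "homogeneous d f" "eta \<in> Dplus f" "Dplus f \<subseteq> U"
    using openin_Proj_basis[OF U(1,2)] by blast
  have det: "det eta = 1" by (simp add: det_def generic wd_def)
  show ?thesis
  proof (rule that[of f d])
    show "f \<noteq> 0" using f(2) by (auto simp: Dplus_def)
    show "homogeneous d f" by fact
    fix Q assume "Q \<in> Proj_ZXY" "f \<notin> Q"
    then have Q: "Q \<in> U" using f by (auto simp: Dplus_def)
    show "lat n Q = span2 n Q (1, 0) (0, 1)" for n using U(3)[OF Q] generic by simp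
    show "loc_unit 0 Q (det Q)"
      using loc_unit_inverse[OF U(4)[OF Q]] det by simp
  qed
qed

lemma det_in_loc: "P \<in> Proj_ZXY \<Longrightarrow> det P \<in> loc 0 eta"
  using deg0[of P] loc_mult[OF eta_in_Proj, of _ 0 _ 0]
  unfolding det_def wd_def by (auto simp: mem_Times_iff intro!: loc_diff[OF eta_in_Proj])

section \<open>The determinant line bundle\<close>

text \<open>A finite stage in the construction of a generator of the determinant:
  \<open>\<delta>\<close> has the order of \<open>det\<close> along the primes in \<open>T\<close>
  and order 0 along the others. Requiring \<open>prime\<close> rather than \<open>prime_elem\<close>
  selects one normalised representative per divisor.\<close>

definition det_divisor :: "zxy set \<Rightarrow> zxy fract \<Rightarrow> int \<Rightarrow> bool" where
  "det_divisor T \<delta> c \<longleftrightarrow> \<delta> \<noteq> 0 \<and> \<delta> \<in> loc (- c) eta \<and> (\<forall>p\<in>T. loc_unit c (pri p) (det (pri p) / \<delta>)) \<and>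
    (\<forall>q k. prime q \<longrightarrow> homogeneous k q \<longrightarrow> q \<notin> T \<longrightarrow> loc_unit (- c) (pri q) \<delta>)"

text \<open>A new prime \<open>p\<close> is treated by multiplying with \<open>p\<close> to the
  power of the order of \<open>det\<close> at \<open>pri p\<close>. This factor is a unit along
  every other prime, so nothing achieved earlier is lost; only the degree \<open>c\<close> is
  shifted.\<close>

lemma ex_divisor:
  assumes "finite T" "\<And>p. p \<in> T \<Longrightarrow> prime p \<and> (\<exists>k. homogeneous k p)"
  shows "\<exists>\<delta> c. det_divisor T \<delta> c"
  using assms
proof (induction T rule: finite_induct)
  case empty
  have "loc_unit 0 (pri q) 1" if "prime q" "homogeneous k q" for q k
    using that pri_in_Proj loc_unit_1 by (auto intro: prime_imp_prime_elem)
  then show ?case unfolding det_divisor_def using loc_1[OF eta_in_Proj] by (intro exI[of _ 1] exI[of _ 0]) auto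
next
  case (insert p T)
  then obtain \<delta> c where dd: "det_divisor T \<delta> c" by blast
  then have \<delta>: "\<delta> \<noteq> 0" "\<delta> \<in> loc (- c) eta"
      "\<And>p. p \<in> T \<Longrightarrow> loc_unit c (pri p) (det (pri p) / \<delta>)"
      "\<And>q k. prime q \<Longrightarrow> homogeneous k q \<Longrightarrow> q \<notin> T \<Longrightarrow> loc_unit (- c) (pri q) \<delta>"
    unfolding det_divisor_def by blast+
  obtain k where p: "prime p" "homogeneous k p" using insert.prems by auto
  have PP: "pri q \<in> Proj_ZXY" if "prime q" "homogeneous k q" for q k
    using that pri_in_Proj by (auto intro: prime_imp_prime_elem)
  have p0: "to_fract p \<noteq> 0" using p by auto
  obtain v where v: "loc_unit (0 - v * int k) (pri p) (det (pri p) * to_fract p powi (- v))"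
    using ex_valuation[OF prime_imp_prime_elem[OF p(1)] p(2) det_in_loc[OF PP[OF p]]]
      det_nonzero[OF PP[OF p]] by auto
  define \<delta>' where "\<delta>' = \<delta> * to_fract p powi v"
  have other: "loc_unit (v * int k) (pri q) (to_fract p powi v)"
    if q: "prime q" "homogeneous l q" "q \<noteq> p" for q l
  proof -
    have "\<not> q dvd p" using primes_dvd_imp_eq[OF q(1) p(1)] q(3) by blast
    then show ?thesis by (intro loc_unit_powi loc_unit_to_fract PP[OF q(1,2)] p) simp
  qed
  have "\<delta>' \<noteq> 0" using \<delta>(1) p0 by (simp add: \<delta>'_def)
  moreover have "\<delta>' \<in> loc (- (c - v * int k)) eta"
  proof -
    have "loc_unit (v * int k) eta (to_fract p powi v)"
      using p by (intro loc_unit_powi loc_unit_to_fract eta_in_Proj) auto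
    then show ?thesis using loc_mult[OF eta_in_Proj \<delta>(2), of "to_fract p powi v" "v * int k"]
      by (simp add: \<delta>'_def loc_unit_def)
  qed
  moreover have "loc_unit (c - v * int k) (pri q) (det (pri q) / \<delta>')" if q: "q \<in> insert p T" for q
  proof (cases "q = p")
    case True
    have "loc_unit (0 - v * int k - - c) (pri p) (det (pri p) * to_fract p powi (- v) / \<delta>)"
      using v \<delta>(4)[OF p insert.hyps(2)] PP[OF p] by (intro loc_unit_divide)
    then show ?thesis using True p0 by (simp add: \<delta>'_def power_int_minus field_simps)
  next
    case False
    then obtain l where q: "q \<in> T" "prime q" "homogeneous l q"
      using insert.prems[OF q] insertE[OF q] by metis
    have "loc_unit (c - v * int k) (pri q) (det (pri q) / \<delta> / to_fract p powi v)"
      using \<delta>(3)[OF q(1)] other[OF q(2,3) False] PP[OF q(2,3)] by (intro loc_unit_divide)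
    then show ?thesis by (simp add: \<delta>'_def field_simps)
  qed
  moreover have "loc_unit (- (c - v * int k)) (pri q) \<delta>'"
    if q: "prime q" "homogeneous l q" "q \<notin> insert p T" for q l
  proof -
    have "loc_unit (- c + v * int k) (pri q) \<delta>'"
      unfolding \<delta>'_def using q \<delta>(4)[of q l] other[of q l] PP[OF q(1,2)] by (intro loc_unit_mult) auto
    then show ?thesis by simp
  qed
  ultimately have "det_divisor (insert p T) \<delta>' (c - v * int k)"
    unfolding det_divisor_def by blast
  then show ?case by blast
qed

lemma pri_normalize: "pri (normalize p) = pri p"
  by (auto simp: pri_def)

text \<open>A generator of the determinant line bundle, which has degree \<open>c\<close>.\<close>

lemma ex_det_generator:
  obtains \<delta> c where "\<delta> \<noteq> 0" "\<delta> \<in> loc (- c) eta" "\<And>P. P \<in> Proj_ZXY \<Longrightarrow> loc_unit c P (det P / \<delta>)"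
proof -
  obtain f d where f: "f \<noteq> 0" "homogeneous d f"
    "\<And>Q. Q \<in> Proj_ZXY \<Longrightarrow> f \<notin> Q \<Longrightarrow> loc_unit 0 Q (det Q)"
    using generic_open by metis
  have "p \<in> prime_factors f \<Longrightarrow> prime p \<and> (\<exists>k. homogeneous k p)" for p
    using homogeneous_dvd[OF f(2,1)] by (metis in_prime_factors_iff)
  then obtain \<delta> c where dd: "det_divisor (prime_factors f) \<delta> c"
    using ex_divisor[OF finite_set_mset] by blast
  then have \<delta>: "\<delta> \<noteq> 0" "\<delta> \<in> loc (- c) eta"
      "\<And>p. p \<in> prime_factors f \<Longrightarrow> loc_unit c (pri p) (det (pri p) / \<delta>)"
      "\<And>q k. prime q \<Longrightarrow> homogeneous k q \<Longrightarrow> q \<notin> prime_factors f \<Longrightarrow> loc_unit (- c) (pri q) \<delta>"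
    unfolding det_divisor_def by blast+
  \<comment> \<open>Along a prime factor of \<open>f\<close> the order was prescribed; along any
    other prime both \<open>det\<close> and \<open>\<delta>\<close> are units.\<close>
  have codim1: "loc_unit c (pri p) (det (pri p) / \<delta>)" if p: "prime_elem p" "homogeneous k p" for p k
  proof -
    have PP: "pri p \<in> Proj_ZXY" using pri_in_Proj p by blast
    define q where "q = normalize p"
    have q: "prime q" "pri q = pri p" using p by (auto simp: q_def pri_normalize)
    obtain l where l: "homogeneous l q"
      using homogeneous_dvd[OF p(2), of q] p by (auto simp: q_def)
    show ?thesis
    proof (cases "q \<in> prime_factors f")
      case True
      then show ?thesis using \<delta>(3) q by metis
    next
      case False
      then have "f \<notin> pri p" using f(1) q(1) unfolding q(2)[symmetric] by (auto simp: in_prime_factors_iff)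
      then have "loc_unit 0 (pri p) (det (pri p))" using f(3) PP by blast
      moreover have "loc_unit (- c) (pri p) \<delta>" using \<delta>(4)[OF q(1) l False] q by simp
      ultimately have "loc_unit (0 - - c) (pri p) (det (pri p) / \<delta>)" by (intro loc_unit_divide PP)
      then show ?thesis by simp
    qed
  qed
  have "loc_unit c P (det P / \<delta>)" if P: "P \<in> Proj_ZXY" for P
  proof -
    \<comment> \<open>The determinants at \<open>P\<close> and at its generization
      \<open>pri p\<close> differ by a unit, so what holds in codimension one transfers to
      \<open>det P\<close>. Hartogs, applied to the quotient and to its inverse, then gives a unit
      at \<open>P\<close>.\<close>
    have c1: "loc_unit c (pri p) (det P / \<delta>)" if p: "prime_elem p" "homogeneous k p" "p \<in> P" for p k
    proof -
      have PP: "pri p \<in> Proj_ZXY" using pri_in_Proj p by blast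
      have sub: "pri p \<subseteq> P" using Proj_dvd[OF P p(3)] by auto
      have "loc_unit (0 + c) (pri p) ((det P / det (pri p)) * (det (pri p) / \<delta>))"
        using lat_generization(2)[OF P PP sub] codim1[OF p(1,2)] by (intro loc_unit_mult PP)
      then show ?thesis using det_nonzero[OF PP] by simp
    qed
    have nz: "det P / \<delta> \<noteq> 0" using det_nonzero[OF P] \<delta>(1) by simp
    note inv = loc_eta_inverse
    have "det P / \<delta> \<in> loc (0 + c) eta"
      unfolding divide_inverse using det_in_loc[OF P] inv[OF \<delta>(2,1)]
      by (intro loc_mult eta_in_Proj) auto
    then have e: "det P / \<delta> \<in> loc c eta" "inverse (det P / \<delta>) \<in> loc (- c) eta"
      using inv[OF _ nz] by auto
    show ?thesis
      unfolding loc_unit_def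
    proof (intro conjI nz loc_Hartogs[OF P e(1)] loc_Hartogs[OF P e(2)])
      fix p k assume "prime_elem p" "homogeneous k p" "p \<in> P"
      then show "det P / \<delta> \<in> loc c (pri p)" "inverse (det P / \<delta>) \<in> loc (- c) (pri p)"
        using c1 unfolding loc_unit_def by auto
    qed
  qed
  then show ?thesis using that \<delta> by blast
qed

end

section \<open>Primitive global sections\<close>

text \<open>Here \<open>degree\<close> is the degree in \<open>y\<close>; it is additive over
  products, so some prime factor carries a positive share.\<close>

lemma prime_factor_degree:
  assumes "degree F > 0" "F \<noteq> 0"
  shows "\<exists>p::zxy. prime_elem p \<and> p dvd F \<and> degree p > 0"
  using assms(2,1)
proof (induction F rule: prime_divisors_induct)
  case (unit x)
  then have "degree x = 0" by (auto simp: is_unit_poly_iff)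
  then show ?case using unit by simp
next
  case (factor p x)
  show ?case
  proof (cases "degree p > 0")
    case True
    then show ?thesis using factor by (auto intro: prime_imp_prime_elem)
  next
    case False
    then have "degree x > 0" "x \<noteq> 0" using factor.prems by (auto simp: degree_mult_eq split: if_splits)
    then show ?thesis using factor.IH by (auto intro: dvd_mult)
  qed
qed auto

text \<open>The power \<open>f ^ N\<close> vanishes to order at least \<open>N\<close> along
  \<open>p\<close>, which outweighs any fixed pole. The formulation with a filter lets finitely many
  primes and coordinates share one \<open>N\<close>.\<close>

lemma power_clears_denominator:
  assumes p: "prime_elem p" "homogeneous k p" and f: "homogeneous d f" "f \<noteq> 0" "p dvd f"
    and c: "c \<in> loc 0 eta"
  shows "\<forall>\<^sub>F N in sequentially. to_fract f ^ N * c \<in> loc (int (N * d)) (pri p)"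
proof -
  have PP: "pri p \<in> Proj_ZXY" using p pri_in_Proj by blast
  have p0: "to_fract p \<noteq> 0" using p by auto
  show ?thesis
  proof (cases "c = 0")
    case True
    then show ?thesis using loc_0[OF PP] by simp
  next
    case False
    obtain v where v: "loc_unit (0 - v * int k) (pri p) (c * to_fract p powi (- v))"
      using ex_valuation[OF p c False] by blast
    obtain f' where f': "f = p * f'" using f by (elim dvdE)
    have hf': "homogeneous (d - k) f'" "k \<le> d" using homogeneous_cofactor f f' p by metis+
    have "to_fract f ^ N * c \<in> loc (int (N * d)) (pri p)" if N: "N \<ge> nat (- v)" for N
    proof -
      define i where "i = nat (int N + v)"
      have i: "int i = int N + v" using N by (simp add: i_def)
      have "to_fract p powi v = to_fract p powi (int i - int N)" by (simp add: i)
      also have "\<dots> = to_fract p ^ i / to_fract p ^ N" using p0 by (simp add: power_int_diff)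
      finally have "to_fract p powi v = to_fract p ^ i / to_fract p ^ N" .
      then have eq: "to_fract f ^ N * c = to_fract (f' ^ N * p ^ i) * (c * to_fract p powi (- v))"
        using p0 by (simp add: f' power_mult_distrib to_fract_power power_int_minus field_simps)
      have mem: "to_fract (f' ^ N * p ^ i) \<in> loc (int (N * (d - k) + i * k)) (pri p)"
        using hf' p by (intro loc_to_fract PP homogeneous_mult homogeneous_power)
      have "c * to_fract p powi (- v) \<in> loc (0 - v * int k) (pri p)"
        using v unfolding loc_unit_def by blast
      from loc_mult[OF PP mem this]
      have "to_fract f ^ N * c \<in> loc (int (N * (d - k) + i * k) + (0 - v * int k)) (pri p)"
        unfolding eq .
      moreover have "int (N * (d - k) + i * k) + (0 - v * int k) = int (N * d)"
      proof -
        obtain d0 where "d = k + d0" using hf'(2) le_Suc_ex by blast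
        then show ?thesis by (simp add: i algebra_simps)
      qed
      ultimately show ?thesis by simp
    qed
    then show ?thesis unfolding eventually_sequentially by blast
  qed
qed

section \<open>Global sections of the twists\<close>

context lattice_family begin

definition sections :: "int \<Rightarrow> kvec set" where
  "sections n = {v. \<forall>P\<in>Proj_ZXY. v \<in> lat n P}"

lemma sectionsI_Hartogs:
  assumes "v \<in> lat n eta" "\<And>p k. prime_elem p \<Longrightarrow> homogeneous k p \<Longrightarrow> v \<in> lat n (pri p)"
  shows "v \<in> sections n"
  unfolding sections_def using assms lat_Hartogs by blast

lemma sections_lat: "v \<in> sections n \<Longrightarrow> P \<in> Proj_ZXY \<Longrightarrow> v \<in> lat n P"
  by (simp add: sections_def)

lemma sections_add: "v \<in> sections n \<Longrightarrow> v' \<in> sections n \<Longrightarrow> v + v' \<in> sections n"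
  by (simp add: sections_def lat_add)

lemma sections_sv:
  "homogeneous d f \<Longrightarrow> v \<in> sections n \<Longrightarrow> sv (to_fract f) v \<in> sections (int d + n)"
  by (simp add: sections_def lat_sv loc_to_fract)

lemma lat_pri_eta: "p = 0 \<or> prime_elem p \<Longrightarrow> homogeneous k p \<Longrightarrow> v \<in> lat n (pri p) \<Longrightarrow> v \<in> lat n eta"
  using lat_mono[OF pri_in_Proj eta_in_Proj eta_subset[OF pri_in_Proj]] by blast

text \<open>Away from \<open>p\<close> division by \<open>p\<close> is harmless, since
  \<open>p\<close> is invertible there; a prime \<open>q\<close> dividing \<open>p\<close> is
  associate to it and gives the same point.\<close>

lemma sections_divide:
  assumes v: "v \<in> sections n" and p: "prime_elem p" "homogeneous k p"
    and pv: "sv (inverse (to_fract p)) v \<in> lat (n - int k) (pri p)"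
  shows "sv (inverse (to_fract p)) v \<in> sections (n - int k)"
proof (rule sectionsI_Hartogs)
  fix q l assume q: "prime_elem q" "homogeneous l q"
  then have Q: "pri q \<in> Proj_ZXY" using pri_in_Proj by blast
  show "sv (inverse (to_fract p)) v \<in> lat (n - int k) (pri q)"
  proof (cases "q dvd p")
    case True
    then have "p dvd q" using p q by (metis prime_elem_imp_irreducible irreducible_altdef prime_elem_not_unit)
    then have "pri q = pri p" using True unfolding pri_def by (auto intro: dvd_trans)
    then show ?thesis using pv by simp
  next
    case False
    then have "inverse (to_fract p) \<in> loc (- int k) (pri q)"
      using loc_inverse_to_fract[OF Q p(2)] by simp
    then show ?thesis using lat_sv[OF Q _ sections_lat[OF v Q]] by fastforce
  qed
next
  show "sv (inverse (to_fract p)) v \<in> lat (n - int k) eta"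
    by (rule lat_pri_eta[OF _ p(2) pv]) (use p in simp)
qed

text \<open>The standard basis of the generic fibre consists of rational sections with poles at most
  along the prime factors of \<open>f\<close>; a high power of \<open>f\<close> turns both into
  global sections of one twist.\<close>

lemma ex_independent_sections:
  obtains s t N where "s \<in> sections N" "t \<in> sections N" "wd s t \<noteq> 0"
proof -
  obtain f d where f: "f \<noteq> 0" "homogeneous d f"
    "\<And>Q n. Q \<in> Proj_ZXY \<Longrightarrow> f \<notin> Q \<Longrightarrow> lat n Q = span2 n Q (1, 0) (0, 1)"
    using generic_open by metis
  define ok where "ok N v p \<longleftrightarrow> sv (to_fract f ^ N) v \<in> lat (int (N * d)) (pri p)" for N v p
  have ev: "\<forall>\<^sub>F N in sequentially. ok N v p"
    if v: "v \<in> lat 0 eta" and p: "prime p" "p dvd f" for v p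
  proof -
    have p': "prime_elem p" using p by auto
    obtain k where k: "homogeneous k p" using homogeneous_dvd[OF f(2,1) p(2)] .
    have PP: "pri p \<in> Proj_ZXY" using pri_in_Proj p' k by blast
    have c: "wd v (w (pri p)) / det (pri p) \<in> loc 0 eta" "wd (u (pri p)) v / det (pri p) \<in> loc 0 eta"
    proof -
      have "v \<in> span2 0 eta (u (pri p)) (w (pri p))"
        using v lat_generization(1)[OF PP eta_in_Proj eta_subset[OF PP]] by simp
      then show "wd v (w (pri p)) / det (pri p) \<in> loc 0 eta" "wd (u (pri p)) v / det (pri p) \<in> loc 0 eta"
        using span2_iff[OF basis[OF PP]] unfolding det_def by auto
    qed
    show ?thesis
      using power_clears_denominator[OF p' k f(2,1) p(2) c(1)]
        power_clears_denominator[OF p' k f(2,1) p(2) c(2)]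
    proof eventually_elim
      case (elim N)
      then show ?case unfolding ok_def lat_def
        by (subst span2_iff[OF basis[OF PP]]) (simp add: wd_simps det_def)
    qed
  qed
  have "\<forall>\<^sub>F N in sequentially. \<forall>p\<in>prime_factors f. ok N (1, 0) p \<and> ok N (0, 1) p"
  proof (intro eventually_ball_finite ballI finite_set_mset eventually_conj ev)
    show "(1, 0) \<in> lat 0 eta" "(0, 1) \<in> lat 0 eta"
      using loc_0[OF eta_in_Proj] loc_1[OF eta_in_Proj] by (auto simp: lat_eta)
  qed (auto simp: in_prime_factors_iff)
  then obtain N where N: "\<forall>p\<in>prime_factors f. ok N (1, 0) p \<and> ok N (0, 1) p"
    using eventually_sequentially by auto
  have sec: "sv (to_fract f ^ N) v \<in> sections (int (N * d))"
    if v: "v = (1, 0) \<or> v = (0, 1)" for v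
  proof (rule sectionsI_Hartogs)
    have fN: "to_fract f ^ N \<in> loc (int (N * d)) Q" if "Q \<in> Proj_ZXY" for Q
      using loc_to_fract[OF that homogeneous_power[OF f(2), of N]] by (simp add: to_fract_power)
    show "sv (to_fract f ^ N) v \<in> lat (int (N * d)) eta"
      using v fN[OF eta_in_Proj] loc_0[OF eta_in_Proj] by (auto simp: lat_eta)
    fix p k assume p: "prime_elem p" "homogeneous k p"
    then have PP: "pri p \<in> Proj_ZXY" using pri_in_Proj by blast
    show "sv (to_fract f ^ N) v \<in> lat (int (N * d)) (pri p)"
    proof (cases "p dvd f")
      case True
      then have "normalize p \<in> prime_factors f" using p f(1) by (auto simp: in_prime_factors_iff)
      then have "ok N v (normalize p)" using N v by auto
      then show ?thesis unfolding ok_def pri_normalize .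
    next
      case False
      then show ?thesis using f(3)[OF PP] fN[OF PP] loc_0[OF PP] v
        by (subst f(3)[OF PP]) (auto simp: span2_iff wd_def)
    qed
  qed
  show ?thesis
    by (rule that[OF sec[of "(1, 0)"] sec[of "(0, 1)"]]) (use f(1) in \<open>auto simp: wd_def\<close>)
qed

end

section \<open>Pairs of sections and their degeneracy divisors\<close>

text \<open>Fixing a generator \<open>\<delta>\<close> of the determinant, whose degree is
  \<open>c\<close>, makes wedge products of sections into sections of \<O> twisted.\<close>

locale lattice_det = lattice_family +
  fixes \<delta> c
  assumes delta: "\<delta> \<noteq> 0" "\<And>P. P \<in> Proj_ZXY \<Longrightarrow> loc_unit c P (det P / \<delta>)"
begin

lemma wd_lat:
  assumes P: "P \<in> Proj_ZXY" and "s \<in> lat m P" "t \<in> lat n P"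
  shows "wd s t / \<delta> \<in> loc (m + n + c) P"
proof -
  have "wd s t / det P * (det P / \<delta>) \<in> loc (m + n + c) P"
    using wd_span2[OF P basis[OF P]] assms delta(2)[OF P] unfolding lat_def det_def
    by (intro loc_mult) (auto simp: loc_unit_def)
  then show ?thesis using det_nonzero[OF P] by simp
qed

text \<open>
  Two independent sections of twists of the bundle; \<open>F\<close> is the form cutting out the divisor along
  which they are dependent.
\<close>

definition frame :: "int \<Rightarrow> int \<Rightarrow> kvec \<Rightarrow> kvec \<Rightarrow> zxy \<Rightarrow> bool" where
  "frame m n s t F \<longleftrightarrow> s \<in> sections m \<and> t \<in> sections n \<and> F \<noteq> 0 \<and> wd s t = to_fract F * \<delta>"

text \<open>The quotient of the wedge product by \<open>\<delta>\<close> is a global section of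
  \<O>(m + n + c), hence a form by \<open>global_loc\<close>. Its degree, recorded in
  \<open>frame_degree\<close>, is therefore never negative.\<close>

lemma frameI:
  assumes "s \<in> sections m" "t \<in> sections n" "wd s t \<noteq> 0"
  obtains F where "frame m n s t F"
proof -
  have "wd s t / \<delta> \<in> loc (m + n + c) P" if "P \<in> Proj_ZXY" for P
    using wd_lat[OF that] sections_lat assms that by blast
  moreover have nz: "wd s t / \<delta> \<noteq> 0" using assms delta by simp
  ultimately obtain d F where "wd s t / \<delta> = to_fract F" by (metis global_loc)
  then show ?thesis using that[of F] assms delta(1) nz
    by (auto simp: frame_def field_simps)
qed

lemma frame_degree:
  assumes "frame m n s t F"
  obtains d where "homogeneous d F" "int d = m + n + c"
proof -
  have eq: "wd s t / \<delta> = to_fract F" "to_fract F \<noteq> 0" using assms delta(1) by (auto simp: frame_def)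
  have "to_fract F \<in> loc (m + n + c) P" if P: "P \<in> Proj_ZXY" for P
    using wd_lat[OF P, of s m t n] sections_lat[OF _ P] assms eq by (simp add: frame_def)
  then obtain d f where "homogeneous d f" "int d = m + n + c" "to_fract F = to_fract f"
    using eq by (metis global_loc)
  then show ?thesis using that by auto
qed

lemma frame_commute: "frame m n s t F \<Longrightarrow> frame n m t s (- F)"
  by (auto simp: frame_def wd_commute[of t s])

lemma frame_divide_right:
  assumes "frame m n s t (p * F)" "prime_elem p" "homogeneous k p"
    "sv (inverse (to_fract p)) t \<in> lat (n - int k) (pri p)"
  shows "frame m (n - int k) s (sv (inverse (to_fract p)) t) F"
  using assms sections_divide[of t n p k] by (auto simp: frame_def wd_simps)

text \<open>Replacing \<open>s\<close> by a combination with coefficient \<open>A\<close> at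
  \<open>s\<close>, divided by \<open>p\<close>, multiplies the wedge product by
  \<open>A / p\<close>: the factor \<open>p\<close> of the divisor is traded for \<open>A\<close>.
  Progress depends on \<open>A\<close> being smaller than \<open>p\<close>.\<close>

lemma frame_combine:
  assumes fr: "frame m n s t (p * F)" and p: "prime_elem p" "homogeneous k p"
    and AB: "homogeneous i A" "homogeneous j B" "int i + m = int j + n" "A \<noteq> 0"
    and r: "sv (inverse (to_fract p)) (sv (to_fract A) s + sv (to_fract B) t) \<in> lat (int i + m - int k) (pri p)"
  shows "frame (int i + m - int k) n
     (sv (inverse (to_fract p)) (sv (to_fract A) s + sv (to_fract B) t)) t (A * F)"
proof -
  have "sv (to_fract A) s + sv (to_fract B) t \<in> sections (int i + m)"
    using sections_add[OF sections_sv[OF AB(1), of s m]] sections_sv[OF AB(2), of t n] AB(3) fr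
    by (auto simp: frame_def)
  then show ?thesis
    using sections_divide[OF _ p r] fr AB(4) p by (auto simp: frame_def wd_simps)
qed

text \<open>A prime dividing the wedge product makes the two sections dependent modulo that prime.\<close>

lemma frame_dependent:
  assumes fr: "frame m n s t F" and p: "prime_elem p" "homogeneous k p" "p dvd F"
    and t: "sv (inverse (to_fract p)) t \<notin> lat (n - int k) (pri p)"
  shows "\<exists>A B i j. homogeneous i A \<and> homogeneous j B \<and> int i + m = int j + n \<and> \<not> p dvd A \<and>
    sv (inverse (to_fract p)) (sv (to_fract A) s + sv (to_fract B) t) \<in> lat (int i + m - int k) (pri p)"
proof -
  have PP: "pri p \<in> Proj_ZXY" using p pri_in_Proj by blast
  define a b where "a = u (pri p)" and "b = w (pri p)"
  have ab: "wd a b \<noteq> 0" using basis[OF PP] by (simp add: a_def b_def)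
  have lat: "lat l (pri p) = span2 l (pri p) a b" for l by (simp add: lat_def a_def b_def)
  have s: "s \<in> span2 m (pri p) a b" and t': "t \<in> span2 n (pri p) a b"
    using fr PP sections_lat unfolding frame_def lat[symmetric] by blast+
  obtain \<alpha> \<beta> where s_eq: "s = sv \<alpha> a + sv \<beta> b" and sc: "\<alpha> \<in> loc m (pri p)" "\<beta> \<in> loc m (pri p)"
    using s by (rule span2E)
  obtain \<alpha>' \<beta>' where t_eq: "t = sv \<alpha>' a + sv \<beta>' b" and tc: "\<alpha>' \<in> loc n (pri p)" "\<beta>' \<in> loc n (pri p)"
    using t' by (rule span2E)
  have wdst: "wd s t = (\<alpha> * \<beta>' - \<beta> * \<alpha>') * wd a b"
    unfolding s_eq t_eq by (simp add: wd_simps wd_commute[of b a] algebra_simps)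
  \<comment> \<open>The wedge product is this minor times the determinant of the lattice; since
    \<open>p\<close> divides \<open>F\<close>, it divides the minor.\<close>
  have minor: "(\<alpha> * \<beta>' - \<beta> * \<alpha>') / to_fract p \<in> loc (m + n - int k) (pri p)"
  proof -
    obtain F' where F': "F = p * F'" using p(3) by (rule dvdE)
    obtain d where d: "homogeneous d F" "int d = m + n + c" using fr frame_degree by metis
    have F0: "F \<noteq> 0" using fr by (simp add: frame_def)
    have hF': "homogeneous (d - k) F'" "k \<le> d" using homogeneous_cofactor d F' p F0 by metis+
    have "(\<alpha> * \<beta>' - \<beta> * \<alpha>') / to_fract p = to_fract F' * inverse (det (pri p) / \<delta>)"
      using wdst fr F' ab p(1) unfolding frame_def det_def a_def[symmetric] b_def[symmetric]
      by (auto simp: field_simps)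
    moreover have "to_fract F' * inverse (det (pri p) / \<delta>) \<in> loc (int (d - k) + - c) (pri p)"
      using loc_to_fract[OF PP hF'(1)] delta(2)[OF PP] by (intro loc_mult PP) (auto simp: loc_unit_def)
    moreover have "int (d - k) + - c = m + n - int k" using d hF' by simp
    ultimately show ?thesis by simp
  qed
  \<comment> \<open>For corresponding coordinates \<open>\<gamma>\<close> of \<open>s\<close> and
    \<open>\<gamma>'\<close> of \<open>t\<close>, the coefficients \<open>\<gamma>'\<close> and
    \<open>- \<gamma>\<close> are cleared of denominators by \<open>e\<close>, the product of the
    two denominators. As \<open>\<gamma>'\<close> is not divisible by \<open>p\<close>, neither is
    \<open>A\<close>.\<close>
  have main: "\<exists>A B i j. homogeneous i A \<and> homogeneous j B \<and> int i + m = int j + n \<and> \<not> p dvd A \<and>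
      (\<exists>e. e \<in> loc (int i - n) (pri p) \<and> to_fract A = e * \<gamma>' \<and> to_fract B = - e * \<gamma>)"
    if g: "\<gamma> \<in> loc m (pri p)" "\<gamma>' \<in> loc n (pri p)" "\<gamma>' / to_fract p \<notin> loc (n - int k) (pri p)" for \<gamma> \<gamma>'
  proof -
    obtain g h d e where 1: "\<gamma> = Fract g h" "homogeneous d g" "homogeneous e h" "int d = int e + m" "h \<notin> pri p"
      using g(1) by (rule locE)
    obtain g' h' d' e' where 2: "\<gamma>' = Fract g' h'" "homogeneous d' g'" "homogeneous e' h'"
      "int d' = int e' + n" "h' \<notin> pri p" using g(2) by (rule locE)
    have h0: "h \<noteq> 0" "h' \<noteq> 0" using 1 2 by auto
    have pg: "\<not> p dvd g'"
      using loc_divide_prime_iff[OF p(1,2) 2(2,3,4) h0(2)] 2 g(3) by auto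
    have "\<not> p dvd h * g'" using pg 1 p(1) by (simp add: prime_elem_dvd_mult_iff)
    moreover have "homogeneous (e + d') (h * g')" using 1 2 by (intro homogeneous_mult)
    moreover have "homogeneous (e' + d) (- (h' * g))"
      using 1 2 by (intro homogeneous_uminus homogeneous_mult)
    moreover have "int (e + d') + m = int (e' + d) + n" using 1 2 by simp
    moreover have "to_fract (h * h') \<in> loc (int (e + e')) (pri p)"
      using 1 2 by (intro loc_to_fract PP homogeneous_mult)
    moreover have "int (e + e') = int (e + d') - n" using 2 by simp
    moreover have "to_fract (h * g') = to_fract (h * h') * \<gamma>'" "to_fract (- (h' * g)) = - to_fract (h * h') * \<gamma>"
      unfolding 1 2 Fract_conv_to_fract using h0 by auto
    ultimately show ?thesis by metis
  qed
  \<comment> \<open>The combination kills one coordinate, and the other becomes \<open>e\<close>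
    times the minor up to sign, hence is divisible by \<open>p\<close>.\<close>
  have fin: "sv (inverse (to_fract p)) (sv (to_fract A) s + sv (to_fract B) t) \<in> lat (int i + m - int k) (pri p)"
    if e: "e \<in> loc (int i - n) (pri p)"
      and A: "to_fract A = e * \<alpha>' \<and> to_fract B = - e * \<alpha> \<or> to_fract A = e * \<beta>' \<and> to_fract B = - e * \<beta>"
    for A B i e
  proof -
    define \<mu> where "\<mu> = (\<alpha> * \<beta>' - \<beta> * \<alpha>') / to_fract p"
    have "inverse (to_fract p) * (e * (\<alpha> * \<beta>' - \<beta> * \<alpha>')) = e * \<mu>" by (simp add: \<mu>_def field_simps)
    moreover have e\<mu>: "e * \<mu> \<in> loc (int i + m - int k) (pri p)" "- (e * \<mu>) \<in> loc (int i + m - int k) (pri p)"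
      using loc_mult[OF PP e minor] loc_uminus by (auto simp: \<mu>_def algebra_simps)
    moreover have "sv (inverse (to_fract p)) (sv (to_fract A) s + sv (to_fract B) t) \<in>
       {sv 0 a + sv (- (e * \<mu>)) b, sv (e * \<mu>) a + sv 0 b}"
    proof -
      have "sv (to_fract A) s + sv (to_fract B) t =
          sv (to_fract A * \<alpha> + to_fract B * \<alpha>') a + sv (to_fract A * \<beta> + to_fract B * \<beta>') b"
        unfolding s_eq t_eq by (simp add: prod_eq_iff algebra_simps)
      then show ?thesis using A by (auto simp: \<mu>_def prod_eq_iff divide_inverse algebra_simps)
    qed
    moreover have "sv 0 a + sv (- (e * \<mu>)) b \<in> lat (int i + m - int k) (pri p)"
      "sv (e * \<mu>) a + sv 0 b \<in> lat (int i + m - int k) (pri p)"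
      unfolding lat using e\<mu> by (auto intro!: span2I loc_0[OF PP])
    ultimately show ?thesis by (metis insertE singletonD)
  qed
  have "\<alpha>' / to_fract p \<notin> loc (n - int k) (pri p) \<or> \<beta>' / to_fract p \<notin> loc (n - int k) (pri p)"
  proof (rule ccontr)
    assume "\<not> ?thesis"
    then have "sv (\<alpha>' / to_fract p) a + sv (\<beta>' / to_fract p) b \<in> lat (n - int k) (pri p)"
      unfolding lat by (intro span2I) auto
    moreover have "sv (\<alpha>' / to_fract p) a + sv (\<beta>' / to_fract p) b = sv (inverse (to_fract p)) t"
      unfolding t_eq by (simp add: prod_eq_iff divide_inverse algebra_simps)
    ultimately show False using t by simp
  qed
  then show ?thesis
  proof
    assume "\<alpha>' / to_fract p \<notin> loc (n - int k) (pri p)"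
    from main[OF sc(1) tc(1) this] obtain A B i j e where "homogeneous i A" "homogeneous j B"
      "int i + m = int j + n" "\<not> p dvd A" "e \<in> loc (int i - n) (pri p)"
      "to_fract A = e * \<alpha>'" "to_fract B = - e * \<alpha>" by blast
    then show ?thesis using fin[of e i A B] by blast
  next
    assume "\<beta>' / to_fract p \<notin> loc (n - int k) (pri p)"
    from main[OF sc(2) tc(2) this] obtain A B i j e where "homogeneous i A" "homogeneous j B"
      "int i + m = int j + n" "\<not> p dvd A" "e \<in> loc (int i - n) (pri p)"
      "to_fract A = e * \<beta>'" "to_fract B = - e * \<beta>" by blast
    then show ?thesis using fin[of e i A B] by blast
  qed
qed

end

section \<open>Shrinking the degeneracy divisor\<close>

lemma prime_elem_xx: "prime_elem xx"
  unfolding xx_def by (intro lift_prime_elem_poly prime_elem_linear_poly) auto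

text \<open>Modulo \<open>x\<close> only the term in which \<open>y\<close> has exponent
  \<open>i\<close> survives, so residues of forms are integers up to powers of
  \<open>y\<close>.\<close>

lemma homogeneous_mod_xx:
  assumes "homogeneous i A"
  shows "\<exists>B. A = of_int (coeff (coeff A i) 0) * yy ^ i + xx * B"
proof -
  have y: "yy ^ i = monom 1 i" by (simp add: yy_def monom_altdef)
  have "xx dvd A - of_int (coeff (coeff A i) 0) * yy ^ i"
    unfolding xx_dvd_iff y using homogeneous_zero_coeff[OF assms, of _ 0]
    by (auto simp: of_int_poly)
  then show ?thesis by (metis dvdE diff_eq_eq add.commute)
qed

context lattice_det begin

text \<open>Trading a prime factor \<open>p\<close> of \<open>F\<close> for the coefficient
  \<open>A\<close> of a relation modulo \<open>p\<close> lowers the degree in \<open>y\<close> as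
  soon as \<open>A\<close> has smaller degree than \<open>p\<close>, and a relation in which the
  degree of \<open>A\<close> is least has this property.\<close>

lemma frame_smaller_degree:
  assumes fr: "frame m n s t F" and deg: "degree F > 0"
  shows "\<exists>m' n' s' t' F'. frame m' n' s' t' F' \<and> degree F' < degree F"
proof -
  have F0: "F \<noteq> 0" using fr by (simp add: frame_def)
  obtain d where d: "homogeneous d F" "int d = m + n + c" using frame_degree[OF fr] .
  obtain p where p: "prime_elem p" "p dvd F" "degree p > 0"
    using prime_factor_degree[OF deg F0] by blast
  obtain k where k: "homogeneous k p" using homogeneous_dvd[OF d(1) F0 p(2)] .
  have PP: "pri p \<in> Proj_ZXY" using p k pri_in_Proj by blast
  have p0: "p \<noteq> 0" using p by auto
  obtain F1 where F1: "F = p * F1" using p(2) by (rule dvdE)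
  have F10: "F1 \<noteq> 0" using F0 F1 by auto
  have degF: "degree F = degree p + degree F1" unfolding F1 using p0 F10 by (rule degree_mult_eq)
  define good where "good A \<longleftrightarrow> (\<exists>B i j. homogeneous i A \<and> homogeneous j B \<and> int i + m = int j + n \<and> \<not> p dvd A \<and>
    sv (inverse (to_fract p)) (sv (to_fract A) s + sv (to_fract B) t) \<in> lat (int i + m - int k) (pri p))" for A
  show ?thesis
  proof (cases "sv (inverse (to_fract p)) t \<in> lat (n - int k) (pri p)")
    case True
    have "frame m (n - int k) s (sv (inverse (to_fract p)) t) F1"
      using frame_divide_right[OF _ p(1) k True] fr F1 by simp
    then show ?thesis using degF p(3) by (metis less_add_same_cancel2)
  next
    case False
    then have "\<exists>A. good A" using frame_dependent[OF fr p(1) k p(2)] unfolding good_def by blast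
    then obtain A where A: "good A" "\<And>A'. good A' \<Longrightarrow> degree A \<le> degree A'"
      using exists_least_iff[of "\<lambda>e. \<exists>A. good A \<and> degree A = e"] by (metis not_le_imp_less)
    obtain B i j where AB: "homogeneous i A" "homogeneous j B" "int i + m = int j + n" "\<not> p dvd A"
      and r: "sv (inverse (to_fract p)) (sv (to_fract A) s + sv (to_fract B) t) \<in> lat (int i + m - int k) (pri p)"
      using A(1) unfolding good_def by blast
    have A0: "A \<noteq> 0" using AB by auto
    have "degree A < degree p"
    proof (rule ccontr)
      assume "\<not> degree A < degree p"
      then have le: "degree p \<le> degree A" by simp
      \<comment> \<open>One step of pseudo-division by \<open>p\<close>, with respect to the variable \<open>y\<close>, lowers the degree of \<open>A\<close>.\<close>
      define e e' where "e = degree A" and "e' = degree p"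
      define l where "l = [:lead_coeff p:]"
      define q where "q = monom (lead_coeff A) (e - e')"
      define A' where "A' = l * A - q * p"
      have lead_k: "coeff (lead_coeff p) j \<noteq> 0 \<Longrightarrow> e' + j = k" for j
        using k by (auto simp: homogeneous_def e'_def)
      have lead_i: "coeff (lead_coeff A) j \<noteq> 0 \<Longrightarrow> e + j = i" for j
        using AB(1) by (auto simp: homogeneous_def e_def)
      have e'k: "e' \<le> k"
      proof -
        obtain j where "coeff (lead_coeff p) j \<noteq> 0" using p0 by (metis coeff_0 leading_coeff_0_iff poly_eqI)
        then show ?thesis using lead_k by force
      qed
      have ei: "e \<le> i"
      proof -
        obtain j where "coeff (lead_coeff A) j \<noteq> 0" using A0 by (metis coeff_0 leading_coeff_0_iff poly_eqI)
        then show ?thesis using lead_i by force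
      qed
      have hl: "homogeneous (k - e') l"
        unfolding homogeneous_def l_def using lead_k by (force simp: coeff_pCons split: nat.splits)
      have hq: "homogeneous (i - e') q"
        unfolding homogeneous_def q_def using lead_i le by (force simp: e_def e'_def split: if_splits)
      have ee: "e' \<le> e" using le by (simp add: e_def e'_def)
      have eq1: "k - e' + i = i - e' + k" using e'k ei ee by simp
      have "homogeneous (k - e' + i) A'"
        unfolding A'_def using homogeneous_mult[OF hl AB(1)] homogeneous_mult[OF hq k] eq1
        by (intro homogeneous_diff) auto
      moreover have "homogeneous (k - e' + j) (l * B)" by (rule homogeneous_mult[OF hl AB(2)])
      moreover have "int (k - e' + i) + m = int (k - e' + j) + n" using AB(3) by simp
      \<comment> \<open>Here the positive degree of \<open>p\<close> in \<open>y\<close> is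
        essential: the multiplier \<open>l\<close> does not involve \<open>y\<close>, so
        \<open>p\<close> cannot divide it.\<close>
      moreover have pA': "\<not> p dvd A'"
      proof
        assume "p dvd A'"
        then have "p dvd l * A" unfolding A'_def by (metis diff_add_cancel dvd_add dvd_triv_right)
        then have "p dvd l" using AB(4) p(1) by (simp add: prime_elem_dvd_mult_iff)
        moreover have "l \<noteq> 0" using p0 by (simp add: l_def)
        ultimately have "degree p \<le> degree l" by (rule dvd_imp_degree_le)
        then show False using p(3) by (simp add: l_def)
      qed
      moreover have "sv (inverse (to_fract p)) (sv (to_fract A') s + sv (to_fract (l * B)) t)
          \<in> lat (int (k - e' + i) + m - int k) (pri p)"
      proof -
        \<comment> \<open>The subtracted multiple \<open>q * p\<close> contributes only
          \<open>- q\<close> times \<open>s\<close>, which lies in the lattice already.\<close>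
        have "sv (inverse (to_fract p)) (sv (to_fract A') s + sv (to_fract (l * B)) t) =
          sv (to_fract l) (sv (inverse (to_fract p)) (sv (to_fract A) s + sv (to_fract B) t))
            + sv (to_fract (- q)) s"
          unfolding A'_def using p0 by (simp add: prod_eq_iff field_simps)
        moreover have "sv (to_fract l) (sv (inverse (to_fract p)) (sv (to_fract A) s + sv (to_fract B) t))
            \<in> lat (int (k - e') + (int i + m - int k)) (pri p)"
          by (intro lat_sv PP loc_to_fract hl r)
        moreover have "sv (to_fract (- q)) s \<in> lat (int (i - e') + m) (pri p)"
          using fr unfolding frame_def
          by (intro lat_sv PP loc_to_fract homogeneous_uminus hq sections_lat) auto
        moreover have "int (k - e') + (int i + m - int k) = int (k - e' + i) + m - int k"
          "int (i - e') + m = int (k - e' + i) + m - int k" using e'k ei ee by simp_all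
        ultimately show ?thesis using lat_add[OF PP] by metis
      qed
      ultimately have "good A'" unfolding good_def by blast
      have "degree A' \<le> e"
        unfolding A'_def
      proof (rule degree_diff_le)
        show "degree (l * A) \<le> e" using degree_mult_le[of l A] by (simp add: l_def e_def)
        show "degree (q * p) \<le> e"
          using degree_mult_le[of q p] degree_monom_le[of "lead_coeff A" "e - e'"] ee
          unfolding q_def e'_def[symmetric] by linarith
      qed
      moreover have "coeff A' e = 0"
      proof -
        have "coeff (l * A) e = lead_coeff p * lead_coeff A" by (simp add: l_def e_def)
        moreover have "coeff (q * p) e = lead_coeff A * lead_coeff p"
          unfolding q_def using ee by (simp add: coeff_monom_mult e'_def)
        ultimately show ?thesis by (simp add: A'_def mult.commute)
      qed
      ultimately have "degree A' < e"
        using pA' by (metis dvd_0_right leading_coeff_0_iff le_neq_implies_less)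
      then show False using A(2)[OF \<open>good A'\<close>] by (simp add: e_def)
    qed
    moreover have "degree (A * F1) = degree A + degree F1" using A0 F10 by (rule degree_mult_eq)
    moreover have "frame (int i + m - int k) n
        (sv (inverse (to_fract p)) (sv (to_fract A) s + sv (to_fract B) t)) t (A * F1)"
      using frame_combine[OF _ p(1) k AB(1-3) A0 r] fr F1 by simp
    ultimately show ?thesis using degF by (metis add_less_cancel_right)
  qed
qed

text \<open>
  If \<open>F\<close> has degree \<open>0\<close> in \<open>y\<close>, it is an integer times a power of \<open>x\<close>; at the prime \<open>x\<close> all residues
  are integers times powers of \<open>y\<close>, so a dependence relation can be normalised to have
  an integer as its coefficient at the section of larger twist.
\<close>

lemma frame_smaller_total:
  assumes fr: "frame m n s t F" and deg: "degree F = 0" and mn: "n \<le> m" and tot: "m + n + c > 0"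
  shows "\<exists>m' n' s' t' F'. frame m' n' s' t' F' \<and> degree F' = 0 \<and> m' + n' < m + n"
proof -
  have F0: "F \<noteq> 0" using fr by (simp add: frame_def)
  obtain d where d: "homogeneous d F" "int d = m + n + c" using frame_degree[OF fr] .
  have PP: "pri xx \<in> Proj_ZXY" using prime_elem_xx pri_in_Proj homogeneous_xx by blast
  \<comment> \<open>\<open>F\<close> does not involve \<open>y\<close> and has positive total
    degree, so it has no term free of \<open>x\<close>.\<close>
  have "coeff (coeff F i) 0 = 0" for i
    using deg homogeneous_zero_coeff[OF d(1), of i 0] d(2) tot by (cases i) (auto simp: coeff_eq_0)
  then have dvd: "xx dvd F" by (simp add: xx_dvd_iff)
  then obtain F1 where F1: "F = xx * F1" by (rule dvdE)
  have "degree F = degree xx + degree F1" unfolding F1 using F0 F1 by (intro degree_mult_eq) auto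
  then have deg1: "degree F1 = 0" using deg by simp
  show ?thesis
  proof (cases "sv (inverse (to_fract xx)) t \<in> lat (n - int (Suc 0)) (pri xx)")
    case True
    have "frame m (n - int (Suc 0)) s (sv (inverse (to_fract xx)) t) F1"
      using frame_divide_right[OF _ prime_elem_xx homogeneous_xx True] fr F1 by simp
    then show ?thesis using deg1 by fastforce
  next
    case False
    obtain A B i j where AB: "homogeneous i A" "homogeneous j B" "int i + m = int j + n" "\<not> xx dvd A"
      and r: "sv (inverse (to_fract xx)) (sv (to_fract A) s + sv (to_fract B) t) \<in>
        lat (int i + m - int (Suc 0)) (pri xx)"
      using frame_dependent[OF fr prime_elem_xx homogeneous_xx dvd False] by blast
    define a b l where "a = coeff (coeff A i) 0" and "b = coeff (coeff B j) 0" and "l = nat (m - n)"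
    have jl: "j = l + i" using AB(3) mn by (simp add: l_def)
    have a0: "a \<noteq> 0" using AB(4) homogeneous_zero_coeff[OF AB(1)] unfolding a_def xx_dvd_iff
      by (metis add.right_neutral)
    obtain A1 where A1: "A = of_int a * yy ^ i + xx * A1"
      using homogeneous_mod_xx[OF AB(1)] unfolding a_def by blast
    obtain B1 where B1: "B = of_int b * yy ^ j + xx * B1"
      using homogeneous_mod_xx[OF AB(2)] unfolding b_def by blast
    \<comment> \<open>The multiples of \<open>x\<close> in \<open>A\<close> and \<open>B\<close>
      contribute lattice vectors after division by \<open>x\<close>; only the residues, integers
      times powers of \<open>y\<close>, matter for the relation.\<close>
    have quot: "to_fract G1 \<in> loc (int e - int (Suc 0)) (pri xx)"
      if G: "homogeneous e G" "G = of_int g * yy ^ e + xx * G1" for e G G1 g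
    proof (cases "G1 = 0")
      case False
      have "homogeneous (0 + e * Suc 0) (of_int g * yy ^ e)"
        by (intro homogeneous_mult homogeneous_power) auto
      then have "homogeneous e (G - of_int g * yy ^ e)" using G(1) by (intro homogeneous_diff) auto
      then have "homogeneous e (xx * G1)" using G(2) by simp
      then have "Suc 0 \<le> e" "homogeneous (e - Suc 0) G1"
        using homogeneous_cofactor[OF _ _ homogeneous_xx] False by auto
      then show ?thesis using loc_to_fract[OF PP, of "e - Suc 0" G1] by (simp add: of_nat_diff)
    qed (use loc_0[OF PP] in simp)
    \<comment> \<open>The power \<open>yy ^ i\<close> common to both residues is split off. Since
      \<open>n \<le> m\<close>, the exponent \<open>l = m - n\<close> left at \<open>t\<close> is
      not negative, and the coefficient left at \<open>s\<close> is an integer.\<close>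
    define C where "C = sv (to_fract (of_int a)) s + sv (to_fract (of_int b * yy ^ l)) t"
    have "sv (inverse (to_fract xx)) (sv (to_fract A) s + sv (to_fract B) t) +
        (sv (- to_fract A1) s + sv (- to_fract B1) t) = sv (to_fract (yy ^ i)) (sv (inverse (to_fract xx)) C)"
      unfolding A1 B1 C_def by (simp add: jl power_add prod_eq_iff field_simps)
    moreover have "sv (- to_fract A1) s \<in> lat (int i + m - int (Suc 0)) (pri xx)"
      using lat_sv[OF PP loc_uminus[OF quot[OF AB(1) A1]] sections_lat[OF _ PP], of s m] fr
      by (simp add: frame_def algebra_simps)
    moreover have "sv (- to_fract B1) t \<in> lat (int i + m - int (Suc 0)) (pri xx)"
      using lat_sv[OF PP loc_uminus[OF quot[OF AB(2) B1]] sections_lat[OF _ PP], of t n] fr AB(3)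
      by (simp add: frame_def algebra_simps)
    ultimately have yC: "sv (to_fract (yy ^ i)) (sv (inverse (to_fract xx)) C) \<in>
        lat (int i + m - int (Suc 0)) (pri xx)"
      using lat_add[OF PP r lat_add[OF PP]] by metis
    \<comment> \<open>As \<open>y\<close> is a unit at \<open>pri xx\<close>, the factor
      \<open>yy ^ i\<close> can be removed. The coefficient of \<open>s\<close> now has degree 0, so
      the first twist drops from \<open>m\<close> to \<open>m - 1\<close>.\<close>
    have "\<not> xx dvd yy ^ i"
    proof
      assume "xx dvd yy ^ i"
      then have "xx dvd yy" by (rule prime_elem_dvd_power[OF prime_elem_xx])
      then have "coeff (coeff yy 1) 0 = 0" unfolding xx_dvd_iff by blast
      then show False by (simp add: yy_def)
    qed
    then have "inverse (to_fract (yy ^ i)) \<in> loc (- int (i * Suc 0)) (pri xx)"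
      by (intro loc_inverse_to_fract PP homogeneous_power) auto
    from lat_sv[OF PP this yC]
    have "sv (inverse (to_fract xx)) C \<in> lat (int 0 + m - int (Suc 0)) (pri xx)"
      by (simp add: algebra_simps)
    from frame_combine[OF _ prime_elem_xx homogeneous_xx _ _ _ _ this[unfolded C_def], where F = F1 and j = l]
    have "frame (int 0 + m - int (Suc 0)) n (sv (inverse (to_fract xx)) C) t (of_int a * F1)"
      using fr F1 mn a0 homogeneous_mult[OF homogeneous_of_int homogeneous_power[OF homogeneous_yy], of l b]
      by (simp add: C_def l_def)
    moreover have "degree (of_int a * F1) = 0" using deg1 by (simp add: of_int_poly)
    ultimately show ?thesis by fastforce
  qed
qed

section \<open>Descent to a primitive section\<close>

text \<open>Both quantities to be minimised are natural numbers: the degree of \<open>F\<close> in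
  \<open>y\<close>, and \<open>m + n + c\<close>, which is the total degree of \<open>F\<close>.
  Once the latter is 0, \<open>F\<close> is an integer, so the two sections are dependent at most
  along fibres over primes of \<int>.\<close>

lemma ex_frame_total_0:
  obtains m n s t F where "frame m n s t F" "m + n + c = 0"
proof -
  define P where "P k \<longleftrightarrow> (\<exists>m n s t F. frame m n s t F \<and> degree F = k)" for k
  define Q where "Q k \<longleftrightarrow> (\<exists>m n s t F. frame m n s t F \<and> degree F = 0 \<and> int k = m + n + c)" for k
  obtain N s t where "s \<in> sections N" "t \<in> sections N" "wd s t \<noteq> 0"
    by (rule ex_independent_sections)
  then obtain F where "frame N N s t F" by (rule frameI)
  then have "P (degree F)" unfolding P_def by blast
  then have "P (LEAST k. P k)" by (rule LeastI)
  moreover have "(LEAST k. P k) = 0"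
  proof (rule ccontr)
    assume "(LEAST k. P k) \<noteq> 0"
    then obtain k where "P k" "k < (LEAST k. P k)"
      using \<open>P (LEAST k. P k)\<close> frame_smaller_degree unfolding P_def by (metis neq0_conv)
    then show False using not_less_Least by blast
  qed
  ultimately have "P 0" by simp
  then obtain m n s t F where 0: "frame m n s t F" "degree F = 0" unfolding P_def by blast
  then obtain d where "int d = m + n + c" using frame_degree by metis
  then have "Q d" using 0 unfolding Q_def by blast
  then have Q: "Q (LEAST k. Q k)" by (rule LeastI)
  have "(LEAST k. Q k) = 0"
  proof (rule ccontr)
    assume pos: "(LEAST k. Q k) \<noteq> 0"
    obtain m n s t F where fr: "frame m n s t F" "degree F = 0" "int (LEAST k. Q k) = m + n + c"
      using Q unfolding Q_def by blast
    have pos': "m + n + c > 0" using fr(3) pos by linarith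
    have "\<exists>m' n' s' t' F'. frame m' n' s' t' F' \<and> degree F' = 0 \<and> m' + n' < m + n"
    proof (cases "n \<le> m")
      case True
      then show ?thesis using frame_smaller_total[OF fr(1,2) _ pos'] by blast
    next
      case False
      then show ?thesis using frame_smaller_total[OF frame_commute[OF fr(1)]] fr(2) pos'
        by (simp add: add.commute)
    qed
    then obtain m' n' s' t' F' where fr': "frame m' n' s' t' F'" "degree F' = 0" "m' + n' < m + n"
      by blast
    obtain d' where d': "int d' = m' + n' + c" using frame_degree[OF fr'(1)] by metis
    then have "Q d'" using fr' unfolding Q_def by blast
    moreover have "d' < (LEAST k. Q k)" using d' fr(3) fr'(3) by linarith
    ultimately show False using not_less_Least by blast
  qed
  then show ?thesis using Q that unfolding Q_def by (metis of_nat_0)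
qed

text \<open>Of two twists with sum \<open>- c\<close> the smaller is at most half of it. Dividing
  that section by a prime form does not raise its twist and removes a prime factor of
  \<open>F\<close>, while the other section stays fixed; so a frame with fewest prime factors has a
  primitive first section.\<close>

lemma ex_primitive_section:
  obtains n s where "s \<in> sections n" "s \<noteq> 0" "2 * n \<le> - c"
    "\<And>p k. prime_elem p \<Longrightarrow> homogeneous k p \<Longrightarrow> sv (inverse (to_fract p)) s \<notin> lat (n - int k) (pri p)"
proof -
  have "\<exists>m n s t F. frame m n s t F \<and> 2 * m \<le> - c"
  proof -
    obtain m n s t F where fr: "frame m n s t F" "m + n + c = 0" by (rule ex_frame_total_0)
    then show ?thesis
      by (cases "m \<le> n") (smt (verit) frame_commute)+
  qed
  then obtain m0 n s0 t F0 where start: "frame m0 n s0 t F0" "2 * m0 \<le> - c" by blast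
  define P where "P k \<longleftrightarrow> (\<exists>m s F. frame m n s t F \<and> 2 * m \<le> - c \<and> size (prime_factorization F) = k)" for k
  have "P (size (prime_factorization F0))" using start unfolding P_def by blast
  then have "P (LEAST k. P k)" by (rule LeastI)
  then obtain m s F where fr: "frame m n s t F" "2 * m \<le> - c"
    and least: "size (prime_factorization F) = (LEAST k. P k)" unfolding P_def by blast
  show ?thesis
  proof (rule that[of s m])
    show "s \<in> sections m" "2 * m \<le> - c" using fr by (auto simp: frame_def)
    show "s \<noteq> 0" using fr delta(1) by (auto simp: frame_def wd_def)
    fix p k assume p: "prime_elem p" "homogeneous k p"
    have p0: "p \<noteq> 0" using p by auto
    show "sv (inverse (to_fract p)) s \<notin> lat (m - int k) (pri p)"
    proof
      assume "sv (inverse (to_fract p)) s \<in> lat (m - int k) (pri p)"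
      then have sec: "sv (inverse (to_fract p)) s \<in> sections (m - int k)"
        using sections_divide[OF _ p] fr by (auto simp: frame_def)
      have "wd (sv (inverse (to_fract p)) s) t \<noteq> 0"
        using fr p0 delta(1) by (auto simp: frame_def wd_simps)
      then obtain F' where F': "frame (m - int k) n (sv (inverse (to_fract p)) s) t F'"
        using fr by (metis frameI[OF sec] frame_def)
      then have "to_fract F = to_fract (p * F')"
        using fr p0 delta(1) by (auto simp: frame_def wd_simps field_simps)
      then have "F = p * F'" "F' \<noteq> 0" using F' by (auto simp: frame_def simp del: to_fract_mult)
      then have "size (prime_factorization F) = Suc (size (prime_factorization F'))"
        using p p0 prime_factorization_prime[of "normalize p"] by (simp add: prime_factorization_mult)
      moreover have "P (size (prime_factorization F'))"
        using F' fr(2) unfolding P_def by (intro exI conjI) (assumption, auto)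
      ultimately show False using not_less_Least[of "size (prime_factorization F')" P] least by simp
    qed
  qed
qed

text \<open>The quotient of the bundle by the line subbundle spanned by \<open>s\<close> is torsion free.\<close>

lemma primitive_section_saturated:
  assumes s: "s \<in> sections n" "s \<noteq> 0"
    and prim: "\<And>p k. prime_elem p \<Longrightarrow> homogeneous k p \<Longrightarrow> sv (inverse (to_fract p)) s \<notin> lat (n - int k) (pri p)"
    and P: "P \<in> Proj_ZXY" and v: "v \<in> lat m P" "wd s v = 0"
  obtains \<tau> where "\<tau> \<in> loc (m - n) P" "v = sv \<tau> s"
proof -
  have seta: "fst s \<in> loc n eta" "snd s \<in> loc n eta" and veta: "fst v \<in> loc m eta" "snd v \<in> loc m eta"
    using sections_lat[OF s(1) eta_in_Proj] lat_mono[OF P eta_in_Proj eta_subset[OF P] v(1)]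
    by (auto simp: lat_eta)
  have div: "a / b \<in> loc (m - n) eta" if "a \<in> loc m eta" "b \<in> loc n eta" "b \<noteq> 0" for a b
    using loc_mult[OF eta_in_Proj that(1) loc_eta_inverse[OF that(2,3)]] by (simp add: divide_inverse)
  \<comment> \<open>The vanishing wedge product makes \<open>v\<close> a multiple of
    \<open>s\<close> over the field; a nonzero coordinate of \<open>s\<close> gives the
    factor.\<close>
  have "\<exists>\<tau>. \<tau> \<in> loc (m - n) eta \<and> v = sv \<tau> s"
  proof (cases "fst s = 0")
    case True
    then have "snd s \<noteq> 0" using s(2) by (auto simp: prod_eq_iff)
    then show ?thesis using True v(2) div[OF veta(2) seta(2)]
      by (intro exI[of _ "snd v / snd s"]) (auto simp: wd_def prod_eq_iff)
  next
    case False
    then show ?thesis using v(2) div[OF veta(1) seta(1)]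
      by (intro exI[of _ "fst v / fst s"]) (auto simp: wd_def prod_eq_iff field_simps)
  qed
  then obtain \<tau> where \<tau>: "\<tau> \<in> loc (m - n) eta" "v = sv \<tau> s" by blast
  have "\<tau> \<in> loc (m - n) P"
  proof (rule loc_Hartogs[OF P \<tau>(1)])
    fix p k assume p: "prime_elem p" "homogeneous k p" "p \<in> P"
    have PP: "pri p \<in> Proj_ZXY" using pri_in_Proj p by blast
    have sub: "pri p \<subseteq> P" using Proj_dvd[OF P p(3)] by auto
    show "\<tau> \<in> loc (m - n) (pri p)"
    proof (cases "\<tau> = 0")
      case True
      then show ?thesis using loc_0[OF PP] by simp
    next
      case False
      obtain g h d e where gh: "\<tau> = Fract g h" "homogeneous d g" "homogeneous e h"
        "int d = int e + (m - n)" "g \<noteq> 0" "h \<noteq> 0" "coprime g h"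
        by (rule loc_lowest[OF \<tau>(1) False])
      have "\<not> p dvd h"
      proof
        \<comment> \<open>A pole of \<open>\<tau>\<close> along \<open>p\<close> is reversed:
          multiplying \<open>v\<close> by \<open>h / (p * g)\<close>, which is regular at
          \<open>pri p\<close>, yields \<open>s\<close> divided by \<open>p\<close>, against
          primitivity.\<close>
        assume ph: "p dvd h"
        then obtain h1 where h1: "h = p * h1" by (rule dvdE)
        have pg: "\<not> p dvd g" using gh(7) ph p(1) by (metis coprime_common_divisor prime_elem_not_unit)
        have hh1: "homogeneous (e - k) h1" "k \<le> e" using homogeneous_cofactor[of e p h1 k] gh p h1 by auto
        have "v \<in> lat m (pri p)" by (rule lat_mono[OF P PP sub v(1)])
        moreover have "Fract h1 g \<in> loc (int (e - k) - int d) (pri p)"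
          using hh1 gh pg by (intro locI) auto
        ultimately have "sv (Fract h1 g) v \<in> lat (int (e - k) - int d + m) (pri p)"
          using lat_sv[OF PP] by blast
        moreover have "Fract h1 g * \<tau> = inverse (to_fract p)"
          unfolding gh(1) h1 to_fract_def using gh(5,6) h1 by (simp add: eq_fract)
        moreover have "int (e - k) - int d + m = n - int k" using gh hh1 by simp
        ultimately have "sv (inverse (to_fract p)) s \<in> lat (n - int k) (pri p)"
          unfolding \<tau>(2) by simp
        then show False using prim[OF p(1,2)] by blast
      qed
      then show ?thesis using gh by (auto intro: locI)
    qed
  qed
  then show ?thesis using \<tau>(2) that by blast
qed

end

section \<open>Sheaves of locally constant functions\<close>

text \<open>
  Every nonempty open set contains the generic point, so the sections of a torsion-free sheaf are
  functions with values in its generic fibre that are locally, hence globally, constant and lie in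
  the prescribed stalk at each point.
\<close>

definition cs :: "(zxy set \<Rightarrow> 'w set) \<Rightarrow> zxy set set \<Rightarrow> (zxy set \<Rightarrow> 'w) set" where
  "cs L U = {s \<in> extensional U. \<forall>P\<in>U. \<exists>V v. openin Proj_topology V \<and> P \<in> V \<and> V \<subseteq> U \<and>
     (\<forall>Q\<in>V. s Q = v \<and> v \<in> L Q)}"

definition cst :: "'w \<Rightarrow> zxy set set \<Rightarrow> zxy set \<Rightarrow> 'w" where
  "cst v U = (\<lambda>P\<in>U. v)"

lemma cst_apply [simp]: "P \<in> U \<Longrightarrow> cst v U P = v"
  by (simp add: cst_def)

lemma restrict_cst [simp]: "V \<subseteq> U \<Longrightarrow> restrict (cst v U) V = cst v V"
  by (auto simp: cst_def fun_eq_iff)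

lemma cst_eq_iff: "U \<noteq> {} \<Longrightarrow> cst v U = cst w U \<longleftrightarrow> v = w"
  by (metis cst_apply ex_in_conv)

lemma cst_empty: "cst v {} = cst w {}"
  by (simp add: cst_def restrict_def)

lemma is_open_P1Z [simp]: "Top P1Z = Proj_topology"
  by (simp add: P1Z_def)

lemma Res_Str_P1Z [simp]: "Res (Str P1Z) U V s = restrict s V"
  by (simp add: P1Z_def)

lemma ring_at_P1Z [simp]:
  "carrier (ring_at P1Z U) = twist_sections 0 U"
  "s \<otimes>\<^bsub>ring_at P1Z U\<^esub> t = (\<lambda>P\<in>U. s P * t P)"
  "s \<oplus>\<^bsub>ring_at P1Z U\<^esub> t = (\<lambda>P\<in>U. s P + t P)"
  "\<one>\<^bsub>ring_at P1Z U\<^esub> = cst 1 U" "\<zero>\<^bsub>ring_at P1Z U\<^esub> = cst 0 U"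
  by (simp_all add: P1Z_def cst_def)

text \<open>A fraction representing a value at one point is a legitimate representation on all of
  \<open>Dplus\<close> of its denominator, so prescribing fractions locally and prescribing values
  in the stalks come to the same.\<close>

lemma twist_sections_eq_cs: "twist_sections n U = cs (loc n) U"
proof (intro equalityI subsetI)
  fix s assume s: "s \<in> twist_sections n U"
  show "s \<in> cs (loc n) U"
    unfolding cs_def
  proof (intro CollectI conjI ballI)
    show "s \<in> extensional U" using s by (simp add: twist_sections_def)
    fix P assume "P \<in> U"
    then obtain V g h d e where "openin Proj_topology V" "P \<in> V" "V \<subseteq> U" "homogeneous d g"
      "homogeneous e h" "int d = int e + n" "\<forall>Q\<in>V. h \<notin> Q \<and> s Q = Fract g h"
      using s unfolding twist_sections_def by blast
    then show "\<exists>V v. openin Proj_topology V \<and> P \<in> V \<and> V \<subseteq> U \<and> (\<forall>Q\<in>V. s Q = v \<and> v \<in> loc n Q)"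
      by (intro exI[of _ V] exI[of _ "Fract g h"]) (auto intro: locI)
  qed
next
  fix s assume s: "s \<in> cs (loc n) U"
  show "s \<in> twist_sections n U"
    unfolding twist_sections_def
  proof (intro CollectI conjI ballI)
    show "s \<in> extensional U" using s by (simp add: cs_def)
    fix P assume "P \<in> U"
    then obtain V v where V: "openin Proj_topology V" "P \<in> V" "V \<subseteq> U" "\<forall>Q\<in>V. s Q = v \<and> v \<in> loc n Q"
      using s unfolding cs_def by blast
    then have "v \<in> loc n P" by blast
    then obtain g h d e where gh: "v = Fract g h" "homogeneous d g" "homogeneous e h" "int d = int e + n" "h \<notin> P"
      by (rule locE)
    have "P \<in> Proj_ZXY" using V open_Proj_subset by blast
    then have "openin Proj_topology (V \<inter> Dplus h)" "P \<in> V \<inter> Dplus h"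
      using V openin_Dplus gh by (auto simp: Dplus_def)
    moreover have "\<forall>Q\<in>V \<inter> Dplus h. h \<notin> Q \<and> s Q = Fract g h" using V gh by (auto simp: Dplus_def)
    ultimately show "\<exists>V g h d e. openin Proj_topology V \<and> P \<in> V \<and> V \<subseteq> U \<and> homogeneous d g \<and>
        homogeneous e h \<and> int d = int e + n \<and> (\<forall>Q\<in>V. h \<notin> Q \<and> s Q = Fract g h)"
      using V(3) gh(2-4) by blast
  qed
qed

text \<open>The value type is left open so that one construction covers twists and ideals, with
  values in the field, and the bundle of rank two, with values in \<open>kvec\<close>.\<close>

definition latt :: "(zxy set \<Rightarrow> 'w set) \<Rightarrow> (zxy fract \<Rightarrow> 'w \<Rightarrow> 'w) \<Rightarrow>
    (zxy set, zxy_section, zxy set \<Rightarrow> 'w::ab_group_add) mod_presheaf" where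
  "latt L sm =
     \<lparr> Sec = (\<lambda>U. \<lparr> carrier = cs L U, monoid.mult = undefined, one = undefined,
                    ring.zero = (\<lambda>P\<in>U. 0),
                    add = (\<lambda>s t. \<lambda>P\<in>U. s P + t P),
                    module.smult = (\<lambda>r s. \<lambda>P\<in>U. sm (r P) (s P)) \<rparr>),
       Res = (\<lambda>U V s. restrict s V) \<rparr>"

lemma latt_simps [simp]:
  "carrier (Sec (latt L sm) U) = cs L U"
  "\<zero>\<^bsub>Sec (latt L sm) U\<^esub> = cst 0 U"
  "s \<oplus>\<^bsub>Sec (latt L sm) U\<^esub> t = (\<lambda>P\<in>U. s P + t P)"
  "r \<odot>\<^bsub>Sec (latt L sm) U\<^esub> s = (\<lambda>P\<in>U. sm (r P) (s P))"
  "Res (latt L sm) U V s = restrict s V"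
  by (simp_all add: latt_def cst_def)

text \<open>This is an equality of records, not merely an isomorphism, so everything proved about
  \<open>latt\<close> applies to the given sheaf without transport; likewise for ideals
  below.\<close>

lemma twisting_sheaf_eq_latt: "twisting_sheaf n = latt (loc n) (*)"
  unfolding twisting_sheaf_def latt_def twist_sections_eq_cs ..

lemma ideal_as_module_eq_latt: "ideal_as_module P1Z (cs L) = latt L (*)"
  unfolding ideal_as_module_def latt_def by (simp add: P1Z_def)

lemma lambda_cst [simp]:
  "(\<lambda>P\<in>U. f (cst v U P)) = cst (f v) U"
  "(\<lambda>P\<in>U. g (cst v U P) (cst w U P)) = cst (g v w) U"
  by (auto simp: cst_def fun_eq_iff)

section \<open>Sheaves defined by lattices\<close>

text \<open>\<open>L_open\<close> ties the stalks together: an element of one stalk lies in all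
  stalks near by, hence is the germ of a constant section.\<close>

locale klattice =
  fixes L :: "zxy set \<Rightarrow> 'w::ab_group_add set" and sm :: "zxy fract \<Rightarrow> 'w \<Rightarrow> 'w"
  assumes vs: "vector_space sm"
    and L_0: "P \<in> Proj_ZXY \<Longrightarrow> 0 \<in> L P"
    and L_add: "P \<in> Proj_ZXY \<Longrightarrow> v \<in> L P \<Longrightarrow> w \<in> L P \<Longrightarrow> v + w \<in> L P"
    and L_sm: "P \<in> Proj_ZXY \<Longrightarrow> r \<in> loc 0 P \<Longrightarrow> v \<in> L P \<Longrightarrow> sm r v \<in> L P"
    and L_open: "P \<in> Proj_ZXY \<Longrightarrow> v \<in> L P \<Longrightarrow>
      \<exists>V. openin Proj_topology V \<and> P \<in> V \<and> (\<forall>Q\<in>V. v \<in> L Q)"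
begin

lemma L_uminus: "P \<in> Proj_ZXY \<Longrightarrow> v \<in> L P \<Longrightarrow> - v \<in> L P"
proof -
  interpret vector_space sm by (rule vs)
  assume "P \<in> Proj_ZXY" "v \<in> L P"
  then show ?thesis using L_sm[OF _ loc_uminus[OF loc_1]] scale_minus_left[of 1 v] by auto
qed

lemma cs_cst:
  assumes U: "openin Proj_topology U" and v: "\<And>P. P \<in> U \<Longrightarrow> v \<in> L P"
  shows "cst v U \<in> cs L U"
  unfolding cs_def
proof (intro CollectI conjI ballI)
  show "cst v U \<in> extensional U" by (simp add: cst_def)
  fix P assume "P \<in> U"
  then show "\<exists>V v'. openin Proj_topology V \<and> P \<in> V \<and> V \<subseteq> U \<and> (\<forall>Q\<in>V. cst v U Q = v' \<and> v' \<in> L Q)"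
    using U v by (intro exI[of _ U] exI[of _ v]) auto
qed

end

lemma cs_value:
  assumes "openin Proj_topology U" "s \<in> cs L U" "P \<in> U"
  shows "s P = s eta" "s P \<in> L P"
proof -
  obtain V v where "openin Proj_topology V" "P \<in> V" "V \<subseteq> U" "\<forall>Q\<in>V. s Q = v \<and> v \<in> L Q"
    using assms unfolding cs_def by blast
  then show "s P = s eta" "s P \<in> L P" using eta_in_open by auto
qed

lemma csE:
  assumes "openin Proj_topology U" "s \<in> cs L U"
  obtains v where "s = cst v U" "\<And>P. P \<in> U \<Longrightarrow> v \<in> L P"
proof (rule that[of "s eta"])
  have "s \<in> extensional U" using assms by (simp add: cs_def)
  then show "s = cst (s eta) U"
    unfolding cst_def by (intro extensionalityI[of _ U]) (auto simp: cs_value(1)[OF assms])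
  show "s eta \<in> L P" if "P \<in> U" for P using cs_value[OF assms that] by simp
qed

lemma cs_iff:
  assumes "openin Proj_topology U" "klattice L sm"
  shows "s \<in> cs L U \<longleftrightarrow> (\<exists>v. s = cst v U \<and> (\<forall>P\<in>U. v \<in> L P))"
  using klattice.cs_cst[OF assms(2,1)] csE[OF assms(1)] by metis

lemma klattice_loc: "klattice (loc n) (*)"
proof
  fix P v assume "P \<in> Proj_ZXY" "v \<in> loc n P"
  then show "\<exists>V. openin Proj_topology V \<and> P \<in> V \<and> (\<forall>Q\<in>V. v \<in> loc n Q)" by (rule loc_open)
qed (auto simp: algebra_simps loc_0 loc_add loc_mult0)

lemmas in_twist_iff = cs_iff[OF _ klattice_loc]

lemma cring_P1Z:
  assumes U: "openin Proj_topology U" shows "cring (ring_at P1Z U)"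
proof -
  have Proj: "P \<in> Proj_ZXY" if "P \<in> U" for P using U open_Proj_subset that by blast
  note [simp] = twist_sections_eq_cs in_twist_iff[OF U]
  note [intro] = loc_0 loc_add loc_mult0 loc_1 loc_uminus Proj
  show ?thesis
  proof (rule cringI)
    show "abelian_group (ring_at P1Z U)"
    proof (rule abelian_groupI)
      fix x assume "x \<in> carrier (ring_at P1Z U)"
      then obtain v where v: "x = cst v U" "\<forall>P\<in>U. v \<in> loc 0 P" by auto
      then show "\<exists>y\<in>carrier (ring_at P1Z U). y \<oplus>\<^bsub>ring_at P1Z U\<^esub> x = \<zero>\<^bsub>ring_at P1Z U\<^esub>"
        by (intro bexI[of _ "cst (- v) U"]) (auto intro!: exI[of _ "- v"])
    qed (auto simp: ac_simps, blast+)
    show "Group.comm_monoid (ring_at P1Z U)"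
      by (rule comm_monoidI) (auto simp: ac_simps, blast+)
  qed (auto simp: algebra_simps)
qed

context klattice begin

lemma abelian_group_latt:
  assumes U: "openin Proj_topology U" shows "abelian_group (Sec (latt L sm) U)"
proof -
  have Proj: "P \<in> Proj_ZXY" if "P \<in> U" for P using U open_Proj_subset that by blast
  note [simp] = cs_iff[OF U klattice_axioms]
  note [intro] = L_0 L_add L_sm L_uminus Proj
  show ?thesis
  proof (rule abelian_groupI)
    fix x assume "x \<in> carrier (Sec (latt L sm) U)"
    then obtain v where v: "x = cst v U" "\<forall>P\<in>U. v \<in> L P" by auto
    then show "\<exists>y\<in>carrier (Sec (latt L sm) U). y \<oplus>\<^bsub>Sec (latt L sm) U\<^esub> x = \<zero>\<^bsub>Sec (latt L sm) U\<^esub>"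
      by (intro bexI[of _ "cst (- v) U"]) (auto intro!: exI[of _ "- v"])
  qed (auto simp: ac_simps, blast+)
qed

lemma module_latt:
  assumes U: "openin Proj_topology U" shows "Module.module (ring_at P1Z U) (Sec (latt L sm) U)"
proof -
  interpret vector_space sm by (rule vs)
  have Proj: "P \<in> Proj_ZXY" if "P \<in> U" for P using U open_Proj_subset that by blast
  note [simp] = cs_iff[OF U klattice_axioms] twist_sections_eq_cs in_twist_iff[OF U]
  note [intro] = L_0 L_add L_sm L_uminus Proj
  show ?thesis
  proof (rule moduleI[OF cring_P1Z[OF U] abelian_group_latt[OF U]])
    fix a x assume "a \<in> carrier (ring_at P1Z U)" "x \<in> carrier (Sec (latt L sm) U)"
    then obtain r v where "a = cst r U" "\<forall>P\<in>U. r \<in> loc 0 P" "x = cst v U" "\<forall>P\<in>U. v \<in> L P" by auto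
    then show "a \<odot>\<^bsub>Sec (latt L sm) U\<^esub> x \<in> carrier (Sec (latt L sm) U)"
      by (auto intro!: exI[of _ "sm r v"])
  qed (auto simp: scale_left_distrib scale_right_distrib)
qed

lemma sheaf_latt: "sheaf_of_modules P1Z (latt L sm)"
proof -
  have res: "restrict s V \<in> cs L V" if "openin Proj_topology U" "openin Proj_topology V" "V \<subseteq> U" "s \<in> cs L U"
    for s U V
    using that cs_iff[OF _ klattice_axioms] by (metis restrict_cst subsetD)
  have pre: "presheaf_of_modules P1Z (latt L sm)"
    unfolding presheaf_of_modules_def
  proof (intro conjI allI impI ballI)
    fix U assume U: "is_open P1Z U"
    then show "Module.module (ring_at P1Z U) (Sec (latt L sm) U)" by (simp add: module_latt)
    fix s assume "s \<in> carrier (Sec (latt L sm) U)"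
    then show "Res (latt L sm) U U s = s" by (auto simp: cs_def extensional_restrict)
  next
    fix U V assume UV: "is_open P1Z U" "is_open P1Z V" "V \<subseteq> U"
    show "Res (latt L sm) U V \<in> hom (add_monoid (Sec (latt L sm) U)) (add_monoid (Sec (latt L sm) V))"
      using res UV by (intro homI) (auto simp: fun_eq_iff restrict_def)
    fix r s show "Res (latt L sm) U V (r \<odot>\<^bsub>Sec (latt L sm) U\<^esub> s) =
        Res (Str P1Z) U V r \<odot>\<^bsub>Sec (latt L sm) V\<^esub> Res (latt L sm) U V s"
      using UV by (auto simp: fun_eq_iff restrict_def)
  next
    fix U V W s assume "is_open P1Z U" "is_open P1Z V" "is_open P1Z W" "W \<subseteq> V" "V \<subseteq> U"
    then show "Res (latt L sm) V W (Res (latt L sm) U V s) = Res (latt L sm) U W s"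
      by (auto simp: fun_eq_iff restrict_def)
  qed
  show ?thesis
    unfolding sheaf_of_modules_def
  proof (intro conjI allI impI ballI pre)
    fix \<U> s t assume "\<forall>U\<in>\<U>. is_open P1Z U" "s \<in> carrier (Sec (latt L sm) (\<Union>\<U>))"
      "t \<in> carrier (Sec (latt L sm) (\<Union>\<U>))" and eq: "\<forall>U\<in>\<U>. Res (latt L sm) (\<Union>\<U>) U s = Res (latt L sm) (\<Union>\<U>) U t"
    then have "s \<in> extensional (\<Union>\<U>)" "t \<in> extensional (\<Union>\<U>)" by (auto simp: cs_def)
    moreover have "s P = t P" if "P \<in> \<Union>\<U>" for P
      using that eq by (auto dest!: bspec fun_cong[of _ _ P])
    ultimately show "s = t" by (rule extensionalityI)
  next
    fix \<U> \<sigma> assume op: "\<forall>U\<in>\<U>. is_open P1Z U" and \<sigma>: "\<forall>U\<in>\<U>. \<sigma> U \<in> carrier (Sec (latt L sm) U)"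
      and comp: "\<forall>U\<in>\<U>. \<forall>V\<in>\<U>. Res (latt L sm) U (U \<inter> V) (\<sigma> U) = Res (latt L sm) V (U \<inter> V) (\<sigma> V)"
    \<comment> \<open>The value at \<open>P\<close> is taken from an arbitrary member of the cover
      through \<open>P\<close>; compatibility on overlaps makes the choice immaterial.\<close>
    define s where "s = (\<lambda>P\<in>\<Union>\<U>. \<sigma> (SOME U. U \<in> \<U> \<and> P \<in> U) P)"
    have s: "s P = \<sigma> U P" if "U \<in> \<U>" "P \<in> U" for U P
    proof -
      define W where "W = (SOME U. U \<in> \<U> \<and> P \<in> U)"
      have W: "W \<in> \<U>" "P \<in> W" unfolding W_def using someI[of "\<lambda>U. U \<in> \<U> \<and> P \<in> U"] that by auto
      have "restrict (\<sigma> W) (W \<inter> U) P = restrict (\<sigma> U) (W \<inter> U) P" using comp W that by simp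
      then have "\<sigma> W P = \<sigma> U P" using W that by simp
      moreover have "s P = \<sigma> W P" using that by (auto simp: s_def W_def)
      ultimately show ?thesis by simp
    qed
    have "s \<in> cs L (\<Union>\<U>)"
      unfolding cs_def
    proof (intro CollectI conjI ballI)
      show "s \<in> extensional (\<Union>\<U>)" by (simp add: s_def)
      fix P assume "P \<in> \<Union>\<U>"
      then obtain U where U: "U \<in> \<U>" "P \<in> U" by blast
      have "\<sigma> U \<in> cs L U" using \<sigma> U(1) by simp
      then obtain V v where "openin Proj_topology V" "P \<in> V" "V \<subseteq> U" "\<forall>Q\<in>V. \<sigma> U Q = v \<and> v \<in> L Q"
        using U(2) unfolding cs_def by blast
      then show "\<exists>V v. openin Proj_topology V \<and> P \<in> V \<and> V \<subseteq> \<Union>\<U> \<and> (\<forall>Q\<in>V. s Q = v \<and> v \<in> L Q)"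
        using s[OF U(1)] U by (intro exI[of _ V] exI[of _ v]) auto
    qed
    moreover have "restrict s U = \<sigma> U" if "U \<in> \<U>" for U
      using \<sigma> that s[OF that] by (auto simp: cs_def fun_eq_iff restrict_def extensional_def)
    ultimately show "\<exists>s\<in>carrier (Sec (latt L sm) (\<Union>\<U>)). \<forall>U\<in>\<U>. Res (latt L sm) (\<Union>\<U>) U s = \<sigma> U"
      by auto
  qed
qed

end

section \<open>Exact sequences of lattice sheaves\<close>

definition kmap :: "('v \<Rightarrow> 'w) \<Rightarrow> zxy set set \<Rightarrow> (zxy set \<Rightarrow> 'v) \<Rightarrow> zxy set \<Rightarrow> 'w" where
  "kmap f U s = (\<lambda>P\<in>U. f (s P))"

lemma kmap_cst [simp]: "kmap f U (cst v U) = cst (f v) U"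
  by (simp add: kmap_def)

lemma kmap_morphism:
  assumes L: "klattice L sm" and M: "klattice M sm'"
    and add: "\<And>v w. f (v + w) = f v + f w" and scale: "\<And>r v. f (sm r v) = sm' r (f v)"
    and maps: "\<And>P v. P \<in> Proj_ZXY \<Longrightarrow> v \<in> L P \<Longrightarrow> f v \<in> M P"
  shows "mod_morphism P1Z (latt L sm) (latt M sm') (kmap f)"
  unfolding mod_morphism_def
proof (intro conjI allI impI ballI)
  fix U assume U: "is_open P1Z U"
  then have U': "openin Proj_topology U" by simp
  have Proj: "P \<in> Proj_ZXY" if "P \<in> U" for P using U' open_Proj_subset that by blast
  show "kmap f U \<in> hom (add_monoid (Sec (latt L sm) U)) (add_monoid (Sec (latt M sm') U))"
    by (rule homI) (use Proj maps in \<open>auto simp: cs_iff[OF U' L] cs_iff[OF U' M] add\<close>)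
  fix r s assume "r \<in> carrier (ring_at P1Z U)" "s \<in> carrier (Sec (latt L sm) U)"
  then show "kmap f U (r \<odot>\<^bsub>Sec (latt L sm) U\<^esub> s) = r \<odot>\<^bsub>Sec (latt M sm') U\<^esub> kmap f U s"
    by (auto simp: kmap_def scale fun_eq_iff)
next
  fix U V s assume "is_open P1Z U" "is_open P1Z V" "V \<subseteq> U" "s \<in> carrier (Sec (latt L sm) U)"
  then show "Res (latt M sm') U V (kmap f U s) = kmap f V (Res (latt L sm) U V s)"
    by (auto simp: kmap_def fun_eq_iff restrict_def)
qed

text \<open>Sections being constants, exactness of the sheaf sequence follows from exactness at each
  stalk, all computed with one pair of linear maps \<open>f\<close>, \<open>g\<close> on the generic
  fibres.\<close>

lemma kmap_short_exact:
  assumes L: "klattice L sm" and M: "klattice M sm'" and N: "klattice N sm''"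
    and f: "\<And>v w. f (v + w) = f v + f w" "\<And>r v. f (sm r v) = sm' r (f v)"
    and g: "\<And>v w. g (v + w) = g v + g w" "\<And>r v. g (sm' r v) = sm'' r (g v)"
    and inj: "\<And>v. f v = 0 \<longleftrightarrow> v = 0" 
    and mid: "\<And>P v. P \<in> Proj_ZXY \<Longrightarrow> v \<in> L P \<Longrightarrow> f v \<in> M P \<and> g (f v) = 0"
      "\<And>P v. P \<in> Proj_ZXY \<Longrightarrow> v \<in> M P \<Longrightarrow> g v = 0 \<Longrightarrow> v \<in> f ` L P"
    and surj: "\<And>P. P \<in> Proj_ZXY \<Longrightarrow> g ` M P = N P"
  shows "short_exact_seq P1Z (latt L sm) (latt M sm') (latt N sm'') (kmap f) (kmap g)"
proof -
  have inj': "v = w" if "f v = f w" for v w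
  proof -
    have "f (v - w) + f w = f w" using f(1)[of "v - w" w] that by simp
    then have "f (v - w) = 0" by simp
    then show ?thesis using inj by simp
  qed
  \<comment> \<open>A preimage of \<open>v\<close> at one point stays in the stalks near by, so
    being locally an image means being an image at each point.\<close>
  have loc_im: "t \<in> image_sheaf P1Z (latt L1 sm1) (latt L2 sm2) (kmap h) U \<longleftrightarrow>
      (\<exists>v. t = cst v U \<and> (\<forall>P\<in>U. v \<in> L2 P \<and> v \<in> h ` L1 P))"
    if U: "openin Proj_topology U" and L1: "klattice L1 sm1" and L2: "klattice L2 sm2"
    for U t and L1 :: "zxy set \<Rightarrow> 'x::ab_group_add set" and sm1 and L2 :: "zxy set \<Rightarrow> 'y::ab_group_add set" and sm2 h
  proof
    assume "t \<in> image_sheaf P1Z (latt L1 sm1) (latt L2 sm2) (kmap h) U"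
    then have t: "t \<in> cs L2 U" "\<And>P. P \<in> U \<Longrightarrow> \<exists>V. openin Proj_topology V \<and> P \<in> V \<and> V \<subseteq> U \<and>
        restrict t V \<in> kmap h V ` cs L1 V" by (auto simp: image_sheaf_def)
    obtain v where v: "t = cst v U" "\<And>P. P \<in> U \<Longrightarrow> v \<in> L2 P" using csE[OF U t(1)] by metis
    have "v \<in> h ` L1 P" if P: "P \<in> U" for P
    proof -
      obtain V s where V: "openin Proj_topology V" "P \<in> V" "V \<subseteq> U" "s \<in> cs L1 V" "restrict t V = kmap h V s"
        using t(2)[OF P] by blast
      obtain x where x: "s = cst x V" "\<And>P. P \<in> V \<Longrightarrow> x \<in> L1 P" using csE[OF V(1,4)] by metis
      have "cst v V = cst (h x) V" using V x v by simp
      then have "v = h x" using V(2) by (metis cst_apply)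
      then show ?thesis using x V(2) by blast
    qed
    then show "\<exists>v. t = cst v U \<and> (\<forall>P\<in>U. v \<in> L2 P \<and> v \<in> h ` L1 P)" using v by blast
  next
    assume "\<exists>v. t = cst v U \<and> (\<forall>P\<in>U. v \<in> L2 P \<and> v \<in> h ` L1 P)"
    then obtain v where v: "t = cst v U" "\<And>P. P \<in> U \<Longrightarrow> v \<in> L2 P" "\<And>P. P \<in> U \<Longrightarrow> v \<in> h ` L1 P" by blast
    have "\<exists>V. openin Proj_topology V \<and> P \<in> V \<and> V \<subseteq> U \<and> restrict t V \<in> kmap h V ` cs L1 V" if P: "P \<in> U" for P
    proof -
      have PP: "P \<in> Proj_ZXY" using P U open_Proj_subset by blast
      obtain x where x: "v = h x" "x \<in> L1 P" using v(3)[OF P] by blast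
      obtain V where V: "openin Proj_topology V" "P \<in> V" "\<forall>Q\<in>V. x \<in> L1 Q"
        using klattice.L_open[OF L1 PP x(2)] by blast
      have W: "openin Proj_topology (U \<inter> V)" using U V by blast
      have "cst x (U \<inter> V) \<in> cs L1 (U \<inter> V)" by (rule klattice.cs_cst[OF L1 W]) (use V in auto)
      moreover have "restrict t (U \<inter> V) = kmap h (U \<inter> V) (cst x (U \<inter> V))" using v x by simp
      ultimately have "restrict t (U \<inter> V) \<in> kmap h (U \<inter> V) ` cs L1 (U \<inter> V)" by (metis image_eqI)
      then show ?thesis using W V P by blast
    qed
    then show "t \<in> image_sheaf P1Z (latt L1 sm1) (latt L2 sm2) (kmap h) U"
      unfolding image_sheaf_def using klattice.cs_cst[OF L2 U v(2)] v(1) by simp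
  qed
  have ker: "t \<in> kernel_sheaf (latt L1 sm1) (latt L2 sm2) (kmap h) U \<longleftrightarrow>
      (\<exists>v. t = cst v U \<and> (\<forall>P\<in>U. v \<in> L1 P \<and> h v = 0))"
    if U: "openin Proj_topology U" and L1: "klattice L1 sm1"
    for U t and L1 :: "zxy set \<Rightarrow> 'x::ab_group_add set" and sm1 and L2 :: "zxy set \<Rightarrow> 'y::ab_group_add set" and sm2 h
    unfolding kernel_sheaf_def a_kernel_def'
    by (auto simp: cs_iff[OF U L1]) (metis cst_apply, metis cst_def restrict_ext)
  show ?thesis
    unfolding short_exact_seq_def right_exact_seq_def
  proof (intro conjI allI impI)
    show "mod_morphism P1Z (latt L sm) (latt M sm') (kmap f)"
      using f mid(1) by (intro kmap_morphism[OF L M]) auto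
    show "mod_morphism P1Z (latt M sm') (latt N sm'') (kmap g)"
    proof (rule kmap_morphism[where f = g, OF M N g(1) g(2)])
      fix P v assume "P \<in> Proj_ZXY" "v \<in> M P"
      then show "g v \<in> N P" using imageI[of v "M P" g] surj[of P] by simp
    qed
  next
    fix U assume "is_open P1Z U"
    then have U: "openin Proj_topology U" by simp
    have Proj: "P \<in> Proj_ZXY" if "P \<in> U" for P using U open_Proj_subset that by blast
    have A: "(\<forall>P\<in>U. v \<in> M P \<and> v \<in> f ` L P) \<longleftrightarrow> (\<forall>P\<in>U. v \<in> M P \<and> g v = 0)" for v
      using mid Proj by blast
    show "image_sheaf P1Z (latt L sm) (latt M sm') (kmap f) U = kernel_sheaf (latt M sm') (latt N sm'') (kmap g) U"
      unfolding set_eq_iff loc_im[OF U L M] ker[OF U M] A by simp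
    have B: "(\<forall>P\<in>U. v \<in> N P \<and> v \<in> g ` M P) \<longleftrightarrow> (\<forall>P\<in>U. v \<in> N P)" for v
      using surj Proj by blast
    show "image_sheaf P1Z (latt M sm') (latt N sm'') (kmap g) U = carrier (Sec (latt N sm'') U)"
      unfolding set_eq_iff loc_im[OF U M N] latt_simps(1) cs_iff[OF U N] B by simp
    \<comment> \<open>The empty open set is treated apart: there every constant gives the same
      section, which is zero.\<close>
    have C: "(\<forall>P\<in>U. v \<in> L P \<and> f v = 0) \<longleftrightarrow> U = {} \<or> v = 0" for v
      using inj klattice.L_0[OF L Proj] by blast
    show "kernel_sheaf (latt L sm) (latt M sm') (kmap f) U = {\<zero>\<^bsub>Sec (latt L sm) U\<^esub>}"
      unfolding set_eq_iff ker[OF U L] C latt_simps(2) using cst_empty by fastforce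
  qed
qed

section \<open>Transport of exact sequences\<close>

lemma presheaf_group:
  assumes "presheaf_of_modules X F" "is_open X U"
  shows "abelian_group (Sec F U)" "cring (ring_at X U)"
proof -
  interpret Module.module "ring_at X U" "Sec F U"
    using assms by (simp add: presheaf_of_modules_def)
  show "abelian_group (Sec F U)" "cring (ring_at X U)" by unfold_locales
qed

lemma presheaf_Res:
  assumes "presheaf_of_modules X F" "is_open X U" "is_open X V" "V \<subseteq> U"
  shows "s \<in> carrier (Sec F U) \<Longrightarrow> Res F U V s \<in> carrier (Sec F V)"
    "s \<in> carrier (Sec F U) \<Longrightarrow> t \<in> carrier (Sec F U) \<Longrightarrow>
      Res F U V (s \<oplus>\<^bsub>Sec F U\<^esub> t) = Res F U V s \<oplus>\<^bsub>Sec F V\<^esub> Res F U V t"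
    "r \<in> carrier (ring_at X U) \<Longrightarrow> s \<in> carrier (Sec F U) \<Longrightarrow>
      Res F U V (r \<odot>\<^bsub>Sec F U\<^esub> s) = Res (Str X) U V r \<odot>\<^bsub>Sec F V\<^esub> Res F U V s"
proof -
  have h: "Res F U V \<in> hom (add_monoid (Sec F U)) (add_monoid (Sec F V))"
    using assms by (simp add: presheaf_of_modules_def)
  show "s \<in> carrier (Sec F U) \<Longrightarrow> Res F U V s \<in> carrier (Sec F V)"
    using hom_in_carrier[OF h] by simp
  show "s \<in> carrier (Sec F U) \<Longrightarrow> t \<in> carrier (Sec F U) \<Longrightarrow>
      Res F U V (s \<oplus>\<^bsub>Sec F U\<^esub> t) = Res F U V s \<oplus>\<^bsub>Sec F V\<^esub> Res F U V t"
    using hom_mult[OF h] by simp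
  show "r \<in> carrier (ring_at X U) \<Longrightarrow> s \<in> carrier (Sec F U) \<Longrightarrow>
      Res F U V (r \<odot>\<^bsub>Sec F U\<^esub> s) = Res (Str X) U V r \<odot>\<^bsub>Sec F V\<^esub> Res F U V s"
    using assms by (simp add: presheaf_of_modules_def)
qed

lemma presheaf_Res_Res:
  assumes "presheaf_of_modules X F" "is_open X U" "s \<in> carrier (Sec F U)"
  shows "Res F U U s = s"
    "is_open X V \<Longrightarrow> is_open X W \<Longrightarrow> W \<subseteq> V \<Longrightarrow> V \<subseteq> U \<Longrightarrow> Res F V W (Res F U V s) = Res F U W s"
  using assms by (simp_all add: presheaf_of_modules_def)

lemma presheaf_smult_closed:
  assumes "presheaf_of_modules X F" "is_open X U" "r \<in> carrier (ring_at X U)" "s \<in> carrier (Sec F U)"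
  shows "r \<odot>\<^bsub>Sec F U\<^esub> s \<in> carrier (Sec F U)"
proof -
  interpret Module.module "ring_at X U" "Sec F U"
    using assms by (simp add: presheaf_of_modules_def)
  show ?thesis using assms by simp
qed

lemma presheaf_add_closed:
  assumes "presheaf_of_modules X F" "is_open X U" "s \<in> carrier (Sec F U)" "t \<in> carrier (Sec F U)"
  shows "s \<oplus>\<^bsub>Sec F U\<^esub> t \<in> carrier (Sec F U)"
  using abelian_group.axioms(1)[OF presheaf_group(1)[OF assms(1,2)]] assms(3,4)
  by (simp add: abelian_monoid.a_closed)

lemma mod_morphismD:
  assumes "mod_morphism X F G \<phi>" "is_open X U"
  shows "s \<in> carrier (Sec F U) \<Longrightarrow> \<phi> U s \<in> carrier (Sec G U)"
    "s \<in> carrier (Sec F U) \<Longrightarrow> t \<in> carrier (Sec F U) \<Longrightarrow>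
      \<phi> U (s \<oplus>\<^bsub>Sec F U\<^esub> t) = \<phi> U s \<oplus>\<^bsub>Sec G U\<^esub> \<phi> U t"
    "r \<in> carrier (ring_at X U) \<Longrightarrow> s \<in> carrier (Sec F U) \<Longrightarrow>
      \<phi> U (r \<odot>\<^bsub>Sec F U\<^esub> s) = r \<odot>\<^bsub>Sec G U\<^esub> \<phi> U s"
    "is_open X V \<Longrightarrow> V \<subseteq> U \<Longrightarrow> s \<in> carrier (Sec F U) \<Longrightarrow> Res G U V (\<phi> U s) = \<phi> V (Res F U V s)"
proof -
  have h: "\<phi> U \<in> hom (add_monoid (Sec F U)) (add_monoid (Sec G U))"
    using assms by (simp add: mod_morphism_def)
  show "s \<in> carrier (Sec F U) \<Longrightarrow> \<phi> U s \<in> carrier (Sec G U)"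
    using hom_in_carrier[OF h] by simp
  show "s \<in> carrier (Sec F U) \<Longrightarrow> t \<in> carrier (Sec F U) \<Longrightarrow>
      \<phi> U (s \<oplus>\<^bsub>Sec F U\<^esub> t) = \<phi> U s \<oplus>\<^bsub>Sec G U\<^esub> \<phi> U t"
    using hom_mult[OF h] by simp
  show "r \<in> carrier (ring_at X U) \<Longrightarrow> s \<in> carrier (Sec F U) \<Longrightarrow>
      \<phi> U (r \<odot>\<^bsub>Sec F U\<^esub> s) = r \<odot>\<^bsub>Sec G U\<^esub> \<phi> U s"
    "is_open X V \<Longrightarrow> V \<subseteq> U \<Longrightarrow> s \<in> carrier (Sec F U) \<Longrightarrow> Res G U V (\<phi> U s) = \<phi> V (Res F U V s)"
    using assms by (simp_all add: mod_morphism_def)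
qed

lemma mod_morphismI:
  assumes "\<And>U s. is_open X U \<Longrightarrow> s \<in> carrier (Sec F U) \<Longrightarrow> \<phi> U s \<in> carrier (Sec G U)"
    "\<And>U s t. is_open X U \<Longrightarrow> s \<in> carrier (Sec F U) \<Longrightarrow> t \<in> carrier (Sec F U) \<Longrightarrow>
      \<phi> U (s \<oplus>\<^bsub>Sec F U\<^esub> t) = \<phi> U s \<oplus>\<^bsub>Sec G U\<^esub> \<phi> U t"
    "\<And>U r s. is_open X U \<Longrightarrow> r \<in> carrier (ring_at X U) \<Longrightarrow> s \<in> carrier (Sec F U) \<Longrightarrow>
      \<phi> U (r \<odot>\<^bsub>Sec F U\<^esub> s) = r \<odot>\<^bsub>Sec G U\<^esub> \<phi> U s"
    "\<And>U V s. is_open X U \<Longrightarrow> is_open X V \<Longrightarrow> V \<subseteq> U \<Longrightarrow> s \<in> carrier (Sec F U) \<Longrightarrow>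
      Res G U V (\<phi> U s) = \<phi> V (Res F U V s)"
  shows "mod_morphism X F G \<phi>"
  unfolding mod_morphism_def using assms by (auto intro!: homI)

lemma mod_morphism_comp:
  assumes \<phi>: "mod_morphism X F G \<phi>" and \<psi>: "mod_morphism X G H \<psi>"
  shows "mod_morphism X F H (\<lambda>U s. \<psi> U (\<phi> U s))"
  by (rule mod_morphismI) (simp_all add: mod_morphismD[OF \<phi>] mod_morphismD[OF \<psi>])

lemma mod_isomorphism_inverse:
  assumes E: "presheaf_of_modules X E" and \<kappa>: "mod_isomorphism X E G \<kappa>"
  shows "mod_morphism X G E (\<lambda>U. inv_into (carrier (Sec E U)) (\<kappa> U))"
proof -
  have mor: "mod_morphism X E G \<kappa>" using \<kappa> by (simp add: mod_isomorphism_def)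
  note D = mod_morphismD[OF mor]
  have bij: "bij_betw (\<kappa> U) (carrier (Sec E U)) (carrier (Sec G U))" if "is_open X U" for U
    using \<kappa> that by (simp add: mod_isomorphism_def)
  have inv: "inv_into (carrier (Sec E U)) (\<kappa> U) (\<kappa> U s) = s" if "is_open X U" "s \<in> carrier (Sec E U)" for U s
    by (rule inv_into_f_f) (use bij[OF that(1)] that(2) in \<open>auto simp: bij_betw_def\<close>)
  have ex: "\<exists>s\<in>carrier (Sec E U). t = \<kappa> U s" if "is_open X U" "t \<in> carrier (Sec G U)" for U t
    using bij[OF that(1)] that(2) by (auto simp: bij_betw_def)
  show ?thesis
  proof (rule mod_morphismI)
    fix U t assume U: "is_open X U" and t: "t \<in> carrier (Sec G U)"
    obtain s where s: "s \<in> carrier (Sec E U)" "t = \<kappa> U s" using ex[OF U t] by blast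
    show "inv_into (carrier (Sec E U)) (\<kappa> U) t \<in> carrier (Sec E U)" using s inv[OF U] by simp
    {
      fix t' assume "t' \<in> carrier (Sec G U)"
      then obtain s' where s': "s' \<in> carrier (Sec E U)" "t' = \<kappa> U s'" using ex[OF U] by blast
      show "inv_into (carrier (Sec E U)) (\<kappa> U) (t \<oplus>\<^bsub>Sec G U\<^esub> t') =
          inv_into (carrier (Sec E U)) (\<kappa> U) t \<oplus>\<^bsub>Sec E U\<^esub> inv_into (carrier (Sec E U)) (\<kappa> U) t'"
        using s s' inv[OF U] D(2)[OF U] presheaf_add_closed[OF E U] by metis
    next
      fix r assume "r \<in> carrier (ring_at X U)"
      then show "inv_into (carrier (Sec E U)) (\<kappa> U) (r \<odot>\<^bsub>Sec G U\<^esub> t) =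
          r \<odot>\<^bsub>Sec E U\<^esub> inv_into (carrier (Sec E U)) (\<kappa> U) t"
        using s inv[OF U] D(3)[OF U] presheaf_smult_closed[OF E U] by metis
    next
      fix V assume V: "is_open X V" "V \<subseteq> U"
      then show "Res E U V (inv_into (carrier (Sec E U)) (\<kappa> U) t) =
          inv_into (carrier (Sec E V)) (\<kappa> V) (Res G U V t)"
        using s inv[OF U] inv[OF V(1)] D(4)[OF U] presheaf_Res(1)[OF E U] by metis
    }
  qed
qed

lemma mod_morphism_zero:
  assumes "presheaf_of_modules X E" "presheaf_of_modules X G" "mod_morphism X E G \<kappa>" "is_open X U"
  shows "\<kappa> U \<zero>\<^bsub>Sec E U\<^esub> = \<zero>\<^bsub>Sec G U\<^esub>"
proof -
  have "\<kappa> U \<in> hom (add_monoid (Sec E U)) (add_monoid (Sec G U))"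
    using assms by (simp add: mod_morphism_def)
  moreover have "group (add_monoid (Sec E U))" "group (add_monoid (Sec G U))"
    using presheaf_group(1) assms abelian_group.a_group by blast+
  ultimately have "\<kappa> U \<one>\<^bsub>add_monoid (Sec E U)\<^esub> = \<one>\<^bsub>add_monoid (Sec G U)\<^esub>" by (rule hom_one)
  then show ?thesis by simp
qed

text \<open>Serves to replace lattice sheaves by the given bundle in the middle and by the tensor
  product sheaf on the right. The two conditions on zero are what the comparison of kernels across
  \<open>\<chi>\<close> takes.\<close>

lemma short_exact_seq_transport:
  assumes ex: "short_exact_seq X F G H \<phi> \<psi>"
    and E: "presheaf_of_modules X E" and G: "presheaf_of_modules X G"
    and \<kappa>: "mod_isomorphism X E G \<kappa>" and \<chi>: "mod_isomorphism X H K \<chi>"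
    and H_zero: "\<And>U. is_open X U \<Longrightarrow> \<zero>\<^bsub>Sec H U\<^esub> \<in> carrier (Sec H U)"
    and \<chi>_zero: "\<And>U. is_open X U \<Longrightarrow> \<chi> U \<zero>\<^bsub>Sec H U\<^esub> = \<zero>\<^bsub>Sec K U\<^esub>"
  shows "short_exact_seq X F E K (\<lambda>U s. inv_into (carrier (Sec E U)) (\<kappa> U) (\<phi> U s))
    (\<lambda>U s. \<chi> U (\<psi> U (\<kappa> U s)))"
proof -
  let ?\<iota> = "\<lambda>U. inv_into (carrier (Sec E U)) (\<kappa> U)"
  have \<phi>: "mod_morphism X F G \<phi>" and \<psi>: "mod_morphism X G H \<psi>"
    and \<kappa>': "mod_morphism X E G \<kappa>" and \<chi>': "mod_morphism X H K \<chi>"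
    and mid: "\<And>U. is_open X U \<Longrightarrow> image_sheaf X F G \<phi> U = kernel_sheaf G H \<psi> U"
    and sur: "\<And>U. is_open X U \<Longrightarrow> image_sheaf X G H \<psi> U = carrier (Sec H U)"
    and inj: "\<And>U. is_open X U \<Longrightarrow> kernel_sheaf F G \<phi> U = {\<zero>\<^bsub>Sec F U\<^esub>}"
    using ex \<kappa> \<chi> by (auto simp: short_exact_seq_def right_exact_seq_def mod_isomorphism_def)
  note \<iota> = mod_isomorphism_inverse[OF E \<kappa>]
  have bij\<kappa>: "bij_betw (\<kappa> U) (carrier (Sec E U)) (carrier (Sec G U))"
    and bij\<chi>: "bij_betw (\<chi> U) (carrier (Sec H U)) (carrier (Sec K U))" if "is_open X U" for U
    using \<kappa> \<chi> that by (auto simp: mod_isomorphism_def)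
  have \<iota>\<kappa>: "?\<iota> U (\<kappa> U s) = s" if "is_open X U" "s \<in> carrier (Sec E U)" for U s
    using bij\<kappa>[OF that(1)] that(2) by (auto simp: bij_betw_def)
  have \<kappa>\<iota>: "\<kappa> U (?\<iota> U s) = s" if "is_open X U" "s \<in> carrier (Sec G U)" for U s
    using bij\<kappa>[OF that(1)] that(2) by (auto simp: bij_betw_def f_inv_into_f)
  have \<kappa>0: "\<kappa> U \<zero>\<^bsub>Sec E U\<^esub> = \<zero>\<^bsub>Sec G U\<^esub>" if "is_open X U" for U
    by (rule mod_morphism_zero[OF E G \<kappa>' that])
  have E0: "\<zero>\<^bsub>Sec E U\<^esub> \<in> carrier (Sec E U)" if "is_open X U" for U
    using presheaf_group(1)[OF E that] by (simp add: abelian_group_def abelian_monoid.zero_closed)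
  show ?thesis
    unfolding short_exact_seq_def right_exact_seq_def
  proof (intro conjI allI impI)
    show "mod_morphism X F E (\<lambda>U s. ?\<iota> U (\<phi> U s))" by (rule mod_morphism_comp[OF \<phi> \<iota>])
    show "mod_morphism X E K (\<lambda>U s. \<chi> U (\<psi> U (\<kappa> U s)))"
      by (rule mod_morphism_comp[OF mod_morphism_comp[OF \<kappa>' \<psi>] \<chi>'])
  next
    fix U assume U: "is_open X U"
    show "image_sheaf X F E (\<lambda>U s. ?\<iota> U (\<phi> U s)) U = kernel_sheaf E K (\<lambda>U s. \<chi> U (\<psi> U (\<kappa> U s))) U"
    proof (rule Set.set_eqI)
      fix t
      show "t \<in> image_sheaf X F E (\<lambda>U s. ?\<iota> U (\<phi> U s)) U \<longleftrightarrow>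
        t \<in> kernel_sheaf E K (\<lambda>U s. \<chi> U (\<psi> U (\<kappa> U s))) U"
      proof (cases "t \<in> carrier (Sec E U)")
        case t: True
        have "Res E U V t \<in> (\<lambda>s. ?\<iota> V (\<phi> V s)) ` carrier (Sec F V) \<longleftrightarrow> Res G U V (\<kappa> U t) \<in> \<phi> V ` carrier (Sec F V)"
          if V: "is_open X V" "V \<subseteq> U" for V
        proof -
          have r: "Res E U V t \<in> carrier (Sec E V)" by (rule presheaf_Res(1)[OF E U V t])
          have "Res E U V t = ?\<iota> V (\<phi> V s) \<longleftrightarrow> \<kappa> V (Res E U V t) = \<phi> V s" if "s \<in> carrier (Sec F V)" for s
            using \<iota>\<kappa>[OF V(1) r] \<kappa>\<iota>[OF V(1) mod_morphismD(1)[OF \<phi> V(1) that]] by metis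
          then show ?thesis using mod_morphismD(4)[OF \<kappa>' U V t] by (auto simp: image_iff)
        qed
        then have "t \<in> image_sheaf X F E (\<lambda>U s. ?\<iota> U (\<phi> U s)) U \<longleftrightarrow> \<kappa> U t \<in> image_sheaf X F G \<phi> U"
          unfolding image_sheaf_def using t mod_morphismD(1)[OF \<kappa>' U t] by (simp cong: conj_cong)
        also have "\<dots> \<longleftrightarrow> \<psi> U (\<kappa> U t) = \<zero>\<^bsub>Sec H U\<^esub>"
          unfolding mid[OF U] kernel_sheaf_def a_kernel_def' using mod_morphismD(1)[OF \<kappa>' U t] by simp
        also have "\<dots> \<longleftrightarrow> \<chi> U (\<psi> U (\<kappa> U t)) = \<zero>\<^bsub>Sec K U\<^esub>"
          using bij\<chi>[OF U] H_zero[OF U] \<chi>_zero[OF U]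
            mod_morphismD(1)[OF \<psi> U mod_morphismD(1)[OF \<kappa>' U t]]
          by (metis bij_betw_def inj_onD)
        finally show ?thesis using t by (simp add: kernel_sheaf_def a_kernel_def')
      qed (simp_all add: image_sheaf_def kernel_sheaf_def a_kernel_def')
    qed
    show "image_sheaf X E K (\<lambda>U s. \<chi> U (\<psi> U (\<kappa> U s))) U = carrier (Sec K U)"
    proof (intro equalityI subsetI)
      fix t assume t: "t \<in> carrier (Sec K U)"
      then obtain h where h: "h \<in> carrier (Sec H U)" "t = \<chi> U h"
        using bij\<chi>[OF U] by (auto simp: bij_betw_def)
      have "\<exists>V. is_open X V \<and> p \<in> V \<and> V \<subseteq> U \<and>
          Res K U V t \<in> (\<lambda>s. \<chi> V (\<psi> V (\<kappa> V s))) ` carrier (Sec E V)" if "p \<in> U" for p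
      proof -
        have "h \<in> image_sheaf X G H \<psi> U" using h sur[OF U] by simp
        then obtain V g where V: "is_open X V" "p \<in> V" "V \<subseteq> U" "g \<in> carrier (Sec G V)" "Res H U V h = \<psi> V g"
          using \<open>p \<in> U\<close> unfolding image_sheaf_def by blast
        obtain e where "e \<in> carrier (Sec E V)" "g = \<kappa> V e"
          using bij\<kappa>[OF V(1)] V(4) by (auto simp: bij_betw_def)
        moreover have "Res K U V t = \<chi> V (Res H U V h)" using mod_morphismD(4)[OF \<chi>' U V(1,3) h(1)] h(2) by simp
        ultimately show ?thesis using V by (intro exI[of _ V]) auto
      qed
      then show "t \<in> image_sheaf X E K (\<lambda>U s. \<chi> U (\<psi> U (\<kappa> U s))) U"
        using t by (simp add: image_sheaf_def)
    qed (simp add: image_sheaf_def)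
    have "?\<iota> U (\<phi> U s) = \<zero>\<^bsub>Sec E U\<^esub> \<longleftrightarrow> \<phi> U s = \<zero>\<^bsub>Sec G U\<^esub>" if "s \<in> carrier (Sec F U)" for s
      using \<kappa>\<iota>[OF U mod_morphismD(1)[OF \<phi> U that]] \<iota>\<kappa>[OF U E0[OF U]] \<kappa>0[OF U] by metis
    then show "kernel_sheaf F E (\<lambda>U s. ?\<iota> U (\<phi> U s)) U = {\<zero>\<^bsub>Sec F U\<^esub>}"
      using inj[OF U] unfolding kernel_sheaf_def a_kernel_def' by blast
  qed
qed

section \<open>Locally free sheaves as lattices\<close>

lemma open_subspace_simps:
  assumes "openin Proj_topology U"
  shows "is_open (open_subspace P1Z U) V \<longleftrightarrow> openin Proj_topology V \<and> V \<subseteq> U"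
    "Str (open_subspace P1Z U) = Str P1Z"
  using assms by (auto simp: open_subspace_def openin_open_subtopology)

definition pair_section :: "kvec \<Rightarrow> zxy set set \<Rightarrow> nat \<Rightarrow> zxy_section" where
  "pair_section v V = (\<lambda>j\<in>{..<2}. cst (if j = 0 then fst v else snd v) V)"

definition regular_pairs :: "zxy set set \<Rightarrow> kvec set" where
  "regular_pairs V = {v. \<forall>P\<in>V. fst v \<in> loc 0 P \<and> snd v \<in> loc 0 P}"

text \<open>For finitely many indices the local finiteness condition in \<open>free_sheaf\<close>
  holds on \<open>V\<close> itself, so sections are plain families.\<close>

lemma free_sheaf_carrier:
  assumes U: "openin Proj_topology U" and J: "finite J" and V: "openin Proj_topology V" "V \<subseteq> U"
  shows "carrier (Sec (free_sheaf (open_subspace P1Z U) J) V) = J \<rightarrow>\<^sub>E twist_sections 0 V"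
proof -
  have "\<forall>p\<in>V. \<exists>W. is_open (open_subspace P1Z U) W \<and> p \<in> W \<and> W \<subseteq> V \<and>
      finite {j \<in> J. Res (Str (open_subspace P1Z U)) V W (c j) \<noteq> \<zero>\<^bsub>ring_at (open_subspace P1Z U) W\<^esub>}" for c
    using J V open_subspace_simps(1)[OF U] by (intro ballI exI[of _ V]) simp
  then show ?thesis
    unfolding free_sheaf_def by (simp add: open_subspace_simps(2)[OF U])
qed

lemma free_sheaf_ops:
  assumes U: "openin Proj_topology U"
  shows "c \<oplus>\<^bsub>Sec (free_sheaf (open_subspace P1Z U) J) V\<^esub> d = (\<lambda>j\<in>J. \<lambda>P\<in>V. c j P + d j P)"
    "r \<odot>\<^bsub>Sec (free_sheaf (open_subspace P1Z U) J) V\<^esub> c = (\<lambda>j\<in>J. \<lambda>P\<in>V. r P * c j P)"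
    "\<zero>\<^bsub>Sec (free_sheaf (open_subspace P1Z U) J) V\<^esub> = (\<lambda>j\<in>J. cst 0 V)"
    "Res (free_sheaf (open_subspace P1Z U) J) V W c = (\<lambda>j\<in>J. restrict (c j) W)"
  by (simp_all add: free_sheaf_def open_subspace_simps[OF U])

lemma pair_section_in_free:
  assumes U: "openin Proj_topology U" and V: "openin Proj_topology V" "V \<subseteq> U"
  shows "carrier (Sec (free_sheaf (open_subspace P1Z U) {..<2}) V) = {pair_section v V | v. v \<in> regular_pairs V}"
proof -
  have "c \<in> {..<2} \<rightarrow>\<^sub>E twist_sections 0 V \<longleftrightarrow> (\<exists>v. c = pair_section v V \<and> v \<in> regular_pairs V)" for c
  proof
    assume c: "c \<in> {..<2} \<rightarrow>\<^sub>E twist_sections 0 V"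
    have "c 0 \<in> cs (loc 0) V" "c 1 \<in> cs (loc 0) V"
      using PiE_mem[OF c, of 0] PiE_mem[OF c, of 1] by (simp_all add: twist_sections_eq_cs)
    then obtain a b where ab: "c 0 = cst a V" "\<forall>P\<in>V. a \<in> loc 0 P" "c 1 = cst b V" "\<forall>P\<in>V. b \<in> loc 0 P"
      using csE[OF V(1)] by metis
    have "c = pair_section (a, b) V"
    proof (rule extensionalityI[of _ "{..<2}"])
      fix j :: nat assume "j \<in> {..<2}"
      then have "j = 0 \<or> j = 1" by auto
      then show "c j = pair_section (a, b) V j" using ab by (auto simp: pair_section_def)
    qed (use c in \<open>auto simp: pair_section_def PiE_def\<close>)
    then show "\<exists>v. c = pair_section v V \<and> v \<in> regular_pairs V" using ab by (auto simp: regular_pairs_def)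
  next
    assume "\<exists>v. c = pair_section v V \<and> v \<in> regular_pairs V"
    then obtain v where v: "c = pair_section v V" "v \<in> regular_pairs V" by blast
    have "cst (fst v) V \<in> twist_sections 0 V" "cst (snd v) V \<in> twist_sections 0 V"
      using v(2) unfolding twist_sections_eq_cs regular_pairs_def
      by (auto intro!: klattice.cs_cst[OF klattice_loc V(1)])
    then show "c \<in> {..<2} \<rightarrow>\<^sub>E twist_sections 0 V"
      unfolding v(1) pair_section_def by auto
  qed
  then show ?thesis
    unfolding free_sheaf_carrier[OF U finite_lessThan V] by (intro Set.set_eqI) (simp only: mem_Collect_eq)
qed

lemma pair_section_eq_iff:
  "V \<noteq> {} \<Longrightarrow> pair_section v V = pair_section w V \<longleftrightarrow> v = w"
proof
  assume V: "V \<noteq> {}" and eq: "pair_section v V = pair_section w V"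
  have "pair_section v V 0 = pair_section w V 0" "pair_section v V 1 = pair_section w V 1" using eq by auto
  then show "v = w" using V by (auto simp: pair_section_def cst_eq_iff prod_eq_iff)
qed simp

lemma (in lattice_family) klattice_lat: "klattice (lat 0) sv"
proof (rule klattice.intro)
  show "vector_space sv" by (rule vector_space_sv)
  fix P v assume P: "P \<in> Proj_ZXY" and v: "v \<in> lat 0 P"
  obtain U where U: "openin Proj_topology U" "P \<in> U" "\<And>Q. Q \<in> U \<Longrightarrow> lat 0 Q = span2 0 Q (u P) (w P)"
    using lat_local[OF P] by metis
  obtain \<alpha> \<beta> where ab: "v = sv \<alpha> (u P) + sv \<beta> (w P)" "\<alpha> \<in> loc 0 P" "\<beta> \<in> loc 0 P"
    using v unfolding lat_def by (rule span2E)
  obtain A where A: "openin Proj_topology A" "P \<in> A" "\<forall>R\<in>A. \<alpha> \<in> loc 0 R" using loc_open[OF P ab(2)] by blast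
  obtain B where B: "openin Proj_topology B" "P \<in> B" "\<forall>R\<in>B. \<beta> \<in> loc 0 R" using loc_open[OF P ab(3)] by blast
  have "v \<in> lat 0 Q" if "Q \<in> U \<inter> A \<inter> B" for Q
    using that A B U(3)[of Q] ab(1) by (auto intro: span2I)
  then show "\<exists>V. openin Proj_topology V \<and> P \<in> V \<and> (\<forall>Q\<in>V. v \<in> lat 0 Q)"
    using U A B by (intro exI[of _ "U \<inter> A \<inter> B"]) auto
qed (use lat_0 lat_add lat_sv[of _ _ 0 _ 0] in auto)

section \<open>The lattice of a locally free sheaf\<close>

text \<open>Local freeness expressed through coordinates: a trivialisation takes pairs of regular
  functions, viewed as elements of the generic fibre, to sections of \<open>E\<close>. Over the
  empty set all pairs may give the same section, hence the restriction in
  \<open>triv_inj\<close>.\<close>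

locale trivialized_sheaf =
  fixes E :: "(zxy set, zxy_section, 'a) mod_presheaf"
    and dom :: "zxy set \<Rightarrow> zxy set set" and triv :: "zxy set \<Rightarrow> zxy set set \<Rightarrow> kvec \<Rightarrow> 'a"
  assumes sheaf: "sheaf_of_modules P1Z E"
    and dom: "P \<in> Proj_ZXY \<Longrightarrow> openin Proj_topology (dom P)" "P \<in> Proj_ZXY \<Longrightarrow> P \<in> dom P"
    and triv_closed: "P \<in> Proj_ZXY \<Longrightarrow> openin Proj_topology V \<Longrightarrow> V \<subseteq> dom P \<Longrightarrow> v \<in> regular_pairs V \<Longrightarrow>
      triv P V v \<in> carrier (Sec E V)"
    and triv_add: "P \<in> Proj_ZXY \<Longrightarrow> openin Proj_topology V \<Longrightarrow> V \<subseteq> dom P \<Longrightarrow> v \<in> regular_pairs V \<Longrightarrow>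
      w \<in> regular_pairs V \<Longrightarrow> triv P V (v + w) = triv P V v \<oplus>\<^bsub>Sec E V\<^esub> triv P V w"
    and triv_sv: "P \<in> Proj_ZXY \<Longrightarrow> openin Proj_topology V \<Longrightarrow> V \<subseteq> dom P \<Longrightarrow> v \<in> regular_pairs V \<Longrightarrow>
      (\<And>Q. Q \<in> V \<Longrightarrow> r \<in> loc 0 Q) \<Longrightarrow> triv P V (sv r v) = cst r V \<odot>\<^bsub>Sec E V\<^esub> triv P V v"
    and triv_Res: "P \<in> Proj_ZXY \<Longrightarrow> openin Proj_topology V \<Longrightarrow> V \<subseteq> dom P \<Longrightarrow> openin Proj_topology W \<Longrightarrow>
      W \<subseteq> V \<Longrightarrow> v \<in> regular_pairs V \<Longrightarrow> Res E V W (triv P V v) = triv P W v"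
    and triv_surj: "P \<in> Proj_ZXY \<Longrightarrow> openin Proj_topology V \<Longrightarrow> V \<subseteq> dom P \<Longrightarrow> s \<in> carrier (Sec E V) \<Longrightarrow>
      \<exists>v\<in>regular_pairs V. s = triv P V v"
    and triv_inj: "P \<in> Proj_ZXY \<Longrightarrow> openin Proj_topology V \<Longrightarrow> V \<subseteq> dom P \<Longrightarrow> V \<noteq> {} \<Longrightarrow> v \<in> regular_pairs V \<Longrightarrow>
      w \<in> regular_pairs V \<Longrightarrow> triv P V v = triv P V w \<Longrightarrow> v = w"
begin

lemma presheaf: "presheaf_of_modules P1Z E"
  using sheaf by (simp add: sheaf_of_modules_def)

lemmas Res_closed = presheaf_Res(1)[OF presheaf, simplified]
lemmas Res_add = presheaf_Res(2)[OF presheaf, simplified]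
lemmas Res_smult = presheaf_Res(3)[OF presheaf, simplified]
lemmas Res_id = presheaf_Res_Res(1)[OF presheaf, simplified]
lemmas Res_Res = presheaf_Res_Res(2)[OF presheaf, simplified]

text \<open>The value of a section in the generic fibre.\<close>

definition val :: "zxy set set \<Rightarrow> 'a \<Rightarrow> kvec" where
  "val V s = (THE v. v \<in> regular_pairs (V \<inter> dom eta) \<and> Res E V (V \<inter> dom eta) s = triv eta (V \<inter> dom eta) v)"

lemma open_dom_eta:
  assumes "openin Proj_topology V" "V \<noteq> {}"
  shows "openin Proj_topology (V \<inter> dom eta)" "eta \<in> V" "eta \<in> V \<inter> dom eta"
  using assms dom[OF eta_in_Proj] eta_in_open by auto

lemma val_unique:
  assumes V: "openin Proj_topology V" "V \<noteq> {}"
    and v: "v \<in> regular_pairs (V \<inter> dom eta)" "Res E V (V \<inter> dom eta) s = triv eta (V \<inter> dom eta) v"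
  shows "val V s = v"
  unfolding val_def
proof (rule the_equality)
  show "v \<in> regular_pairs (V \<inter> dom eta) \<and> Res E V (V \<inter> dom eta) s = triv eta (V \<inter> dom eta) v"
    using v by simp
  fix w assume w: "w \<in> regular_pairs (V \<inter> dom eta) \<and> Res E V (V \<inter> dom eta) s = triv eta (V \<inter> dom eta) w"
  have ne: "V \<inter> dom eta \<noteq> {}" using open_dom_eta(3)[OF V] by blast
  show "w = v"
  proof (rule triv_inj[OF eta_in_Proj open_dom_eta(1)[OF V] Int_lower2 ne])
    show "triv eta (V \<inter> dom eta) w = triv eta (V \<inter> dom eta) v" using w v(2) by (metis)
  qed (use w v(1) in blast)+
qed

lemma val:
  assumes V: "openin Proj_topology V" "V \<noteq> {}" and s: "s \<in> carrier (Sec E V)"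
  shows "val V s \<in> regular_pairs (V \<inter> dom eta)"
    "Res E V (V \<inter> dom eta) s = triv eta (V \<inter> dom eta) (val V s)"
proof -
  have "Res E V (V \<inter> dom eta) s \<in> carrier (Sec E (V \<inter> dom eta))"
    using open_dom_eta(1)[OF V] V s by (intro Res_closed) auto
  then obtain v where v: "v \<in> regular_pairs (V \<inter> dom eta)" "Res E V (V \<inter> dom eta) s = triv eta (V \<inter> dom eta) v"
    using triv_surj[OF eta_in_Proj open_dom_eta(1)[OF V] Int_lower2] by blast
  then show "val V s \<in> regular_pairs (V \<inter> dom eta)"
    "Res E V (V \<inter> dom eta) s = triv eta (V \<inter> dom eta) (val V s)"
    using val_unique[OF V v] by auto
qed

lemma regular_pairs_mono: "W \<subseteq> V \<Longrightarrow> regular_pairs V \<subseteq> regular_pairs W"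
  by (auto simp: regular_pairs_def)

lemma regular_pairs_add:
  assumes "openin Proj_topology V" "v \<in> regular_pairs V" "w \<in> regular_pairs V"
  shows "v + w \<in> regular_pairs V"
  using assms open_Proj_subset[OF assms(1)] by (auto simp: regular_pairs_def intro!: loc_add)

lemma regular_pairs_sv:
  assumes "openin Proj_topology V" "v \<in> regular_pairs V" "\<And>Q. Q \<in> V \<Longrightarrow> r \<in> loc 0 Q"
  shows "sv r v \<in> regular_pairs V"
  using assms open_Proj_subset[OF assms(1)] by (auto simp: regular_pairs_def intro!: loc_mult0)

text \<open>Both values can be compared on \<open>W \<inter> dom eta\<close>, which is nonempty
  because it contains the generic point.\<close>

lemma val_Res:
  assumes V: "openin Proj_topology V" and W: "openin Proj_topology W" "W \<noteq> {}" "W \<subseteq> V"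
    and s: "s \<in> carrier (Sec E V)"
  shows "val W (Res E V W s) = val V s"
proof (rule val_unique[OF W(1,2)])
  have V0: "V \<noteq> {}" using W by auto
  note v = val[OF V V0 s]
  have o: "openin Proj_topology (W \<inter> dom eta)" "openin Proj_topology (V \<inter> dom eta)"
    using open_dom_eta W V V0 by auto
  show "val V s \<in> regular_pairs (W \<inter> dom eta)"
    using v(1) regular_pairs_mono[of "W \<inter> dom eta" "V \<inter> dom eta"] W(3) by auto
  have "Res E W (W \<inter> dom eta) (Res E V W s) = Res E V (W \<inter> dom eta) s"
    using V W o s by (intro Res_Res) auto
  also have "\<dots> = Res E (V \<inter> dom eta) (W \<inter> dom eta) (Res E V (V \<inter> dom eta) s)"
    using V W o s by (intro Res_Res[symmetric]) auto
  also have "\<dots> = triv eta (W \<inter> dom eta) (val V s)"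
    unfolding v(2) using W(3) o v(1) by (intro triv_Res eta_in_Proj) auto
  finally show "Res E W (W \<inter> dom eta) (Res E V W s) = triv eta (W \<inter> dom eta) (val V s)" .
qed

lemma val_add:
  assumes V: "openin Proj_topology V" "V \<noteq> {}" and s: "s \<in> carrier (Sec E V)" and t: "t \<in> carrier (Sec E V)"
  shows "val V (s \<oplus>\<^bsub>Sec E V\<^esub> t) = val V s + val V t"
proof (rule val_unique[OF V])
  note o = open_dom_eta(1)[OF V]
  show "val V s + val V t \<in> regular_pairs (V \<inter> dom eta)"
    by (rule regular_pairs_add[OF o val(1)[OF V s] val(1)[OF V t]])
  show "Res E V (V \<inter> dom eta) (s \<oplus>\<^bsub>Sec E V\<^esub> t) = triv eta (V \<inter> dom eta) (val V s + val V t)"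
    using V(1) o s t Res_add[of V "V \<inter> dom eta" s t]
      triv_add[OF eta_in_Proj o _ val(1)[OF V s] val(1)[OF V t]] val(2)[OF V s] val(2)[OF V t] by auto
qed

lemma val_smult:
  assumes V: "openin Proj_topology V" "V \<noteq> {}" and s: "s \<in> carrier (Sec E V)"
    and r: "\<And>Q. Q \<in> V \<Longrightarrow> r \<in> loc 0 Q"
  shows "val V (cst r V \<odot>\<^bsub>Sec E V\<^esub> s) = sv r (val V s)"
proof (rule val_unique[OF V])
  note o = open_dom_eta(1)[OF V]
  have r': "\<And>Q. Q \<in> V \<inter> dom eta \<Longrightarrow> r \<in> loc 0 Q" using r by auto
  show "sv r (val V s) \<in> regular_pairs (V \<inter> dom eta)"
    by (rule regular_pairs_sv[OF o val(1)[OF V s] r'])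
  have "cst r V \<in> twist_sections 0 V" using r by (auto simp: twist_sections_eq_cs in_twist_iff[OF V(1)])
  then show "Res E V (V \<inter> dom eta) (cst r V \<odot>\<^bsub>Sec E V\<^esub> s) = triv eta (V \<inter> dom eta) (sv r (val V s))"
    using V(1) o s Res_smult[of V "V \<inter> dom eta" "cst r V" s]
      triv_sv[OF eta_in_Proj o _ val(1)[OF V s] r'] val(2)[OF V s] by auto
qed

text \<open>\<open>bu P\<close> and \<open>bw P\<close> are the columns of the transition matrix
  from the trivialisation at \<open>P\<close> to the one at \<open>eta\<close>.\<close>

definition bu :: "zxy set \<Rightarrow> kvec" where "bu P = val (dom P) (triv P (dom P) (1, 0))"
definition bw :: "zxy set \<Rightarrow> kvec" where "bw P = val (dom P) (triv P (dom P) (0, 1))"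

lemma unit_regular: "openin Proj_topology V \<Longrightarrow> (1, 0) \<in> regular_pairs V" "openin Proj_topology V \<Longrightarrow> (0, 1) \<in> regular_pairs V"
  using loc_0 loc_1 open_Proj_subset unfolding regular_pairs_def by fastforce+

lemma dom_nonempty: "P \<in> Proj_ZXY \<Longrightarrow> dom P \<noteq> {}"
  using dom(2) by blast

lemma val_triv:
  assumes P: "P \<in> Proj_ZXY" and V: "openin Proj_topology V" "V \<subseteq> dom P" "V \<noteq> {}" and v: "v \<in> regular_pairs V"
  shows "val V (triv P V v) = sv (fst v) (bu P) + sv (snd v) (bw P)"
proof -
  note u = unit_regular[OF V(1)] and c = triv_closed[OF P V(1,2)]
  have r: "fst v \<in> loc 0 Q" "snd v \<in> loc 0 Q" if "Q \<in> V" for Q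
    using v that by (auto simp: regular_pairs_def)
  have e: "val V (triv P V (1, 0)) = bu P" "val V (triv P V (0, 1)) = bw P"
  proof -
    have "triv P V x = Res E (dom P) V (triv P (dom P) x)" if "x \<in> regular_pairs (dom P)" for x
      using triv_Res[OF P dom(1)[OF P] _ V(1,2) that] by simp
    moreover have "val V (Res E (dom P) V (triv P (dom P) x)) = val (dom P) (triv P (dom P) x)"
      if "x \<in> regular_pairs (dom P)" for x
      using triv_closed[OF P dom(1)[OF P] _ that] by (intro val_Res[OF dom(1)[OF P] V(1,3,2)]) auto
    ultimately show "val V (triv P V (1, 0)) = bu P" "val V (triv P V (0, 1)) = bw P"
      using unit_regular[OF dom(1)[OF P]] by (simp_all add: bu_def bw_def)
  qed
  have "v = sv (fst v) (1, 0) + sv (snd v) (0, 1)" by (simp add: prod_eq_iff)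
  then have "val V (triv P V v) = val V (triv P V (sv (fst v) (1, 0) + sv (snd v) (0, 1)))" by simp
  also have "\<dots> = val V (triv P V (sv (fst v) (1, 0)) \<oplus>\<^bsub>Sec E V\<^esub> triv P V (sv (snd v) (0, 1)))"
    using regular_pairs_sv[OF V(1) u(1) r(1)] regular_pairs_sv[OF V(1) u(2) r(2)]
    by (simp add: triv_add[OF P V(1,2)])
  also have "\<dots> = val V (triv P V (sv (fst v) (1, 0))) + val V (triv P V (sv (snd v) (0, 1)))"
    using regular_pairs_sv[OF V(1) u(1) r(1)] regular_pairs_sv[OF V(1) u(2) r(2)] c
    by (intro val_add V) auto
  also have "\<dots> = sv (fst v) (bu P) + sv (snd v) (bw P)"
    using triv_sv[OF P V(1,2) u(1) r(1)] triv_sv[OF P V(1,2) u(2) r(2)]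
      val_smult[OF V(1,3) c[OF u(1)] r(1)] val_smult[OF V(1,3) c[OF u(2)] r(2)] e by simp
  finally show ?thesis .
qed

text \<open>The stalk at \<open>Q\<close> as a subset of the generic fibre, with no reference to a
  trivialisation at \<open>Q\<close>. Computing it with any trivialisation defined near
  \<open>Q\<close> shows that all of them span the same lattice.\<close>

definition germs :: "zxy set \<Rightarrow> kvec set" where
  "germs Q = {val V s | V s. openin Proj_topology V \<and> Q \<in> V \<and> s \<in> carrier (Sec E V)}"

lemma germs_eq_span:
  assumes P: "P \<in> Proj_ZXY" and Q: "Q \<in> dom P"
  shows "germs Q = span2 0 Q (bu P) (bw P)"
proof (intro equalityI subsetI)
  fix x assume "x \<in> germs Q"
  then obtain V s where V: "openin Proj_topology V" "Q \<in> V" and s: "s \<in> carrier (Sec E V)" and x: "x = val V s"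
    by (auto simp: germs_def)
  define W where "W = V \<inter> dom P"
  have W: "openin Proj_topology W" "W \<noteq> {}" "W \<subseteq> V" "W \<subseteq> dom P" "Q \<in> W"
    using V Q dom(1)[OF P] by (auto simp: W_def)
  have "Res E V W s \<in> carrier (Sec E W)" by (rule Res_closed[OF V(1) W(1,3) s])
  then obtain v where v: "v \<in> regular_pairs W" "Res E V W s = triv P W v"
    using triv_surj[OF P W(1,4)] by blast
  have "x = sv (fst v) (bu P) + sv (snd v) (bw P)"
    using val_Res[OF V(1) W(1-3) s] val_triv[OF P W(1,4,2) v(1)] v(2) x by simp
  then show "x \<in> span2 0 Q (bu P) (bw P)"
    using v(1) W(5) by (auto simp: regular_pairs_def intro!: span2I)
next
  fix x assume "x \<in> span2 0 Q (bu P) (bw P)"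
  then obtain \<alpha> \<beta> where x: "x = sv \<alpha> (bu P) + sv \<beta> (bw P)" "\<alpha> \<in> loc 0 Q" "\<beta> \<in> loc 0 Q" by (rule span2E)
  have QP: "Q \<in> Proj_ZXY" using Q dom(1)[OF P] open_Proj_subset by blast
  obtain A where A: "openin Proj_topology A" "Q \<in> A" "\<forall>R\<in>A. \<alpha> \<in> loc 0 R" using loc_open[OF QP x(2)] by blast
  obtain B where B: "openin Proj_topology B" "Q \<in> B" "\<forall>R\<in>B. \<beta> \<in> loc 0 R" using loc_open[OF QP x(3)] by blast
  define V where "V = A \<inter> B \<inter> dom P"
  have V: "openin Proj_topology V" "V \<subseteq> dom P" "Q \<in> V" using A B Q dom(1)[OF P] by (auto simp: V_def)
  have v: "(\<alpha>, \<beta>) \<in> regular_pairs V" using A B by (auto simp: regular_pairs_def V_def)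
  have "V \<noteq> {}" using V(3) by blast
  then have "x = val V (triv P V (\<alpha>, \<beta>))" using val_triv[OF P V(1,2) _ v] x by simp
  then show "x \<in> germs Q" using triv_closed[OF P V(1,2) v] V by (auto simp: germs_def)
qed

lemma basis_eta: "bu eta = (1, 0)" "bw eta = (0, 1)"
proof -
  note o = dom[OF eta_in_Proj]
  have "val (dom eta) (triv eta (dom eta) x) = x" if x: "x \<in> regular_pairs (dom eta)" for x
    using Res_id[OF o(1) triv_closed[OF eta_in_Proj o(1) _ x]] x o by (intro val_unique) auto
  then show "bu eta = (1, 0)" "bw eta = (0, 1)"
    using unit_regular[OF o(1)] by (simp_all add: bu_def bw_def)
qed

text \<open>At the generic point the trivialisations at \<open>P\<close> and at \<open>eta\<close>
  span the same space, so the standard basis is expressed through \<open>bu P\<close> and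
  \<open>bw P\<close>, and its wedge product 1 would vanish with theirs.\<close>

lemma basis_nondegenerate:
  assumes P: "P \<in> Proj_ZXY" shows "wd (bu P) (bw P) \<noteq> 0"
proof
  assume 0: "wd (bu P) (bw P) = 0"
  have "germs eta = span2 0 eta (bu P) (bw P)"
    using eta_in_open[OF dom[OF P]] by (intro germs_eq_span P)
  moreover have "germs eta = span2 0 eta (1, 0) (0, 1)"
    using germs_eq_span[OF eta_in_Proj dom(2)[OF eta_in_Proj]] basis_eta by simp
  ultimately have "(1, 0) \<in> span2 0 eta (bu P) (bw P)" "(0, 1) \<in> span2 0 eta (bu P) (bw P)"
    using span2_basis[OF eta_in_Proj] by blast+
  then obtain \<alpha> \<beta> \<alpha>' \<beta>' where ab: "(1, 0) = sv \<alpha> (bu P) + sv \<beta> (bw P)" "(0, 1) = sv \<alpha>' (bu P) + sv \<beta>' (bw P)"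
    by (elim span2E) blast
  have "1 = wd (1, 0) (0, 1)" by (simp add: wd_def)
  also have "\<dots> = 0"
    unfolding ab using 0 by (simp add: wd_simps wd_commute[of "bw P" "bu P"])
  finally show False by simp
qed

sublocale lattice_family bu bw
proof
  show "bu eta = (1, 0)" "bw eta = (0, 1)" by (fact basis_eta)+
  fix P assume P: "P \<in> Proj_ZXY"
  show "wd (bu P) (bw P) \<noteq> 0" by (rule basis_nondegenerate[OF P])
  have mem: "v \<in> loc 0 eta \<times> loc 0 eta" if "v \<in> regular_pairs (dom P \<inter> dom eta)" for v
    using that open_dom_eta(3)[OF dom(1)[OF P] dom_nonempty[OF P]] by (auto simp: regular_pairs_def mem_Times_iff)
  show "bu P \<in> loc 0 eta \<times> loc 0 eta" "bw P \<in> loc 0 eta \<times> loc 0 eta"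
    unfolding bu_def bw_def using triv_closed[OF P dom(1)[OF P]] unit_regular[OF dom(1)[OF P]]
    by (auto intro!: mem val(1) dom P dom_nonempty)
  show "\<exists>U. openin Proj_topology U \<and> P \<in> U \<and> (\<forall>Q\<in>U. span2 0 Q (bu Q) (bw Q) = span2 0 Q (bu P) (bw P))"
  proof (intro exI[of _ "dom P"] conjI ballI dom P)
    fix Q assume Q: "Q \<in> dom P"
    then have "Q \<in> Proj_ZXY" using dom(1)[OF P] open_Proj_subset by blast
    then show "span2 0 Q (bu Q) (bw Q) = span2 0 Q (bu P) (bw P)"
      using germs_eq_span[OF P Q] germs_eq_span[of Q Q] dom(2)[of Q] by simp
  qed
qed

lemma germs_eq_lat: "Q \<in> Proj_ZXY \<Longrightarrow> germs Q = lat 0 Q"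
  unfolding lat_def using germs_eq_span dom(2) by blast

text \<open>Equality of sections is local. Where \<open>E\<close> is trivialised, the value
  determines both coordinates because the basis is nondegenerate.\<close>

lemma val_inj:
  assumes V: "openin Proj_topology V" "V \<noteq> {}" and s: "s \<in> carrier (Sec E V)" and t: "t \<in> carrier (Sec E V)"
    and eq: "val V s = val V t"
  shows "s = t"
proof -
  define \<U> where "\<U> = (\<lambda>P. V \<inter> dom P) ` V"
  have VP: "V \<subseteq> Proj_ZXY" using V open_Proj_subset by blast
  have o: "openin Proj_topology U" if "U \<in> \<U>" for U using that V(1) dom VP by (auto simp: \<U>_def)
  have Un: "\<Union>\<U> = V" using dom(2) VP by (auto simp: \<U>_def)
  have "Res E V U s = Res E V U t" if U: "U \<in> \<U>" for U
  proof -
    obtain P where P: "P \<in> V" "U = V \<inter> dom P" using U by (auto simp: \<U>_def)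
    then have PP: "P \<in> Proj_ZXY" and U': "U \<subseteq> dom P" "U \<subseteq> V" "U \<noteq> {}" using VP dom(2) by auto
    obtain v where v: "v \<in> regular_pairs U" "Res E V U s = triv P U v"
      using triv_surj[OF PP o[OF U] U'(1) Res_closed[OF V(1) o[OF U] U'(2) s]] by blast
    obtain w where w: "w \<in> regular_pairs U" "Res E V U t = triv P U w"
      using triv_surj[OF PP o[OF U] U'(1) Res_closed[OF V(1) o[OF U] U'(2) t]] by blast
    have "val U (Res E V U s) = val U (Res E V U t)"
      using val_Res[OF V(1) o[OF U] U'(3,2)] s t eq by simp
    then have e: "sv (fst v) (bu P) + sv (snd v) (bw P) = sv (fst w) (bu P) + sv (snd w) (bw P)"
      using val_triv[OF PP o[OF U] U'(1,3)] v w by simp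
    have "wd (sv (fst v) (bu P) + sv (snd v) (bw P)) (bw P) = fst v * wd (bu P) (bw P)"
      "wd (bu P) (sv (fst v) (bu P) + sv (snd v) (bw P)) = snd v * wd (bu P) (bw P)" for v
      by (simp_all add: wd_simps)
    then have "v = w" using e basis_nondegenerate[OF PP] by (metis mult_right_cancel prod_eq_iff)
    then show ?thesis using v w by simp
  qed
  then show ?thesis
    using sheaf s t o Un unfolding sheaf_of_modules_def by (metis is_open_P1Z)
qed

text \<open>As \<open>v\<close> lies in the stalk at every point of \<open>V\<close>, sections with
  value \<open>v\<close> exist locally; by \<open>val_inj\<close> they agree on overlaps, so they
  glue.\<close>

lemma val_surj:
  assumes V: "openin Proj_topology V" "V \<noteq> {}" and v: "\<And>Q. Q \<in> V \<Longrightarrow> v \<in> lat 0 Q"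
  shows "\<exists>s\<in>carrier (Sec E V). val V s = v"
proof -
  define \<U> where "\<U> = {U. openin Proj_topology U \<and> U \<noteq> {} \<and> U \<subseteq> V \<and> (\<exists>s\<in>carrier (Sec E U). val U s = v)}"
  define \<sigma> where "\<sigma> U = (SOME s. s \<in> carrier (Sec E U) \<and> val U s = v)" for U
  have o: "openin Proj_topology U" "U \<subseteq> V" "U \<noteq> {}" if "U \<in> \<U>" for U using that by (auto simp: \<U>_def)
  have \<sigma>: "\<sigma> U \<in> carrier (Sec E U)" "val U (\<sigma> U) = v" if "U \<in> \<U>" for U
    unfolding \<sigma>_def using that someI_ex[of "\<lambda>s. s \<in> carrier (Sec E U) \<and> val U s = v"] by (auto simp: \<U>_def)
  have "\<exists>U\<in>\<U>. Q \<in> U" if Q: "Q \<in> V" for Q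
  proof -
    have QP: "Q \<in> Proj_ZXY" using V Q open_Proj_subset by blast
    have "v \<in> germs Q" using v[OF Q] germs_eq_lat[OF QP] by simp
    then obtain W s where W: "openin Proj_topology W" "Q \<in> W" "s \<in> carrier (Sec E W)" "v = val W s"
      unfolding germs_def by blast
    have o': "openin Proj_topology (V \<inter> W)" "V \<inter> W \<noteq> {}" using V W Q by auto
    have "Res E W (V \<inter> W) s \<in> carrier (Sec E (V \<inter> W))" "val (V \<inter> W) (Res E W (V \<inter> W) s) = v"
      using Res_closed[OF W(1) o'(1) _ W(3)] val_Res[OF W(1) o' _ W(3)] W(4) by auto
    then have "V \<inter> W \<in> \<U>" using o' by (auto simp: \<U>_def)
    then show ?thesis using Q W by blast
  qed
  then have Un: "\<Union>\<U> = V" using o by blast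
  have "Res E U (U \<inter> W) (\<sigma> U) = Res E W (U \<inter> W) (\<sigma> W)" if UW: "U \<in> \<U>" "W \<in> \<U>" for U W
  proof (rule val_inj)
    show o': "openin Proj_topology (U \<inter> W)" "U \<inter> W \<noteq> {}"
      using o[OF UW(1)] o[OF UW(2)] eta_in_open by blast+
    show "Res E U (U \<inter> W) (\<sigma> U) \<in> carrier (Sec E (U \<inter> W))" "Res E W (U \<inter> W) (\<sigma> W) \<in> carrier (Sec E (U \<inter> W))"
      using Res_closed o o'(1) \<sigma> UW by auto
    show "val (U \<inter> W) (Res E U (U \<inter> W) (\<sigma> U)) = val (U \<inter> W) (Res E W (U \<inter> W) (\<sigma> W))"
      using val_Res o o' \<sigma> UW by auto
  qed
  then obtain s where s: "s \<in> carrier (Sec E V)" "\<forall>U\<in>\<U>. Res E V U s = \<sigma> U"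
    using sheaf o(1) \<sigma>(1) Un unfolding sheaf_of_modules_def is_open_P1Z by metis
  obtain U where U: "U \<in> \<U>" using Un V by blast
  have "val V s = v" using val_Res[OF V(1) o(1,3,2)[OF U] s(1)] s(2) U \<sigma>(2)[OF U] by simp
  then show ?thesis using s(1) by blast
qed

text \<open>Both sheaf conditions are applied to the empty cover of the empty set.\<close>

lemma empty_section: "\<exists>!s. s \<in> carrier (Sec E {})"
proof -
  have "\<exists>s\<in>carrier (Sec E (\<Union>{})). \<forall>U\<in>{}. Res E (\<Union>{}) U s = undefined"
    using sheaf unfolding sheaf_of_modules_def by blast
  moreover have "s = t" if "s \<in> carrier (Sec E (\<Union>{}))" "t \<in> carrier (Sec E (\<Union>{}))" for s t
    using sheaf that unfolding sheaf_of_modules_def by blast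
  ultimately show ?thesis by auto
qed

lemma iso_lattice_sheaf:
  "mod_isomorphism P1Z E (latt (lat 0) sv) (\<lambda>V s. cst (val V s) V)"
proof -
  have val_lat: "val V s \<in> lat 0 Q" if "openin Proj_topology V" "s \<in> carrier (Sec E V)" "Q \<in> V" for V s Q
  proof -
    have "Q \<in> Proj_ZXY" using that open_Proj_subset by blast
    then show ?thesis using that germs_eq_lat[of Q] by (auto simp: germs_def)
  qed
  show ?thesis
    unfolding mod_isomorphism_def
  proof (intro conjI allI impI)
    show "mod_morphism P1Z E (latt (lat 0) sv) (\<lambda>V s. cst (val V s) V)"
    proof (rule mod_morphismI)
      fix V s assume "is_open P1Z V" and s: "s \<in> carrier (Sec E V)"
      then have V: "openin Proj_topology V" by simp
      show "cst (val V s) V \<in> carrier (Sec (latt (lat 0) sv) V)"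
        using klattice.cs_cst[OF klattice_lat V val_lat[OF V s]] by simp
      {
        fix t assume "t \<in> carrier (Sec E V)"
        then show "cst (val V (s \<oplus>\<^bsub>Sec E V\<^esub> t)) V = cst (val V s) V \<oplus>\<^bsub>Sec (latt (lat 0) sv) V\<^esub> cst (val V t) V"
          using val_add[OF V _ s] cst_empty by (cases "V = {}") auto
      next
        fix r assume "r \<in> carrier (ring_at P1Z V)"
        then obtain \<rho> where r: "r = cst \<rho> V" "\<And>Q. Q \<in> V \<Longrightarrow> \<rho> \<in> loc 0 Q"
          using csE[OF V] by (auto simp: twist_sections_eq_cs)
        show "cst (val V (r \<odot>\<^bsub>Sec E V\<^esub> s)) V = r \<odot>\<^bsub>Sec (latt (lat 0) sv) V\<^esub> cst (val V s) V"
          unfolding r using val_smult[OF V _ s r(2)] cst_empty by (cases "V = {}") auto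
      next
        fix W assume "is_open P1Z W" "W \<subseteq> V"
        then show "Res (latt (lat 0) sv) V W (cst (val V s) V) = cst (val W (Res E V W s)) W"
          using val_Res[OF V _ _ _ s] cst_empty by (cases "W = {}") auto
      }
    qed
    fix V assume "is_open P1Z V"
    then have V: "openin Proj_topology V" by simp
    show "bij_betw (\<lambda>s. cst (val V s) V) (carrier (Sec E V)) (carrier (Sec (latt (lat 0) sv) V))"
    proof (cases "V = {}")
      case True
      obtain s where "carrier (Sec E {}) = {s}" using empty_section by auto
      moreover have "cs (lat 0) {} = {cst 0 {}}"
        by (auto simp: cs_def cst_def)
      ultimately show ?thesis using cst_empty[of "val {} s" 0] True by (auto simp: bij_betw_def)
    next
      case False
      show ?thesis
        unfolding bij_betw_def
      proof (intro conjI)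
        show "inj_on (\<lambda>s. cst (val V s) V) (carrier (Sec E V))"
          using val_inj[OF V False] by (auto intro!: inj_onI simp: cst_eq_iff[OF False])
        show "(\<lambda>s. cst (val V s) V) ` carrier (Sec E V) = carrier (Sec (latt (lat 0) sv) V)"
        proof (intro equalityI subsetI)
          fix x assume "x \<in> (\<lambda>s. cst (val V s) V) ` carrier (Sec E V)"
          then show "x \<in> carrier (Sec (latt (lat 0) sv) V)"
            using klattice.cs_cst[OF klattice_lat V val_lat[OF V]] by auto
        next
          fix x assume "x \<in> carrier (Sec (latt (lat 0) sv) V)"
          then obtain v where v: "x = cst v V" "\<And>Q. Q \<in> V \<Longrightarrow> v \<in> lat 0 Q"
            using csE[OF V] unfolding latt_simps(1) by metis
          obtain s where "s \<in> carrier (Sec E V)" "val V s = v" using val_surj[OF V False v(2)] by blast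
          then show "x \<in> (\<lambda>s. cst (val V s) V) ` carrier (Sec E V)" using v(1) by blast
        qed
      qed
    qed
  qed
qed

end

lemma locally_free_trivialized:
  fixes E :: "(zxy set, zxy_section, 'a) mod_presheaf"
  assumes E: "locally_free_sheaf P1Z 2 E"
  shows "\<exists>dom triv. trivialized_sheaf E dom triv"
proof -
  have "\<forall>P\<in>Proj_ZXY. \<exists>U. openin Proj_topology U \<and> P \<in> U \<and>
      (\<exists>\<phi>. mod_isomorphism (open_subspace P1Z U) (free_sheaf (open_subspace P1Z U) {..<2::nat}) E \<phi>)"
    using E by (simp add: locally_free_sheaf_def topspace_Proj)
  then obtain dom where d: "\<forall>P\<in>Proj_ZXY. openin Proj_topology (dom P) \<and> P \<in> dom P \<and>
      (\<exists>\<phi>. mod_isomorphism (open_subspace P1Z (dom P)) (free_sheaf (open_subspace P1Z (dom P)) {..<2::nat}) E \<phi>)"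
    by (rule bchoice[THEN exE])
  then have "\<forall>P\<in>Proj_ZXY. \<exists>\<phi>. mod_isomorphism (open_subspace P1Z (dom P))
      (free_sheaf (open_subspace P1Z (dom P)) {..<2::nat}) E \<phi>" by blast
  then obtain \<phi> where iso': "\<forall>P\<in>Proj_ZXY. mod_isomorphism (open_subspace P1Z (dom P))
      (free_sheaf (open_subspace P1Z (dom P)) {..<2::nat}) E (\<phi> P)"
    by (rule bchoice[THEN exE])
  have dom: "\<And>P. P \<in> Proj_ZXY \<Longrightarrow> openin Proj_topology (dom P)" "\<And>P. P \<in> Proj_ZXY \<Longrightarrow> P \<in> dom P"
    using d by auto
  have iso: "\<And>P. P \<in> Proj_ZXY \<Longrightarrow>
      mod_isomorphism (open_subspace P1Z (dom P)) (free_sheaf (open_subspace P1Z (dom P)) {..<2::nat}) E (\<phi> P)"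
    using iso' by blast
  define triv where "triv P V v = \<phi> P V (pair_section v V)" for P V v
  have "trivialized_sheaf E dom triv"
  proof
    show "sheaf_of_modules P1Z E" using E by (simp add: locally_free_sheaf_def)
    show "openin Proj_topology (dom P)" "P \<in> dom P" if "P \<in> Proj_ZXY" for P using dom that by auto
  next
    fix P V v assume P: "P \<in> Proj_ZXY" and V: "openin Proj_topology V" "V \<subseteq> dom P"
    note os = open_subspace_simps[OF dom(1)[OF P]]
    have V': "is_open (open_subspace P1Z (dom P)) V" using V os by simp
    have mor: "mod_morphism (open_subspace P1Z (dom P)) (free_sheaf (open_subspace P1Z (dom P)) {..<2::nat}) E (\<phi> P)"
      and bij: "bij_betw (\<phi> P V) (carrier (Sec (free_sheaf (open_subspace P1Z (dom P)) {..<2::nat}) V)) (carrier (Sec E V))"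
      using iso[OF P] V' by (simp_all add: mod_isomorphism_def)
    note D = mod_morphismD[OF mor V'] and car = pair_section_in_free[OF dom(1)[OF P] V]
      and ops = free_sheaf_ops[OF dom(1)[OF P]]
    show "s \<in> carrier (Sec E V) \<Longrightarrow> \<exists>v\<in>regular_pairs V. s = triv P V v" for s
    proof -
      assume "s \<in> carrier (Sec E V)"
      then have "s \<in> \<phi> P V ` {pair_section v V | v. v \<in> regular_pairs V}"
        using bij unfolding car bij_betw_def by simp
      then show ?thesis unfolding triv_def by blast
    qed
    assume v: "v \<in> regular_pairs V"
    then have pv: "pair_section v V \<in> carrier (Sec (free_sheaf (open_subspace P1Z (dom P)) {..<2::nat}) V)"
      using car by blast
    show "triv P V v \<in> carrier (Sec E V)" unfolding triv_def by (rule D(1)[OF pv])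
    {
      fix w assume w: "w \<in> regular_pairs V"
      then have pw: "pair_section w V \<in> carrier (Sec (free_sheaf (open_subspace P1Z (dom P)) {..<2::nat}) V)"
        using car by blast
      have "pair_section (v + w) V = pair_section v V \<oplus>\<^bsub>Sec (free_sheaf (open_subspace P1Z (dom P)) {..<2::nat}) V\<^esub> pair_section w V"
        unfolding ops by (auto simp: pair_section_def fun_eq_iff cst_def restrict_def)
      then show "triv P V (v + w) = triv P V v \<oplus>\<^bsub>Sec E V\<^esub> triv P V w"
        unfolding triv_def using D(2)[OF pv pw] by simp
      assume ne: "V \<noteq> {}" and eq: "triv P V v = triv P V w"
      have "pair_section v V = pair_section w V"
        using bij eq pv pw unfolding bij_betw_def triv_def by (meson inj_onD)
      then show "v = w" using pair_section_eq_iff[OF ne] by simp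
    next
      fix r assume r: "\<And>Q. Q \<in> V \<Longrightarrow> r \<in> loc 0 Q"
      have "cst r V \<in> carrier (ring_at (open_subspace P1Z (dom P)) V)"
        using r unfolding os(2) by (auto simp: twist_sections_eq_cs in_twist_iff[OF V(1)])
      moreover have "pair_section (sv r v) V = cst r V \<odot>\<^bsub>Sec (free_sheaf (open_subspace P1Z (dom P)) {..<2::nat}) V\<^esub> pair_section v V"
        unfolding ops by (auto simp: pair_section_def fun_eq_iff cst_def restrict_def)
      ultimately show "triv P V (sv r v) = cst r V \<odot>\<^bsub>Sec E V\<^esub> triv P V v"
        unfolding triv_def using D(3)[OF _ pv] by simp
    next
      fix W assume W: "openin Proj_topology W" "W \<subseteq> V"
      then have W': "is_open (open_subspace P1Z (dom P)) W" using V os by auto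
      have "Res (free_sheaf (open_subspace P1Z (dom P)) {..<2::nat}) V W (pair_section v V) = pair_section v W"
        unfolding ops using W by (auto simp: pair_section_def fun_eq_iff)
      then show "Res E V W (triv P V v) = triv P W v"
        unfolding triv_def using D(4)[OF W' W(2) pv] by simp
    }
  qed
  then show ?thesis by blast
qed

section \<open>Tensor products\<close>

locale tensor_pair = M: Module.module R M + N: Module.module R N
  for R :: "('r, 'k) ring_scheme" and M :: "('r, 'a) module" and N :: "('r, 'b) module"
begin

definition gens :: "('a \<times> 'b \<Rightarrow>\<^sub>0 int) set" where
  "gens = {frag_of (m \<oplus>\<^bsub>M\<^esub> m', n) - frag_of (m, n) - frag_of (m', n) | m m' n.
           m \<in> carrier M \<and> m' \<in> carrier M \<and> n \<in> carrier N} \<union>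
        {frag_of (m, n \<oplus>\<^bsub>N\<^esub> n') - frag_of (m, n) - frag_of (m, n') | m n n'.
           m \<in> carrier M \<and> n \<in> carrier N \<and> n' \<in> carrier N} \<union>
        {frag_of (r \<odot>\<^bsub>M\<^esub> m, n) - frag_of (m, r \<odot>\<^bsub>N\<^esub> n) | r m n.
           r \<in> carrier R \<and> m \<in> carrier M \<and> n \<in> carrier N}"

lemma gensI:
  "m \<in> carrier M \<Longrightarrow> m' \<in> carrier M \<Longrightarrow> n \<in> carrier N \<Longrightarrow>
    frag_of (m \<oplus>\<^bsub>M\<^esub> m', n) - frag_of (m, n) - frag_of (m', n) \<in> gens"
  "m \<in> carrier M \<Longrightarrow> n \<in> carrier N \<Longrightarrow> n' \<in> carrier N \<Longrightarrow>
    frag_of (m, n \<oplus>\<^bsub>N\<^esub> n') - frag_of (m, n) - frag_of (m, n') \<in> gens"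
  "r \<in> carrier R \<Longrightarrow> m \<in> carrier M \<Longrightarrow> n \<in> carrier N \<Longrightarrow>
    frag_of (r \<odot>\<^bsub>M\<^esub> m, n) - frag_of (m, r \<odot>\<^bsub>N\<^esub> n) \<in> gens"
  unfolding gens_def by blast+

abbreviation "rel \<equiv> tensor_relations R M N"
abbreviation "pairs \<equiv> carrier M \<times> carrier N"

lemma rel_eq: "rel = generate (free_Abelian_group pairs) gens"
  unfolding tensor_relations_def gens_def ..

lemma keys_diff2: "Poly_Mapping.keys a \<subseteq> S \<Longrightarrow> Poly_Mapping.keys b \<subseteq> S \<Longrightarrow> Poly_Mapping.keys (a - b) \<subseteq> S"
  using keys_diff[of a b] by blast

lemma gens_keys: "x \<in> gens \<Longrightarrow> Poly_Mapping.keys x \<subseteq> pairs"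
  unfolding gens_def
  by (elim UnE CollectE exE conjE; hypsubst; intro keys_diff2; simp add: keys_frag_of)

lemma subgroup_rel: "subgroup rel (free_Abelian_group pairs)"
  unfolding rel_eq using gens_keys by (intro group.generate_is_subgroup) auto

lemma rel_keys: "x \<in> rel \<Longrightarrow> Poly_Mapping.keys x \<subseteq> pairs"
  using subgroup.mem_carrier[OF subgroup_rel] by (metis carrier_free_Abelian_group_iff)

lemma rel_0: "0 \<in> rel"
  using subgroup.one_closed[OF subgroup_rel] by simp

lemma rel_add: "x \<in> rel \<Longrightarrow> y \<in> rel \<Longrightarrow> x + y \<in> rel"
  using subgroup.m_closed[OF subgroup_rel] by simp

lemma rel_minus: "x \<in> rel \<Longrightarrow> - x \<in> rel"
  using subgroup.m_inv_closed[OF subgroup_rel] rel_keys by fastforce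

lemma rel_diff: "x \<in> rel \<Longrightarrow> y \<in> rel \<Longrightarrow> x - y \<in> rel"
  using rel_add[OF _ rel_minus] by fastforce

lemma rel_gens: "x \<in> gens \<Longrightarrow> x \<in> rel"
  unfolding rel_eq by (rule generate.incl)

text \<open>An additive map that sends the defining relations into a subgroup sends everything they
  generate there. With the subgroup 0 this makes a map descend to the tensor product; with the
  relations of another tensor product it gives an induced map.\<close>

lemma rel_induct:
  fixes \<phi> :: "('a \<times> 'b \<Rightarrow>\<^sub>0 int) \<Rightarrow> 'c::ab_group_add"
  assumes diff: "\<And>a b. \<phi> (a - b) = \<phi> a - \<phi> b"
    and H: "0 \<in> H" "\<And>x y. x \<in> H \<Longrightarrow> y \<in> H \<Longrightarrow> x - y \<in> H"
    and gens: "\<And>x. x \<in> gens \<Longrightarrow> \<phi> x \<in> H" and x: "x \<in> rel"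
  shows "\<phi> x \<in> H"
proof -
  have zero: "\<phi> 0 = 0" using diff[of 0 0] by simp
  have minus: "\<phi> (- a) = - \<phi> a" for a using diff[of 0 a] zero by simp
  have add: "\<phi> (a + b) = \<phi> a + \<phi> b" for a b using diff[of a "- b"] minus[of b] by simp
  have Hm: "- y \<in> H" if "y \<in> H" for y using H(2)[OF H(1) that] by simp
  have Ha: "y + z \<in> H" if "y \<in> H" "z \<in> H" for y z using H(2)[OF that(1) Hm[OF that(2)]] by simp
  show ?thesis
    using x unfolding rel_eq
  proof (induction rule: generate.induct)
    case (inv h)
    then show ?case using gens gens_keys[of h] minus Hm by simp
  qed (use zero H gens add Ha in auto)
qed

definition cos :: "('a \<times> 'b \<Rightarrow>\<^sub>0 int) \<Rightarrow> ('a \<times> 'b \<Rightarrow>\<^sub>0 int) set" where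
  "cos a = rel #>\<^bsub>free_Abelian_group pairs\<^esub> a"

lemma cos_eq: "cos a = {x. x - a \<in> rel}"
proof -
  have "cos a = {h + a | h. h \<in> rel}" unfolding cos_def r_coset_def by auto
  also have "\<dots> = {x. x - a \<in> rel}"
  proof (intro equalityI subsetI)
    fix x assume "x \<in> {x. x - a \<in> rel}"
    then show "x \<in> {h + a | h. h \<in> rel}" by (intro CollectI exI[of _ "x - a"]) simp
  qed auto
  finally show ?thesis .
qed

lemma cos_eq_iff: "cos a = cos b \<longleftrightarrow> a - b \<in> rel"
proof
  assume eq: "cos a = cos b"
  have "a \<in> cos a" unfolding cos_eq using rel_0 by simp
  then show "a - b \<in> rel" unfolding eq unfolding cos_eq by simp
next
  assume ab: "a - b \<in> rel"
  have "x - a \<in> rel \<longleftrightarrow> x - b \<in> rel" for x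
    using rel_add[OF _ ab, of "x - a"] rel_diff[OF _ ab, of "x - b"] by (auto simp: algebra_simps)
  then show "cos a = cos b" by (simp add: cos_eq)
qed

lemma carrier_tensor: "carrier (tensor_module R M N) = {cos a | a. Poly_Mapping.keys a \<subseteq> pairs}"
  unfolding tensor_module_def tensor_group_def FactGroup_def RCOSETS_def cos_def[symmetric] by auto

lemma zero_tensor: "\<zero>\<^bsub>tensor_module R M N\<^esub> = cos 0"
  unfolding tensor_module_def tensor_group_def FactGroup_def by (simp add: cos_eq)

lemma add_tensor: "cos a \<oplus>\<^bsub>tensor_module R M N\<^esub> cos b = cos (a + b)"
proof -
  have "cos a \<oplus>\<^bsub>tensor_module R M N\<^esub> cos b = {x + y | x y. x \<in> cos a \<and> y \<in> cos b}"
    unfolding tensor_module_def tensor_group_def FactGroup_def set_mult_def by auto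
  also have "\<dots> = cos (a + b)"
  proof (intro equalityI subsetI)
    fix z assume "z \<in> {x + y | x y. x \<in> cos a \<and> y \<in> cos b}"
    then obtain x y where "z = x + y" "x - a \<in> rel" "y - b \<in> rel" by (auto simp: cos_eq)
    then show "z \<in> cos (a + b)" using rel_add[of "x - a" "y - b"] by (simp add: cos_eq algebra_simps)
  next
    fix z assume "z \<in> cos (a + b)"
    then have "z - b \<in> cos a" "b \<in> cos b" using rel_0 by (auto simp: cos_eq algebra_simps)
    moreover have "z = (z - b) + b" by simp
    ultimately show "z \<in> {x + y | x y. x \<in> cos a \<and> y \<in> cos b}" by blast
  qed
  finally show ?thesis .
qed

end

abbreviation "frag_map h \<equiv> frag_extend (\<lambda>x. frag_of (h x))"

lemma keys_frag_map: "Poly_Mapping.keys a \<subseteq> S \<Longrightarrow> h ` S \<subseteq> T \<Longrightarrow> Poly_Mapping.keys (frag_map h a) \<subseteq> T"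
  using keys_frag_extend[of "\<lambda>x. frag_of (h x)" a] by (force simp: keys_frag_of)

text \<open>The map \<open>\<rho>\<close> allows a change of rings: with the restriction of
  functions this covers restriction of tensors, and with the identity it covers multiplication by a
  scalar.\<close>

lemma tensor_map_cos:
  assumes A: "tensor_pair R M N" and B: "tensor_pair R' M' N'"
    and f: "\<And>m. m \<in> carrier M \<Longrightarrow> f m \<in> carrier M'"
      "\<And>m m'. m \<in> carrier M \<Longrightarrow> m' \<in> carrier M \<Longrightarrow> f (m \<oplus>\<^bsub>M\<^esub> m') = f m \<oplus>\<^bsub>M'\<^esub> f m'"
      "\<And>r m. r \<in> carrier R \<Longrightarrow> m \<in> carrier M \<Longrightarrow> f (r \<odot>\<^bsub>M\<^esub> m) = \<rho> r \<odot>\<^bsub>M'\<^esub> f m"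
    and g: "\<And>n. n \<in> carrier N \<Longrightarrow> g n \<in> carrier N'"
      "\<And>n n'. n \<in> carrier N \<Longrightarrow> n' \<in> carrier N \<Longrightarrow> g (n \<oplus>\<^bsub>N\<^esub> n') = g n \<oplus>\<^bsub>N'\<^esub> g n'"
      "\<And>r n. r \<in> carrier R \<Longrightarrow> n \<in> carrier N \<Longrightarrow> g (r \<odot>\<^bsub>N\<^esub> n) = \<rho> r \<odot>\<^bsub>N'\<^esub> g n"
    and \<rho>: "\<And>r. r \<in> carrier R \<Longrightarrow> \<rho> r \<in> carrier R'"
    and h: "h = (\<lambda>(m, n). (f m, g n))"
  shows "tensor_map R' M' N' h (tensor_pair.cos R M N a) = tensor_pair.cos R' M' N' (frag_map h a)"
proof -
  interpret A: tensor_pair R M N by fact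
  interpret B: tensor_pair R' M' N' by fact
  have rel: "frag_map h x \<in> B.rel" if "x \<in> A.rel" for x
  proof (rule A.rel_induct[of "frag_map h" B.rel x])
    fix x assume "x \<in> A.gens"
    then consider m m' n where "x = frag_of (m \<oplus>\<^bsub>M\<^esub> m', n) - frag_of (m, n) - frag_of (m', n)"
        "m \<in> carrier M" "m' \<in> carrier M" "n \<in> carrier N"
      | m n n' where "x = frag_of (m, n \<oplus>\<^bsub>N\<^esub> n') - frag_of (m, n) - frag_of (m, n')"
        "m \<in> carrier M" "n \<in> carrier N" "n' \<in> carrier N"
      | r m n where "x = frag_of (r \<odot>\<^bsub>M\<^esub> m, n) - frag_of (m, r \<odot>\<^bsub>N\<^esub> n)"
        "r \<in> carrier R" "m \<in> carrier M" "n \<in> carrier N"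
      unfolding A.gens_def by blast
    then show "frag_map h x \<in> B.rel"
    proof cases
      case 1
      then have "frag_map h x = frag_of (f m \<oplus>\<^bsub>M'\<^esub> f m', g n) - frag_of (f m, g n) - frag_of (f m', g n)"
        using f by (simp add: frag_extend_diff h)
      then show ?thesis using 1 f(1) g(1) B.rel_gens[OF B.gensI(1)] by simp
    next
      case 2
      then have "frag_map h x = frag_of (f m, g n \<oplus>\<^bsub>N'\<^esub> g n') - frag_of (f m, g n) - frag_of (f m, g n')"
        using g by (simp add: frag_extend_diff h)
      then show ?thesis using 2 f(1) g(1) B.rel_gens[OF B.gensI(2)] by simp
    next
      case 3
      then have "frag_map h x = frag_of (\<rho> r \<odot>\<^bsub>M'\<^esub> f m, g n) - frag_of (f m, \<rho> r \<odot>\<^bsub>N'\<^esub> g n)"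
        using f g by (simp add: frag_extend_diff h)
      then show ?thesis using 3 f(1) g(1) \<rho> B.rel_gens[OF B.gensI(3)] by simp
    qed
  qed (auto simp: frag_extend_diff B.rel_0 B.rel_diff that)
  have "B.cos (frag_map h c) = B.cos (frag_map h a)" if "c \<in> A.cos a" for c
    using rel[of "c - a"] that by (simp add: A.cos_eq B.cos_eq_iff frag_extend_diff)
  moreover have "a \<in> A.cos a" using A.rel_0 by (simp add: A.cos_eq)
  moreover have "tensor_map R' M' N' h (A.cos a) = (\<Union>c\<in>A.cos a. B.cos (frag_map h c))"
    unfolding tensor_map_def B.cos_def ..
  ultimately show ?thesis by blast
qed

lemma smult_tensor:
  assumes A: "tensor_pair R M N" and r: "r \<in> carrier R"
  shows "r \<odot>\<^bsub>tensor_module R M N\<^esub> tensor_pair.cos R M N a =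
    tensor_pair.cos R M N (frag_map (\<lambda>(m, n). (r \<odot>\<^bsub>M\<^esub> m, n)) a)"
proof -
  interpret A: tensor_pair R M N by fact
  have "r \<odot>\<^bsub>tensor_module R M N\<^esub> A.cos a = tensor_map R M N (\<lambda>(m, n). (r \<odot>\<^bsub>M\<^esub> m, n)) (A.cos a)"
    by (simp add: tensor_module_def)
  also have "\<dots> = A.cos (frag_map (\<lambda>(m, n). (r \<odot>\<^bsub>M\<^esub> m, n)) a)"
  proof (rule tensor_map_cos[OF A A, where f = "\<lambda>m. r \<odot>\<^bsub>M\<^esub> m" and g = "\<lambda>n. n" and \<rho> = "\<lambda>r. r"])
    fix r' m assume "r' \<in> carrier R" "m \<in> carrier M"
    then show "r \<odot>\<^bsub>M\<^esub> (r' \<odot>\<^bsub>M\<^esub> m) = r' \<odot>\<^bsub>M\<^esub> (r \<odot>\<^bsub>M\<^esub> m)"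
      using r by (metis A.M.smult_assoc1 A.M.R.m_comm)
  qed (use r in \<open>auto simp: A.M.smult_r_distr\<close>)
  finally show ?thesis .
qed

text \<open>Operations on germs are defined as unions over representatives; this collapses such a
  union when all members agree and there is a representative.\<close>

lemma UN_pairs_const:
  assumes "\<And>x y. (x, y) \<in> A \<Longrightarrow> f x y = C" "A \<noteq> {}"
  shows "(\<Union>(x, y)\<in>A. f x y) = C"
proof -
  have "(\<Union>(x, y)\<in>A. f x y) = (\<Union>z\<in>A. C)" by (rule SUP_cong) (use assms(1) in auto)
  then show ?thesis using assms(2) by simp
qed

section \<open>Values of tensors\<close>

text \<open>The multiplication map on formal sums of pairs, evaluated at the generic point. Sections
  are constant, so over a nonempty open set nothing is lost by evaluating there.\<close>

definition mval :: "(zxy_section \<times> zxy_section \<Rightarrow>\<^sub>0 int) \<Rightarrow> zxy fract" where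
  "mval c = (\<Sum>k\<in>Poly_Mapping.keys c. of_int (Poly_Mapping.lookup c k) * (fst k eta * snd k eta))"

lemma mval_superset:
  assumes "finite S" "Poly_Mapping.keys c \<subseteq> S"
  shows "mval c = (\<Sum>k\<in>S. of_int (Poly_Mapping.lookup c k) * (fst k eta * snd k eta))"
  unfolding mval_def using assms by (intro sum.mono_neutral_left) (auto simp: in_keys_iff)

lemma mval_diff: "mval (a - b) = mval a - mval b"
proof -
  let ?S = "Poly_Mapping.keys a \<union> Poly_Mapping.keys b"
  show ?thesis
    using mval_superset[of ?S a] mval_superset[of ?S b] mval_superset[of ?S "a - b"] keys_diff[of a b]
    by (simp add: Poly_Mapping.lookup_minus algebra_simps sum_subtractf)
qed

lemma mval_0 [simp]: "mval 0 = 0"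
  by (simp add: mval_def)

lemma mval_add: "mval (a + b) = mval a + mval b"
  using mval_diff[of a "- b"] mval_diff[of 0 b] by simp

lemma mval_of [simp]: "mval (frag_of k) = fst k eta * snd k eta"
  by (simp add: mval_def keys_frag_of)

lemma frag_property:
  assumes "Poly_Mapping.keys x \<subseteq> S" "0 \<in> H" "\<And>x y. x \<in> H \<Longrightarrow> y \<in> H \<Longrightarrow> x - y \<in> H"
    and "\<And>a. a \<in> S \<Longrightarrow> \<phi> (frag_of a) \<in> H" and diff: "\<And>a b. \<phi> (a - b) = \<phi> a - (\<phi> b :: 'c::ab_group_add)"
  shows "\<phi> x \<in> H"
  using assms(1)
proof (rule free_Abelian_group_induct)
  show "\<phi> 0 \<in> H" using diff[of 0 0] assms(2) by simp
qed (use assms in auto)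

text \<open>
  The tensor product sheaf of an ideal lattice and \<open>\<O>(b)\<close>. Wherever \<open>\<O>(b)\<close> has a generator a
  tensor is determined by its value under multiplication, so germs of tensors are the sets \<open>G p v\<close>
  of all local sections with value \<open>v\<close>.
\<close>

locale twisted_lattice = L: klattice L "(*)" for L :: "zxy set \<Rightarrow> zxy fract set" +
  fixes b :: int
begin

abbreviation "FL \<equiv> latt L (*)"
abbreviation "FO \<equiv> latt (loc b) (*)"
abbreviation "TP \<equiv> tensor_presheaf P1Z FL FO"

text \<open>The product of the ideal with \<O>(b). Single products suffice, since \<O>(b) has a
  generator at \<open>P\<close> to which the second factor of every product can be
  normalised.\<close>

definition J :: "zxy set \<Rightarrow> zxy fract set" where
  "J P = {i * c | i c. i \<in> L P \<and> c \<in> loc b P}"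

lemma J_iff:
  assumes P: "P \<in> Proj_ZXY" and g: "loc_unit b P g"
  shows "v \<in> J P \<longleftrightarrow> v / g \<in> L P"
proof
  assume "v \<in> J P"
  then obtain i c where ic: "v = i * c" "i \<in> L P" "c \<in> loc b P" by (auto simp: J_def)
  have "c / g \<in> loc 0 P"
    using loc_mult[OF P ic(3), of "inverse g" "- b"] g by (simp add: loc_unit_def divide_inverse)
  then have "c / g * i \<in> L P" by (rule L.L_sm[OF P _ ic(2)])
  then show "v / g \<in> L P" by (simp add: ic mult.commute)
next
  assume "v / g \<in> L P"
  moreover have "v = v / g * g" using g by (simp add: loc_unit_def)
  ultimately show "v \<in> J P" using g unfolding J_def loc_unit_def by blast
qed

lemma klattice_J: "klattice J (*)"
proof (rule klattice.intro)
  show "vector_space ((*) :: zxy fract \<Rightarrow> zxy fract \<Rightarrow> zxy fract)" by (rule L.vs)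
  fix P assume P: "P \<in> Proj_ZXY"
  obtain g where g: "loc_unit b P g" using ex_loc_unit[OF P] by blast
  note iff = J_iff[OF P g]
  show "0 \<in> J P" using L.L_0[OF P] by (simp add: iff)
  show "v + w \<in> J P" if "v \<in> J P" "w \<in> J P" for v w
    using that L.L_add[OF P, of "v / g" "w / g"] by (simp add: iff add_divide_distrib)
  show "r * v \<in> J P" if "r \<in> loc 0 P" "v \<in> J P" for r v
    using that L.L_sm[OF P, of r "v / g"] by (simp add: iff)
  fix v assume "v \<in> J P"
  then obtain i c where ic: "v = i * c" "i \<in> L P" "c \<in> loc b P" by (auto simp: J_def)
  obtain V W where "openin Proj_topology V" "P \<in> V" "\<forall>Q\<in>V. i \<in> L Q"
    "openin Proj_topology W" "P \<in> W" "\<forall>Q\<in>W. c \<in> loc b Q"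
    using L.L_open[OF P ic(2)] loc_open[OF P ic(3)] by blast
  then show "\<exists>V. openin Proj_topology V \<and> P \<in> V \<and> (\<forall>Q\<in>V. v \<in> J Q)"
    by (intro exI[of _ "V \<inter> W"]) (auto simp: J_def ic(1))
qed

sublocale Jl: klattice J "(*)" by (rule klattice_J)

lemma J_diff: "P \<in> Proj_ZXY \<Longrightarrow> v \<in> J P \<Longrightarrow> w \<in> J P \<Longrightarrow> v - w \<in> J P"
  using Jl.L_add[OF _ _ Jl.L_uminus] by fastforce

lemma tensor_pair: "openin Proj_topology V \<Longrightarrow> tensor_pair (ring_at P1Z V) (Sec FL V) (Sec FO V)"
  unfolding tensor_pair_def using L.module_latt klattice.module_latt[OF klattice_loc] by blast

abbreviation "tcos V \<equiv> tensor_pair.cos (ring_at P1Z V) (Sec FL V) (Sec FO V)"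
abbreviation "trel V \<equiv> tensor_relations (ring_at P1Z V) (Sec FL V) (Sec FO V)"
abbreviation "tpairs V \<equiv> cs L V \<times> cs (loc b) V"

lemma Sec_TP: "Sec TP V = tensor_module (ring_at P1Z V) (Sec FL V) (Sec FO V)"
  by (simp add: tensor_presheaf_def)

lemma carrier_TP:
  assumes "openin Proj_topology V"
  shows "carrier (Sec TP V) = {tcos V a | a. Poly_Mapping.keys a \<subseteq> tpairs V}"
  unfolding Sec_TP using tensor_pair.carrier_tensor[OF tensor_pair[OF assms]] by simp

lemma mval_rel:
  assumes V: "openin Proj_topology V" "V \<noteq> {}" and x: "x \<in> trel V"
  shows "mval x = 0"
proof -
  interpret tensor_pair "ring_at P1Z V" "Sec FL V" "Sec FO V" by (rule tensor_pair[OF V(1)])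
  have eta: "eta \<in> V" using V eta_in_open by blast
  have "mval x \<in> {0}"
  proof (rule rel_induct[OF mval_diff _ _ _ x])
    fix y assume "y \<in> gens"
    then show "mval y \<in> {0}"
      unfolding gens_def
      by (elim UnE CollectE exE conjE; hypsubst; simp (no_asm) add: mval_diff mval_add eta algebra_simps)
  qed auto
  then show ?thesis by simp
qed

definition tval :: "(zxy_section \<times> zxy_section \<Rightarrow>\<^sub>0 int) set \<Rightarrow> zxy fract" where
  "tval C = mval (SOME a. a \<in> C)"

lemma tval_cos:
  assumes V: "openin Proj_topology V" "V \<noteq> {}"
  shows "tval (tcos V a) = mval a"
proof -
  interpret tensor_pair "ring_at P1Z V" "Sec FL V" "Sec FO V" by (rule tensor_pair[OF V(1)])
  have "a \<in> tcos V a" using rel_0 by (simp add: cos_eq)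
  then have "(SOME x. x \<in> tcos V a) \<in> tcos V a" by (rule someI)
  then have "(SOME x. x \<in> tcos V a) - a \<in> trel V" by (simp add: cos_eq)
  from mval_rel[OF V this] show ?thesis unfolding tval_def by (simp add: mval_diff)
qed

lemma mval_J:
  assumes V: "openin Proj_topology V" and a: "Poly_Mapping.keys a \<subseteq> tpairs V" and Q: "Q \<in> V"
  shows "mval a \<in> J Q"
proof (rule frag_property[OF a])
  have QP: "Q \<in> Proj_ZXY" using V Q open_Proj_subset by blast
  show "0 \<in> J Q" by (rule Jl.L_0[OF QP])
  show "x - y \<in> J Q" if "x \<in> J Q" "y \<in> J Q" for x y by (rule J_diff[OF QP that])
  fix p assume "p \<in> tpairs V"
  then obtain s t where p: "p = (s, t)" "s \<in> cs L V" "t \<in> cs (loc b) V" by auto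
  obtain i where i: "s = cst i V" "i \<in> L Q" using csE[OF V p(2)] Q by metis
  obtain c where c: "t = cst c V" "c \<in> loc b Q" using csE[OF V p(3)] Q by metis
  have "eta \<in> V" using V Q eta_in_open by blast
  then show "mval (frag_of p) \<in> J Q" using p i c by (auto simp: J_def)
qed (rule mval_diff)

text \<open>With a generator \<open>g\<close> of \<O>(b) over \<open>V\<close>, the scalar
  \<open>c / g\<close> moves across the tensor sign, so every tensor takes the form of one
  elementary tensor of some \<open>i\<close> in the ideal with \<open>g\<close>. Its value
  \<open>i * g\<close> recovers \<open>i\<close>, so tensors with equal values agree.\<close>

lemma tcos_eq:
  assumes V: "openin Proj_topology V" "V \<noteq> {}" and g: "\<And>Q. Q \<in> V \<Longrightarrow> loc_unit b Q g"
    and a: "Poly_Mapping.keys a \<subseteq> tpairs V" and a': "Poly_Mapping.keys a' \<subseteq> tpairs V"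
    and eq: "mval a = mval a'"
  shows "tcos V a = tcos V a'"
proof -
  interpret tensor_pair "ring_at P1Z V" "Sec FL V" "Sec FO V" by (rule tensor_pair[OF V(1)])
  have Proj: "Q \<in> Proj_ZXY" if "Q \<in> V" for Q using V(1) open_Proj_subset that by blast
  have eta: "eta \<in> V" using V eta_in_open by blast
  have g0: "g \<noteq> 0" using g[OF eta] by (simp add: loc_unit_def)
  have gV: "cst g V \<in> cs (loc b) V"
    using g by (intro klattice.cs_cst[OF klattice_loc V(1)]) (auto simp: loc_unit_def)
  have iV: "cst i V \<in> cs L V \<longleftrightarrow> (\<forall>Q\<in>V. i \<in> L Q)" for i
    using L.cs_cst[OF V(1)] cs_value(2)[OF V(1), of "cst i V"] by auto
  define \<nu> where "\<nu> i = frag_of (cst i V, cst g V)" for i :: "zxy fract"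
  have sub: "\<nu> i - \<nu> j - \<nu> (i - j) \<in> rel" if i: "\<forall>Q\<in>V. i \<in> L Q" and j: "\<forall>Q\<in>V. j \<in> L Q" for i j
  proof -
    have ij: "\<forall>Q\<in>V. i - j \<in> L Q" using i j Proj L.L_add[OF _ _ L.L_uminus] by fastforce
    have "\<nu> i - \<nu> (i - j) - \<nu> j \<in> gens"
      using gensI(1)[of "cst (i - j) V" "cst j V" "cst g V"] i j ij gV iV by (simp add: \<nu>_def)
    then show ?thesis using rel_gens by (simp add: algebra_simps)
  qed
  have normal: "\<exists>i. (\<forall>Q\<in>V. i \<in> L Q) \<and> x - \<nu> i \<in> rel" if "Poly_Mapping.keys x \<subseteq> tpairs V" for x
    using that
  proof (rule free_Abelian_group_induct)
    have z: "\<forall>Q\<in>V. 0 \<in> L Q" using L.L_0 Proj by blast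
    from sub[OF z z] show "\<exists>i. (\<forall>Q\<in>V. i \<in> L Q) \<and> 0 - \<nu> i \<in> rel"
      by (intro exI[of _ 0] conjI z) simp
  next
    fix x y assume "\<exists>i. (\<forall>Q\<in>V. i \<in> L Q) \<and> x - \<nu> i \<in> rel" "\<exists>i. (\<forall>Q\<in>V. i \<in> L Q) \<and> y - \<nu> i \<in> rel"
    then obtain i j where i: "\<forall>Q\<in>V. i \<in> L Q" "x - \<nu> i \<in> rel" and j: "\<forall>Q\<in>V. j \<in> L Q" "y - \<nu> j \<in> rel"
      by blast
    have "(x - \<nu> i) - (y - \<nu> j) + (\<nu> i - \<nu> j - \<nu> (i - j)) \<in> rel"
      by (intro rel_add rel_diff i j sub)
    then have "x - y - \<nu> (i - j) \<in> rel" by (simp add: algebra_simps)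
    moreover have "\<forall>Q\<in>V. i - j \<in> L Q" using i j Proj L.L_add[OF _ _ L.L_uminus] by fastforce
    ultimately show "\<exists>i. (\<forall>Q\<in>V. i \<in> L Q) \<and> x - y - \<nu> i \<in> rel" by blast
  next
    fix p assume "p \<in> tpairs V"
    then obtain s t where p: "p = (s, t)" "s \<in> cs L V" "t \<in> cs (loc b) V" by auto
    obtain i where i: "s = cst i V" "\<And>Q. Q \<in> V \<Longrightarrow> i \<in> L Q" using csE[OF V(1) p(2)] by metis
    obtain c where c: "t = cst c V" "\<And>Q. Q \<in> V \<Longrightarrow> c \<in> loc b Q" using csE[OF V(1) p(3)] by metis
    have r: "c / g \<in> loc 0 Q" if "Q \<in> V" for Q
      using loc_mult[OF Proj[OF that] c(2)[OF that], of "inverse g" "- b"] g[OF that]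
      by (simp add: loc_unit_def divide_inverse)
    have rV: "cst (c / g) V \<in> twist_sections 0 V"
      using r by (auto simp: twist_sections_eq_cs in_twist_iff[OF V(1)])
    have "frag_of (cst (c / g * i) V, cst g V) - frag_of p \<in> gens"
      using gensI(3)[of "cst (c / g) V" s "cst g V"] rV p i c gV g0 by simp
    then have "frag_of p - \<nu> (c / g * i) \<in> rel" using rel_minus[OF rel_gens] by (fastforce simp: \<nu>_def)
    moreover have "\<forall>Q\<in>V. c / g * i \<in> L Q" using L.L_sm Proj r i by blast
    ultimately show "\<exists>i. (\<forall>Q\<in>V. i \<in> L Q) \<and> frag_of p - \<nu> i \<in> rel" by blast
  qed
  have val: "i = mval x / g" if "x - \<nu> i \<in> rel" for x i
  proof -
    have "mval x = mval (\<nu> i)" using mval_rel[OF V that] by (simp add: mval_diff)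
    then show ?thesis using eta g0 by (simp add: \<nu>_def)
  qed
  obtain i where i: "a - \<nu> i \<in> rel" using normal[OF a] by blast
  obtain j where j: "a' - \<nu> j \<in> rel" using normal[OF a'] by blast
  have "i = j" using val[OF i] val[OF j] eq by simp
  then have "a - a' \<in> rel" using rel_diff[OF i j] by simp
  then show ?thesis by (simp add: cos_eq_iff)
qed

text \<open>Restriction acts on representatives by restricting both factors; if \<open>W\<close> is
  nonempty, it contains the generic point and the value there is untouched.\<close>

lemma Res_TP:
  assumes V: "openin Proj_topology V" and W: "openin Proj_topology W" "W \<subseteq> V"
    and a: "Poly_Mapping.keys a \<subseteq> tpairs V"
  shows "\<exists>a'. Res TP V W (tcos V a) = tcos W a' \<and> Poly_Mapping.keys a' \<subseteq> tpairs W \<and> (W \<noteq> {} \<longrightarrow> mval a' = mval a)"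
proof -
  let ?h = "\<lambda>(s, t). (Res FL V W s, Res FO V W t)"
  note pre = L.sheaf_latt klattice.sheaf_latt[OF klattice_loc, of b]
  have preL: "presheaf_of_modules P1Z FL" and preO: "presheaf_of_modules P1Z FO"
    using pre by (simp_all add: sheaf_of_modules_def)
  have oV: "is_open P1Z V" "is_open P1Z W" using V W by simp_all
  have res: "restrict r W \<in> twist_sections 0 W" if "r \<in> twist_sections 0 V" for r
    using presheaf_Res(1)[OF _ oV W(2), of "latt (loc 0) (*)" r] klattice.sheaf_latt[OF klattice_loc, of 0] that
    by (simp add: sheaf_of_modules_def twist_sections_eq_cs)
  have "Res TP V W (tcos V a) = tensor_map (ring_at P1Z W) (Sec FL W) (Sec FO W) ?h (tcos V a)"
    by (simp add: tensor_presheaf_def)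
  also have "\<dots> = tcos W (frag_map ?h a)"
    by (rule tensor_map_cos[OF tensor_pair[OF V] tensor_pair[OF W(1)],
          where f = "Res FL V W" and g = "Res FO V W" and \<rho> = "Res (Str P1Z) V W"])
      (use presheaf_Res[OF preL oV W(2)] presheaf_Res[OF preO oV W(2)] res in auto)
  finally have 1: "Res TP V W (tcos V a) = tcos W (frag_map ?h a)" .
  have 2: "Poly_Mapping.keys (frag_map ?h a) \<subseteq> tpairs W"
    by (rule keys_frag_map[OF a])
      (use presheaf_Res(1)[OF preL oV W(2)] presheaf_Res(1)[OF preO oV W(2)] in auto)
  have 3: "mval (frag_map ?h a) = mval a" if "W \<noteq> {}"
  proof -
    have eta: "eta \<in> W" using W(1) that eta_in_open by blast
    have "mval (frag_map ?h a) - mval a \<in> {0}"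
      by (rule frag_property[OF a]) (auto simp: mval_diff frag_extend_diff eta)
    then show ?thesis by simp
  qed
  show ?thesis using 1 2 3 by blast
qed

definition G :: "zxy set \<Rightarrow> zxy fract \<Rightarrow> (zxy set set \<times> (zxy_section \<times> zxy_section \<Rightarrow>\<^sub>0 int) set) set" where
  "G p v = {(V, t). openin Proj_topology V \<and> p \<in> V \<and> t \<in> carrier (Sec TP V) \<and> tval t = v}"

text \<open>Equal germs have equal values because restriction preserves values. Conversely, on a
  neighbourhood inside the chart of a coordinate that does not vanish at \<open>p\<close>, \<O>(b)
  has a generator and \<open>tcos_eq\<close> applies.\<close>

lemma germ_eq:
  assumes U: "openin Proj_topology U" "p \<in> U" and t: "t \<in> carrier (Sec TP U)"
  shows "germ Proj_topology TP p U t = G p (tval t)"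
proof -
  obtain a where a: "t = tcos U a" "Poly_Mapping.keys a \<subseteq> tpairs U" using t carrier_TP[OF U(1)] by blast
  have U0: "U \<noteq> {}" and pP: "p \<in> Proj_ZXY" using U open_Proj_subset by blast+
  have "(\<exists>W. openin Proj_topology W \<and> p \<in> W \<and> W \<subseteq> U \<inter> V \<and> Res TP U W t = Res TP V W t') \<longleftrightarrow> tval t' = tval t"
    if V: "openin Proj_topology V" "p \<in> V" and t': "t' \<in> carrier (Sec TP V)" for V t'
  proof -
    obtain a' where a': "t' = tcos V a'" "Poly_Mapping.keys a' \<subseteq> tpairs V" using t' carrier_TP[OF V(1)] by blast
    have V0: "V \<noteq> {}" using V by blast
    show ?thesis
    proof
      assume "\<exists>W. openin Proj_topology W \<and> p \<in> W \<and> W \<subseteq> U \<inter> V \<and> Res TP U W t = Res TP V W t'"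
      then obtain W where W: "openin Proj_topology W" "p \<in> W" "W \<subseteq> U" "W \<subseteq> V" "Res TP U W t = Res TP V W t'"
        by blast
      have W0: "W \<noteq> {}" using W by blast
      obtain x where x: "Res TP U W t = tcos W x" "mval x = mval a"
        using Res_TP[OF U(1) W(1,3) a(2)] W0 unfolding a(1) by blast
      obtain y where y: "Res TP V W t' = tcos W y" "mval y = mval a'"
        using Res_TP[OF V(1) W(1,4) a'(2)] W0 unfolding a'(1) by blast
      have "mval x = mval y" using W(5) x(1) y(1) tval_cos[OF W(1) W0] by metis
      then show "tval t' = tval t"
        using x y tval_cos[OF U(1) U0] tval_cos[OF V(1) V0] a a' by simp
    next
      assume eq: "tval t' = tval t"
      obtain z where z: "z \<in> {xx, yy}" "z \<notin> p" using Proj_coord[OF pP] by blast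
      have hz: "homogeneous (Suc 0) z" using z by auto
      define W where "W = U \<inter> V \<inter> Dplus z"
      have W: "openin Proj_topology W" "p \<in> W" "W \<subseteq> U" "W \<subseteq> V"
        using U V z pP openin_Dplus[OF hz] by (auto simp: W_def Dplus_def)
      have W0: "W \<noteq> {}" using W by blast
      have g: "loc_unit b Q (to_fract z powi b)" if "Q \<in> W" for Q
        using that z by (intro loc_unit_gen) (auto simp: W_def Dplus_def)
      obtain x where x: "Res TP U W t = tcos W x" "Poly_Mapping.keys x \<subseteq> tpairs W" "mval x = mval a"
        using Res_TP[OF U(1) W(1,3) a(2)] W0 unfolding a(1) by blast
      obtain y where y: "Res TP V W t' = tcos W y" "Poly_Mapping.keys y \<subseteq> tpairs W" "mval y = mval a'"
        using Res_TP[OF V(1) W(1,4) a'(2)] W0 unfolding a'(1) by blast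
      have "mval x = mval y"
        using x y eq tval_cos[OF U(1) U0] tval_cos[OF V(1) V0] a a' by simp
      then have "tcos W x = tcos W y" by (intro tcos_eq[OF W(1) W0 g x(2) y(2)])
      then show "\<exists>W. openin Proj_topology W \<and> p \<in> W \<and> W \<subseteq> U \<inter> V \<and> Res TP U W t = Res TP V W t'"
        using W x(1) y(1) by (intro exI[of _ W]) auto
    qed
  qed
  then show ?thesis unfolding germ_def G_def by blast
qed

lemma G_J: "(V, t) \<in> G p v \<Longrightarrow> Q \<in> V \<Longrightarrow> v \<in> J Q"
proof -
  assume "(V, t) \<in> G p v" and Q: "Q \<in> V"
  then have V: "openin Proj_topology V" "t \<in> carrier (Sec TP V)" "tval t = v" by (auto simp: G_def)
  then obtain a where a: "t = tcos V a" "Poly_Mapping.keys a \<subseteq> tpairs V" using carrier_TP by blast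
  have "V \<noteq> {}" using Q by blast
  then show "v \<in> J Q" using mval_J[OF V(1) a(2) Q] tval_cos[OF V(1)] V(3) a(1) by simp
qed

lemma G_ex:
  assumes p: "p \<in> Proj_ZXY" and v: "v \<in> J p" and U: "openin Proj_topology U" "p \<in> U"
  shows "\<exists>V t. V \<subseteq> U \<and> (V, t) \<in> G p v"
proof -
  obtain i c where ic: "v = i * c" "i \<in> L p" "c \<in> loc b p" using v by (auto simp: J_def)
  obtain A where A: "openin Proj_topology A" "p \<in> A" "\<forall>Q\<in>A. i \<in> L Q" using L.L_open[OF p ic(2)] by blast
  obtain B where B: "openin Proj_topology B" "p \<in> B" "\<forall>Q\<in>B. c \<in> loc b Q" using loc_open[OF p ic(3)] by blast
  define V where "V = U \<inter> A \<inter> B"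
  have V: "openin Proj_topology V" "p \<in> V" "V \<subseteq> U" using U A B by (auto simp: V_def)
  have V0: "V \<noteq> {}" using V by blast
  have k: "Poly_Mapping.keys (frag_of (cst i V, cst c V)) \<subseteq> tpairs V"
    using L.cs_cst[OF V(1), of i] klattice.cs_cst[OF klattice_loc V(1), of c b] A B
    by (auto simp: keys_frag_of V_def)
  have "(V, tcos V (frag_of (cst i V, cst c V))) \<in> G p v"
    unfolding G_def using V k carrier_TP[OF V(1)] tval_cos[OF V(1) V0] eta_in_open[OF V(1,2)] ic(1) by auto
  then show ?thesis using V by blast
qed

lemma G_inj: "p \<in> Proj_ZXY \<Longrightarrow> v \<in> J p \<Longrightarrow> G p v = G p w \<Longrightarrow> v = w"
proof -
  assume "p \<in> Proj_ZXY" "v \<in> J p" and eq: "G p v = G p w"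
  then obtain V t where "(V, t) \<in> G p v" using G_ex[of p v Proj_ZXY] openin_topspace[of Proj_topology]
    by (auto simp: topspace_Proj)
  then show "v = w" using eq by (auto simp: G_def)
qed

lemma Res_TP_tval:
  assumes V: "openin Proj_topology V" and W: "openin Proj_topology W" "W \<subseteq> V" "W \<noteq> {}"
    and t: "t \<in> carrier (Sec TP V)"
  obtains a where "Res TP V W t = tcos W a" "Poly_Mapping.keys a \<subseteq> tpairs W" "mval a = tval t"
proof -
  obtain x where x: "t = tcos V x" "Poly_Mapping.keys x \<subseteq> tpairs V" using t carrier_TP[OF V] by blast
  have "V \<noteq> {}" using W by blast
  then show ?thesis using Res_TP[OF V W(1,2) x(2)] W(3) x(1) tval_cos[OF V] that by metis
qed

lemma germ_add_G:
  assumes p: "p \<in> Proj_ZXY" and v: "v \<in> J p" and w: "w \<in> J p"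
  shows "germ_add Proj_topology TP p (G p v) (G p w) = G p (v + w)"
proof -
  have "germ Proj_topology TP p (U \<inter> V) (Res TP U (U \<inter> V) s \<oplus>\<^bsub>Sec TP (U \<inter> V)\<^esub> Res TP V (U \<inter> V) t) = G p (v + w)"
    if "(U, s) \<in> G p v" "(V, t) \<in> G p w" for U s V t
  proof -
    have U: "openin Proj_topology U" "p \<in> U" "s \<in> carrier (Sec TP U)" "tval s = v"
      and V: "openin Proj_topology V" "p \<in> V" "t \<in> carrier (Sec TP V)" "tval t = w"
      using that by (auto simp: G_def)
    have W: "openin Proj_topology (U \<inter> V)" "p \<in> U \<inter> V" "U \<inter> V \<noteq> {}" using U V by auto
    obtain a where a: "Res TP U (U \<inter> V) s = tcos (U \<inter> V) a" "Poly_Mapping.keys a \<subseteq> tpairs (U \<inter> V)" "mval a = v"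
      using Res_TP_tval[OF U(1) W(1) Int_lower1 W(3) U(3)] U(4) by metis
    obtain a' where a': "Res TP V (U \<inter> V) t = tcos (U \<inter> V) a'" "Poly_Mapping.keys a' \<subseteq> tpairs (U \<inter> V)" "mval a' = w"
      using Res_TP_tval[OF V(1) W(1) Int_lower2 W(3) V(3)] V(4) by metis
    have sum: "Res TP U (U \<inter> V) s \<oplus>\<^bsub>Sec TP (U \<inter> V)\<^esub> Res TP V (U \<inter> V) t = tcos (U \<inter> V) (a + a')"
      unfolding a a' Sec_TP by (rule tensor_pair.add_tensor[OF tensor_pair[OF W(1)]])
    have "Poly_Mapping.keys (a + a') \<subseteq> tpairs (U \<inter> V)" using keys_add[of a a'] a a' by blast
    then have "tcos (U \<inter> V) (a + a') \<in> carrier (Sec TP (U \<inter> V))" using carrier_TP[OF W(1)] by blast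
    from germ_eq[OF W(1,2) this] show ?thesis
      unfolding sum using tval_cos[OF W(1,3)] a a' by (simp add: mval_add)
  qed
  moreover obtain U s where "(U, s) \<in> G p v"
    using G_ex[OF p v, of Proj_ZXY] openin_topspace[of Proj_topology] p by (auto simp: topspace_Proj)
  moreover obtain V t where "(V, t) \<in> G p w"
    using G_ex[OF p w, of Proj_ZXY] openin_topspace[of Proj_topology] p by (auto simp: topspace_Proj)
  ultimately show ?thesis unfolding germ_add_def by (intro UN_pairs_const) auto
qed

lemma germ_smult_G:
  assumes p: "p \<in> Proj_ZXY" and v: "v \<in> J p" and U: "openin Proj_topology U" "p \<in> U"
    and r: "\<And>Q. Q \<in> U \<Longrightarrow> r \<in> loc 0 Q"
  shows "germ_smult P1Z TP p U (cst r U) (G p v) = G p (r * v)"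
proof -
  have "germ Proj_topology TP p (U \<inter> V) (Res (Str P1Z) U (U \<inter> V) (cst r U) \<odot>\<^bsub>Sec TP (U \<inter> V)\<^esub> Res TP V (U \<inter> V) t)
      = G p (r * v)" if "(V, t) \<in> G p v" for V t
  proof -
    have V: "openin Proj_topology V" "p \<in> V" "t \<in> carrier (Sec TP V)" "tval t = v" using that by (auto simp: G_def)
    define W where "W = U \<inter> V"
    have W: "openin Proj_topology W" "p \<in> W" "W \<noteq> {}" "W \<subseteq> V" "W \<subseteq> U" using U V by (auto simp: W_def)
    have eta: "eta \<in> W" by (rule eta_in_open[OF W(1,2)])
    obtain a where a: "Res TP V W t = tcos W a" "Poly_Mapping.keys a \<subseteq> tpairs W" "mval a = v"
      using Res_TP_tval[OF V(1) W(1,4,3) V(3)] V(4) by metis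
    let ?h = "\<lambda>(m, n). (cst r W \<odot>\<^bsub>Sec FL W\<^esub> m, n)"
    have rW: "cst r W \<in> carrier (ring_at P1Z W)"
      using klattice.cs_cst[OF klattice_loc W(1), of r 0] r W(5) by (auto simp: twist_sections_eq_cs)
    have prod: "cst r W \<odot>\<^bsub>Sec TP W\<^esub> Res TP V W t = tcos W (frag_map ?h a)"
      unfolding a Sec_TP by (rule smult_tensor[OF tensor_pair[OF W(1)] rW])
    have k: "Poly_Mapping.keys (frag_map ?h a) \<subseteq> tpairs W"
    proof (rule keys_frag_map[OF a(2)])
      have "cst r W \<odot>\<^bsub>Sec FL W\<^esub> m \<in> cs L W" if "m \<in> cs L W" for m
        using Module.module.smult_closed[OF L.module_latt[OF W(1)] rW, of m] that by simp
      then show "?h ` tpairs W \<subseteq> tpairs W" by auto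
    qed
    have "mval (frag_map ?h a) - r * mval a \<in> {0}"
      by (rule frag_property[OF a(2)]) (auto simp: mval_diff frag_extend_diff eta algebra_simps)
    then have m: "mval (frag_map ?h a) = r * v" using a by simp
    have "tcos W (frag_map ?h a) \<in> carrier (Sec TP W)" using carrier_TP[OF W(1)] k by blast
    from germ_eq[OF W(1,2) this]
    have "germ Proj_topology TP p W (cst r W \<odot>\<^bsub>Sec TP W\<^esub> Res TP V W t) = G p (r * v)"
      unfolding prod using tval_cos[OF W(1,3)] m by simp
    then show ?thesis using W(5) by (simp add: W_def)
  qed
  moreover obtain V t where "(V, t) \<in> G p v" using G_ex[OF p v U] by blast
  ultimately show ?thesis unfolding germ_smult_def is_open_P1Z by (intro UN_pairs_const) auto
qed

definition gsec :: "zxy set set \<Rightarrow> (zxy set \<Rightarrow> zxy fract) \<Rightarrow>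
    zxy set \<Rightarrow> (zxy set set \<times> (zxy_section \<times> zxy_section \<Rightarrow>\<^sub>0 int) set) set" where
  "gsec U s = (\<lambda>p\<in>U. G p (s p))"

abbreviation "TS \<equiv> tensor_sheaf P1Z FL FO"

lemma TS_simps:
  "s \<oplus>\<^bsub>Sec TS U\<^esub> t = (\<lambda>p\<in>U. germ_add Proj_topology TP p (s p) (t p))"
  "r \<odot>\<^bsub>Sec TS U\<^esub> s = (\<lambda>p\<in>U. germ_smult P1Z TP p U r (s p))"
  "\<zero>\<^bsub>Sec TS U\<^esub> = (\<lambda>p\<in>U. germ Proj_topology TP p U \<zero>\<^bsub>Sec TP U\<^esub>)"
  "Res TS U V s = restrict s V"
  by (simp_all add: tensor_sheaf_def sheafification_def)

text \<open>Near each point a section has a single value, and this value is visible in its germ at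
  the generic point, which lies in all these neighbourhoods; so one value serves for the whole of
  \<open>U\<close>.\<close>

lemma carrier_TS:
  assumes U: "openin Proj_topology U"
  shows "carrier (Sec TS U) = gsec U ` cs J U"
proof (intro equalityI subsetI)
  have UP: "U \<subseteq> Proj_ZXY" using U open_Proj_subset by blast
  fix s assume "s \<in> carrier (Sec TS U)"
  then have s: "s \<in> extensional U" "\<And>p. p \<in> U \<Longrightarrow> \<exists>V t. openin Proj_topology V \<and> p \<in> V \<and> V \<subseteq> U \<and>
      t \<in> carrier (Sec TP V) \<and> (\<forall>q\<in>V. s q = germ Proj_topology TP q V t)"
    by (auto simp: tensor_sheaf_def sheafification_def)
  have loc: "\<exists>v. (s eta = G eta v \<and> v \<in> J eta) \<and> s p = G p v \<and> v \<in> J p" if p: "p \<in> U" for p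
  proof -
    obtain V t where V: "openin Proj_topology V" "p \<in> V" "V \<subseteq> U" "t \<in> carrier (Sec TP V)"
        "\<forall>q\<in>V. s q = germ Proj_topology TP q V t"
      using s(2)[OF p] by blast
    have "s q = G q (tval t) \<and> tval t \<in> J q" if q: "q \<in> V" for q
    proof
      show "s q = G q (tval t)" using V(5) germ_eq[OF V(1) q V(4)] q by simp
      show "tval t \<in> J q" by (rule G_J[of V t q _ q]) (use V q in \<open>auto simp: G_def\<close>)
    qed
    then show ?thesis using V(2) eta_in_open[OF V(1,2)] by blast
  qed
  show "s \<in> gsec U ` cs J U"
  proof (cases "U = {}")
    case True
    then have "s = gsec U (cst 0 U)" using s(1) by (auto simp: gsec_def extensional_def fun_eq_iff)
    moreover have "cst 0 U \<in> cs J U" by (rule Jl.cs_cst[OF U]) (use True in auto)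
    ultimately show ?thesis by blast
  next
    case False
    then have "eta \<in> U" using U eta_in_open by blast
    then obtain v where v: "s eta = G eta v" "v \<in> J eta" using loc by blast
    have p: "s p = G p v \<and> v \<in> J p" if "p \<in> U" for p
      using loc[OF that] v G_inj[OF eta_in_Proj v(2)] by metis
    have "s = gsec U (cst v U)"
      unfolding gsec_def by (rule extensionalityI[OF s(1)]) (use p in auto)
    moreover have "cst v U \<in> cs J U" by (rule Jl.cs_cst[OF U]) (use p in blast)
    ultimately show ?thesis by blast
  qed
next
  fix s assume "s \<in> gsec U ` cs J U"
  then obtain v where v: "s = gsec U (cst v U)" "\<And>p. p \<in> U \<Longrightarrow> v \<in> J p" using csE[OF U] by blast
  have "\<exists>V t. openin Proj_topology V \<and> p \<in> V \<and> V \<subseteq> U \<and> t \<in> carrier (Sec TP V) \<and>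
      (\<forall>q\<in>V. s q = germ Proj_topology TP q V t)" if p: "p \<in> U" for p
  proof -
    have pP: "p \<in> Proj_ZXY" using p U open_Proj_subset by blast
    obtain V t where V: "V \<subseteq> U" "(V, t) \<in> G p v" using G_ex[OF pP v(2)[OF p] U p] by blast
    then have V': "openin Proj_topology V" "p \<in> V" "t \<in> carrier (Sec TP V)" "tval t = v" by (auto simp: G_def)
    have "s q = germ Proj_topology TP q V t" if "q \<in> V" for q
      using germ_eq[OF V'(1) that V'(3)] V'(4) v(1) that V(1) by (auto simp: gsec_def)
    then show ?thesis using V V' by blast
  qed
  then show "s \<in> carrier (Sec TS U)"
    by (simp add: tensor_sheaf_def sheafification_def v(1) gsec_def[of U] extensional_def)
qed

lemma iso_tensor_sheaf: "mod_isomorphism P1Z (latt J (*)) TS gsec"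
  unfolding mod_isomorphism_def
proof (intro conjI allI impI)
  show "mod_morphism P1Z (latt J (*)) TS gsec"
  proof (rule mod_morphismI)
    fix U s assume "is_open P1Z U" and s: "s \<in> carrier (Sec (latt J (*)) U)"
    then have U: "openin Proj_topology U" by simp
    have UP: "p \<in> Proj_ZXY" if "p \<in> U" for p using U open_Proj_subset that by blast
    show "gsec U s \<in> carrier (Sec TS U)" using s carrier_TS[OF U] by simp
    obtain v where v: "s = cst v U" "\<And>p. p \<in> U \<Longrightarrow> v \<in> J p" using csE[OF U] s by auto
    {
      fix t assume "t \<in> carrier (Sec (latt J (*)) U)"
      then obtain w where w: "t = cst w U" "\<And>p. p \<in> U \<Longrightarrow> w \<in> J p" using csE[OF U] by auto
      show "gsec U (s \<oplus>\<^bsub>Sec (latt J (*)) U\<^esub> t) = gsec U s \<oplus>\<^bsub>Sec TS U\<^esub> gsec U t"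
        unfolding TS_simps v(1) w(1) gsec_def
        by (rule restrict_ext) (use germ_add_G[OF UP v(2) w(2)] in simp)
    next
      fix r assume "r \<in> carrier (ring_at P1Z U)"
      then obtain \<rho> where r: "r = cst \<rho> U" "\<And>Q. Q \<in> U \<Longrightarrow> \<rho> \<in> loc 0 Q"
        using csE[OF U] by (auto simp: twist_sections_eq_cs)
      show "gsec U (r \<odot>\<^bsub>Sec (latt J (*)) U\<^esub> s) = r \<odot>\<^bsub>Sec TS U\<^esub> gsec U s"
        unfolding TS_simps v(1) r(1) gsec_def
        by (rule restrict_ext) (use germ_smult_G[OF UP v(2) U _ r(2)] in simp)
    next
      fix V assume "is_open P1Z V" "V \<subseteq> U"
      then show "Res TS U V (gsec U s) = gsec V (Res (latt J (*)) U V s)"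
        unfolding TS_simps latt_simps gsec_def by (auto simp: fun_eq_iff restrict_def)
    }
  qed
  fix U assume "is_open P1Z U"
  then have U: "openin Proj_topology U" by simp
  have "inj_on (gsec U) (cs J U)"
  proof (rule inj_onI)
    fix s t assume s: "s \<in> cs J U" and t: "t \<in> cs J U" and eq: "gsec U s = gsec U t"
    show "s = t"
    proof (rule extensionalityI[of _ U])
      fix p assume p: "p \<in> U"
      have pP: "p \<in> Proj_ZXY" using p U open_Proj_subset by blast
      have "G p (s p) = G p (t p)" using fun_cong[OF eq, of p] p by (simp add: gsec_def)
      then show "s p = t p" using G_inj[OF pP cs_value(2)[OF U s p]] by blast
    qed (use s t in \<open>auto simp: cs_def\<close>)
  qed
  then show "bij_betw (gsec U) (carrier (Sec (latt J (*)) U)) (carrier (Sec TS U))"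
    by (simp add: bij_betw_def carrier_TS[OF U])
qed

lemma gsec_zero:
  assumes U: "openin Proj_topology U"
  shows "gsec U \<zero>\<^bsub>Sec (latt J (*)) U\<^esub> = \<zero>\<^bsub>Sec TS U\<^esub>"
proof -
  have "germ Proj_topology TP p U \<zero>\<^bsub>Sec TP U\<^esub> = G p 0" if p: "p \<in> U" for p
  proof -
    have U0: "U \<noteq> {}" using p by blast
    have z: "\<zero>\<^bsub>Sec TP U\<^esub> = tcos U 0"
      unfolding Sec_TP by (rule tensor_pair.zero_tensor[OF tensor_pair[OF U]])
    have "tcos U 0 \<in> carrier (Sec TP U)" using carrier_TP[OF U] by auto
    from germ_eq[OF U p this] show ?thesis unfolding z using tval_cos[OF U U0] by simp
  qed
  then show ?thesis unfolding TS_simps gsec_def latt_simps by (intro restrict_ext) simp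
qed

end

section \<open>Ideals with a Koszul presentation\<close>

text \<open>A model of the stalk inside the ambient field. The ring axioms are immediate here and
  are carried over to germs along \<open>stalk_elem\<close>.\<close>

definition local_ring :: "zxy set \<Rightarrow> zxy fract ring" where
  "local_ring P = \<lparr>carrier = loc 0 P, monoid.mult = (*), one = 1, ring.zero = 0, add = (+)\<rparr>"

lemma local_ring_simps [simp]:
  "carrier (local_ring P) = loc 0 P" "x \<otimes>\<^bsub>local_ring P\<^esub> y = x * y" "x \<oplus>\<^bsub>local_ring P\<^esub> y = x + y"
  "\<one>\<^bsub>local_ring P\<^esub> = 1" "\<zero>\<^bsub>local_ring P\<^esub> = 0"
  by (simp_all add: local_ring_def)

lemma cring_local_ring: assumes P: "P \<in> Proj_ZXY" shows "cring (local_ring P)"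
proof (rule cringI)
  show "abelian_group (local_ring P)"
  proof (rule abelian_groupI)
    fix x assume "x \<in> carrier (local_ring P)"
    then show "\<exists>y\<in>carrier (local_ring P). y \<oplus>\<^bsub>local_ring P\<^esub> x = \<zero>\<^bsub>local_ring P\<^esub>"
      by (intro bexI[of _ "- x"]) (auto intro: loc_uminus)
  qed (auto simp: ac_simps loc_add[OF P] loc_0[OF P])
  show "Group.comm_monoid (local_ring P)"
    by (rule comm_monoidI) (auto simp: ac_simps loc_mult0[OF P] loc_1[OF P])
qed (auto simp: algebra_simps)

definition stalk_elem :: "zxy set \<Rightarrow> zxy fract \<Rightarrow> (zxy set set \<times> zxy_section) set" where
  "stalk_elem P v = {(V, t). openin Proj_topology V \<and> P \<in> V \<and> t \<in> twist_sections 0 V \<and> t eta = v}"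

lemma germ_Str_eq:
  assumes U: "openin Proj_topology U" "P \<in> U" and t: "t \<in> twist_sections 0 U"
  shows "germ Proj_topology (Str P1Z) P U t = stalk_elem P (t eta)"
proof -
  have "(\<exists>W. openin Proj_topology W \<and> P \<in> W \<and> W \<subseteq> U \<inter> V \<and> restrict t W = restrict t' W) \<longleftrightarrow> t' eta = t eta"
    if V: "openin Proj_topology V" "P \<in> V" and t': "t' \<in> twist_sections 0 V" for V t'
  proof
    assume "\<exists>W. openin Proj_topology W \<and> P \<in> W \<and> W \<subseteq> U \<inter> V \<and> restrict t W = restrict t' W"
    then obtain W where W: "openin Proj_topology W" "P \<in> W" "restrict t W = restrict t' W" by blast
    have "eta \<in> W" using eta_in_open[OF W(1,2)] .
    then show "t' eta = t eta" using fun_cong[OF W(3), of eta] by simp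
  next
    assume eq: "t' eta = t eta"
    have "t Q = t' Q" if "Q \<in> U \<inter> V" for Q
      using cs_value(1)[OF U(1), of t "loc 0" Q] cs_value(1)[OF V(1), of t' "loc 0" Q] t t' eq that
      by (simp add: twist_sections_eq_cs)
    then have "restrict t (U \<inter> V) = restrict t' (U \<inter> V)" by (auto simp: fun_eq_iff restrict_def)
    then show "\<exists>W. openin Proj_topology W \<and> P \<in> W \<and> W \<subseteq> U \<inter> V \<and> restrict t W = restrict t' W"
      using U V by (intro exI[of _ "U \<inter> V"]) auto
  qed
  then show ?thesis unfolding germ_def stalk_elem_def by auto
qed

lemma cst_twist: "openin Proj_topology U \<Longrightarrow> (\<And>Q. Q \<in> U \<Longrightarrow> v \<in> loc n Q) \<Longrightarrow> cst v U \<in> twist_sections n U"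
  unfolding twist_sections_eq_cs by (rule klattice.cs_cst[OF klattice_loc])

lemma stalk_elem_ex:
  assumes P: "P \<in> Proj_ZXY" and v: "v \<in> loc 0 P"
  shows "\<exists>V. (V, cst v V) \<in> stalk_elem P v"
proof -
  obtain V where V: "openin Proj_topology V" "P \<in> V" "\<forall>Q\<in>V. v \<in> loc 0 Q" using loc_open[OF P v] by blast
  then show ?thesis using cst_twist[OF V(1)] eta_in_open[OF V(1,2)] by (auto simp: stalk_elem_def)
qed

lemma stalk_elem_loc: "(V, t) \<in> stalk_elem P v \<Longrightarrow> Q \<in> V \<Longrightarrow> t Q = v \<and> v \<in> loc 0 Q"
  using cs_value[of V t "loc 0" Q] by (auto simp: stalk_elem_def twist_sections_eq_cs)

lemma stalk_elem_inj: "P \<in> Proj_ZXY \<Longrightarrow> v \<in> loc 0 P \<Longrightarrow> stalk_elem P v = stalk_elem P w \<Longrightarrow> v = w"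
proof -
  assume "P \<in> Proj_ZXY" "v \<in> loc 0 P" and eq: "stalk_elem P v = stalk_elem P w"
  then obtain V where V: "(V, cst v V) \<in> stalk_elem P v" using stalk_elem_ex by blast
  then have V': "(V, cst v V) \<in> stalk_elem P w" using eq by simp
  have "cst v V eta = v" using V unfolding stalk_elem_def by simp
  moreover have "cst v V eta = w" using V' unfolding stalk_elem_def by simp
  ultimately show "v = w" by simp
qed

lemma stalk_ring_carrier:
  assumes P: "P \<in> Proj_ZXY"
  shows "carrier (stalk_ring P1Z P) = stalk_elem P ` loc 0 P"
proof (intro equalityI subsetI)
  fix x assume "x \<in> carrier (stalk_ring P1Z P)"
  then obtain U s where U: "openin Proj_topology U" "P \<in> U" "s \<in> twist_sections 0 U"
    "x = germ Proj_topology (Str P1Z) P U s" by (auto simp: stalk_ring_def)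
  moreover have "s eta \<in> loc 0 P"
    using cs_value[OF U(1) _ U(2), of s "loc 0"] U(3) by (simp add: twist_sections_eq_cs)
  ultimately show "x \<in> stalk_elem P ` loc 0 P" using germ_Str_eq by auto
next
  fix x assume "x \<in> stalk_elem P ` loc 0 P"
  then obtain v where v: "v \<in> loc 0 P" "x = stalk_elem P v" by blast
  obtain V where "(V, cst v V) \<in> stalk_elem P v" using stalk_elem_ex[OF P v(1)] by blast
  then have V: "openin Proj_topology V" "P \<in> V" "cst v V \<in> twist_sections 0 V" "cst v V eta = v"
    by (auto simp: stalk_elem_def)
  then have "x = germ Proj_topology (Str P1Z) P V (cst v V)" using germ_Str_eq[OF V(1-3)] v by simp
  then show "x \<in> carrier (stalk_ring P1Z P)" using V by (auto simp: stalk_ring_def)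
qed

lemma stalk_ring_ops:
  assumes P: "P \<in> Proj_ZXY" and v: "v \<in> loc 0 P" and w: "w \<in> loc 0 P"
  shows "stalk_elem P v \<oplus>\<^bsub>stalk_ring P1Z P\<^esub> stalk_elem P w = stalk_elem P (v + w)"
    "stalk_elem P v \<otimes>\<^bsub>stalk_ring P1Z P\<^esub> stalk_elem P w = stalk_elem P (v * w)"
proof -
  note nonempty = stalk_elem_ex[OF P v] stalk_elem_ex[OF P w]
  \<comment> \<open>One argument serves for sums and products: representatives of the two germs are
    constant with values \<open>v\<close> and \<open>w\<close>, so the result is constant with value
    \<open>f v w\<close>.\<close>
  have *: "germ Proj_topology (Str P1Z) P (U \<inter> V) (\<lambda>Q\<in>U \<inter> V. f (restrict s (U \<inter> V) Q) (restrict t (U \<inter> V) Q))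
      = stalk_elem P (f v w)"
    if st: "(U, s) \<in> stalk_elem P v" "(V, t) \<in> stalk_elem P w"
      and f: "\<And>Q a b. Q \<in> Proj_ZXY \<Longrightarrow> a \<in> loc 0 Q \<Longrightarrow> b \<in> loc 0 Q \<Longrightarrow> f a b \<in> loc 0 Q" for f U s V t
  proof -
    have UV: "openin Proj_topology (U \<inter> V)" "P \<in> U \<inter> V" using st by (auto simp: stalk_elem_def)
    have eq: "(\<lambda>Q\<in>U \<inter> V. f (restrict s (U \<inter> V) Q) (restrict t (U \<inter> V) Q)) = cst (f v w) (U \<inter> V)"
      unfolding cst_def using stalk_elem_loc[OF st(1)] stalk_elem_loc[OF st(2)] by (intro restrict_ext) simp
    have "cst (f v w) (U \<inter> V) \<in> twist_sections 0 (U \<inter> V)"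
      using f stalk_elem_loc[OF st(1)] stalk_elem_loc[OF st(2)] open_Proj_subset[OF UV(1)]
      by (intro cst_twist[OF UV(1)]) blast
    from germ_Str_eq[OF UV this] show ?thesis unfolding eq using eta_in_open[OF UV] by simp
  qed
  show "stalk_elem P v \<oplus>\<^bsub>stalk_ring P1Z P\<^esub> stalk_elem P w = stalk_elem P (v + w)"
    unfolding stalk_ring_def ring_record_simps germ_add_def is_open_P1Z ring_at_P1Z Res_Str_P1Z
    using nonempty by (intro UN_pairs_const *) (auto intro: loc_add)
  show "stalk_elem P v \<otimes>\<^bsub>stalk_ring P1Z P\<^esub> stalk_elem P w = stalk_elem P (v * w)"
    unfolding stalk_ring_def monoid.simps germ_mult_def is_open_P1Z ring_at_P1Z Res_Str_P1Z
    using nonempty by (intro UN_pairs_const *) (auto intro: loc_mult0)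
qed

lemma stalk_ring_consts:
  assumes P: "P \<in> Proj_ZXY"
  shows "\<one>\<^bsub>stalk_ring P1Z P\<^esub> = stalk_elem P 1" "\<zero>\<^bsub>stalk_ring P1Z P\<^esub> = stalk_elem P 0"
proof -
  have o: "openin Proj_topology Proj_ZXY" using openin_topspace[of Proj_topology] by (simp add: topspace_Proj)
  have "cst 1 Proj_ZXY \<in> twist_sections 0 Proj_ZXY" "cst 0 Proj_ZXY \<in> twist_sections 0 Proj_ZXY"
    by (auto intro!: cst_twist[OF o] loc_1 loc_0)
  then show "\<one>\<^bsub>stalk_ring P1Z P\<^esub> = stalk_elem P 1" "\<zero>\<^bsub>stalk_ring P1Z P\<^esub> = stalk_elem P 0"
    using germ_Str_eq[OF o P] eta_in_Proj by (simp_all add: stalk_ring_def topspace_Proj)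
qed

lemma cring_stalk: assumes P: "P \<in> Proj_ZXY" shows "cring (stalk_ring P1Z P)"
proof -
  interpret R: cring "local_ring P" by (rule cring_local_ring[OF P])
  have iso: "stalk_elem P \<in> ring_iso (local_ring P) (stalk_ring P1Z P)"
    unfolding ring_iso_def
  proof (intro CollectI conjI ring_hom_memI)
    show "bij_betw (stalk_elem P) (carrier (local_ring P)) (carrier (stalk_ring P1Z P))"
      using stalk_elem_inj[OF P] by (auto simp: bij_betw_def stalk_ring_carrier[OF P] intro: inj_onI)
  qed (auto simp: stalk_ring_ops[OF P] stalk_ring_consts[OF P] stalk_ring_carrier[OF P])
  have "cring (stalk_ring P1Z P\<lparr>zero := \<zero>\<^bsub>stalk_ring P1Z P\<^esub>\<rparr>)"
    using R.ring_iso_imp_img_cring[OF iso] stalk_ring_consts(2)[OF P] by simp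
  then show ?thesis by (simp add: stalk_ring_def)
qed

lemma ideal_stalk_ring:
  assumes P: "P \<in> Proj_ZXY" and I: "I \<subseteq> loc 0 P" "0 \<in> I" "\<And>x y. x \<in> I \<Longrightarrow> y \<in> I \<Longrightarrow> x + y \<in> I"
    "\<And>r x. r \<in> loc 0 P \<Longrightarrow> x \<in> I \<Longrightarrow> r * x \<in> I"
  shows "ideal (stalk_elem P ` I) (stalk_ring P1Z P)"
proof -
  interpret cring "stalk_ring P1Z P" by (rule cring_stalk[OF P])
  show ?thesis
  proof (rule idealI)
    show "ring (stalk_ring P1Z P)" by (rule ring_axioms)
    show "subgroup (stalk_elem P ` I) (add_monoid (stalk_ring P1Z P))"
    proof (rule group.subgroupI[OF a_group])
      show "stalk_elem P ` I \<subseteq> carrier (add_monoid (stalk_ring P1Z P))"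
        using I(1) by (auto simp: stalk_ring_carrier[OF P])
      show "stalk_elem P ` I \<noteq> {}" using I(2) by auto
      fix x assume "x \<in> stalk_elem P ` I"
      then obtain v where v: "v \<in> I" "x = stalk_elem P v" by blast
      have mv: "- v \<in> I" using I(4)[OF loc_uminus[OF loc_1[OF P]] v(1)] by simp
      have "inv\<^bsub>add_monoid (stalk_ring P1Z P)\<^esub> x = stalk_elem P (- v)"
        unfolding v(2)
      proof (rule group.inv_equality[OF a_group])
        have l: "- v \<in> loc 0 P" "v \<in> loc 0 P" using v(1) mv I(1) by auto
        show "stalk_elem P (- v) \<otimes>\<^bsub>add_monoid (stalk_ring P1Z P)\<^esub> stalk_elem P v = \<one>\<^bsub>add_monoid (stalk_ring P1Z P)\<^esub>"
          using stalk_ring_ops(1)[OF P l] stalk_ring_consts(2)[OF P] by simp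
        show "stalk_elem P v \<in> carrier (add_monoid (stalk_ring P1Z P))"
          "stalk_elem P (- v) \<in> carrier (add_monoid (stalk_ring P1Z P))"
          using l by (simp_all add: stalk_ring_carrier[OF P])
      qed
      then show "inv\<^bsub>add_monoid (stalk_ring P1Z P)\<^esub> x \<in> stalk_elem P ` I" using mv by simp
      fix y assume "y \<in> stalk_elem P ` I"
      then obtain w where w: "w \<in> I" "y = stalk_elem P w" by blast
      show "x \<otimes>\<^bsub>add_monoid (stalk_ring P1Z P)\<^esub> y \<in> stalk_elem P ` I"
      proof -
        have "v \<in> loc 0 P" "w \<in> loc 0 P" using v(1) w(1) I(1) by auto
        from stalk_ring_ops(1)[OF P this] show ?thesis
          using I(3)[OF v(1) w(1)] unfolding v(2) w(2) by simp
      qed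
    qed
    fix x r assume "x \<in> stalk_elem P ` I" and "r \<in> carrier (stalk_ring P1Z P)"
    then obtain v \<rho> where v: "v \<in> I" "x = stalk_elem P v" "v \<in> loc 0 P" and r: "\<rho> \<in> loc 0 P" "r = stalk_elem P \<rho>"
      using I(1) unfolding stalk_ring_carrier[OF P] by blast
    show "r \<otimes>\<^bsub>stalk_ring P1Z P\<^esub> x \<in> stalk_elem P ` I"
      unfolding v(2) r(2) stalk_ring_ops(2)[OF P r(1) v(3)] using I(4)[OF r(1) v(1)] by simp
    show "x \<otimes>\<^bsub>stalk_ring P1Z P\<^esub> r \<in> stalk_elem P ` I"
      unfolding v(2) r(2) stalk_ring_ops(2)[OF P v(3) r(1)] using I(4)[OF r(1) v(1)] by (simp add: mult.commute)
  qed
qed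

section \<open>Koszul presentations and local complete intersections\<close>

text \<open>Locally there are two generators whose only relations are the multiples of the Koszul
  relation. At points of the subscheme this amounts to regularity of the sequence \<open>f\<close>,
  \<open>g\<close>, but it also makes sense where the ideal is the unit ideal.\<close>

locale koszul_ideal = klattice L "(*)" for L +
  assumes L_loc: "P \<in> Proj_ZXY \<Longrightarrow> L P \<subseteq> loc 0 P"
    and gen: "P \<in> Proj_ZXY \<Longrightarrow> \<exists>U f g. openin Proj_topology U \<and> P \<in> U \<and> (f \<noteq> 0 \<or> g \<noteq> 0) \<and>
      (\<forall>Q\<in>U. L Q = {f * x + g * y | x y. x \<in> loc 0 Q \<and> y \<in> loc 0 Q} \<and>
        (\<forall>x\<in>loc 0 Q. \<forall>y\<in>loc 0 Q. f * x + g * y = 0 \<longrightarrow> (\<exists>r\<in>loc 0 Q. x = r * g \<and> y = - r * f)))"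
begin

lemma ideal_sections:
  assumes U: "openin Proj_topology U" shows "ideal (cs L U) (ring_at P1Z U)"
proof -
  interpret R: cring "ring_at P1Z U" by (rule cring_P1Z[OF U])
  have Proj: "Q \<in> Proj_ZXY" if "Q \<in> U" for Q using U open_Proj_subset that by blast
  have sub: "cs L U \<subseteq> twist_sections 0 U"
  proof
    fix s assume "s \<in> cs L U"
    then obtain v where "s = cst v U" "\<And>Q. Q \<in> U \<Longrightarrow> v \<in> L Q" using csE[OF U] by metis
    then show "s \<in> twist_sections 0 U" using L_loc Proj by (auto intro!: cst_twist[OF U])
  qed
  show ?thesis
  proof (rule idealI)
    show "ring (ring_at P1Z U)" by (rule R.ring_axioms)
    show "subgroup (cs L U) (add_monoid (ring_at P1Z U))"
    proof (rule group.subgroupI[OF R.a_group])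
      show "cs L U \<subseteq> carrier (add_monoid (ring_at P1Z U))" using sub by simp
      show "cs L U \<noteq> {}" using cs_cst[OF U, of 0] L_0 Proj by blast
      fix s assume s: "s \<in> cs L U"
      then obtain v where v: "s = cst v U" "\<And>Q. Q \<in> U \<Longrightarrow> v \<in> L Q" using csE[OF U] by metis
      have mv: "cst (- v) U \<in> cs L U" using v(2) L_uminus Proj by (intro cs_cst[OF U]) auto
      have "inv\<^bsub>add_monoid (ring_at P1Z U)\<^esub> s = cst (- v) U"
        using s mv sub by (intro group.inv_equality[OF R.a_group]) (auto simp: v(1))
      then show "inv\<^bsub>add_monoid (ring_at P1Z U)\<^esub> s \<in> cs L U" using mv by simp
      fix t assume "t \<in> cs L U"
      then obtain w where w: "t = cst w U" "\<And>Q. Q \<in> U \<Longrightarrow> w \<in> L Q" using csE[OF U] by metis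
      have "cst (v + w) U \<in> cs L U" using v(2) w(2) L_add Proj by (intro cs_cst[OF U]) auto
      then show "s \<otimes>\<^bsub>add_monoid (ring_at P1Z U)\<^esub> t \<in> cs L U" by (simp add: v(1) w(1))
    qed
    fix s r assume "s \<in> cs L U" "r \<in> carrier (ring_at P1Z U)"
    then obtain v \<rho> where v: "s = cst v U" "\<And>Q. Q \<in> U \<Longrightarrow> v \<in> L Q" and r: "r = cst \<rho> U" "\<And>Q. Q \<in> U \<Longrightarrow> \<rho> \<in> loc 0 Q"
      using csE[OF U] unfolding ring_at_P1Z twist_sections_eq_cs by metis
    have "cst (\<rho> * v) U \<in> cs L U" using v(2) r(2) L_sm Proj by (intro cs_cst[OF U]) auto
    then show "r \<otimes>\<^bsub>ring_at P1Z U\<^esub> s \<in> cs L U" "s \<otimes>\<^bsub>ring_at P1Z U\<^esub> r \<in> cs L U"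
      by (simp_all add: v(1) r(1) mult.commute)
  qed
qed

lemma ideal_stalk_eq:
  assumes P: "P \<in> Proj_ZXY" shows "ideal_stalk P1Z (cs L) P = stalk_elem P ` L P"
proof (intro equalityI subsetI)
  fix x assume "x \<in> ideal_stalk P1Z (cs L) P"
  then obtain U s where U: "openin Proj_topology U" "P \<in> U" "s \<in> cs L U"
    "x = germ Proj_topology (Str P1Z) P U s" by (auto simp: ideal_stalk_def)
  have "s \<in> twist_sections 0 U"
    using ideal.Icarr[OF ideal_sections[OF U(1)] U(3)] by simp
  then have "x = stalk_elem P (s eta)" using germ_Str_eq[OF U(1,2)] U(4) by simp
  moreover have "s eta \<in> L P" using cs_value[OF U(1,3,2)] by simp
  ultimately show "x \<in> stalk_elem P ` L P" by blast
next
  fix x assume "x \<in> stalk_elem P ` L P"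
  then obtain v where v: "v \<in> L P" "x = stalk_elem P v" by blast
  obtain V where V: "openin Proj_topology V" "P \<in> V" "\<forall>Q\<in>V. v \<in> L Q" using L_open[OF P v(1)] by blast
  have s: "cst v V \<in> cs L V" by (rule cs_cst[OF V(1)]) (use V in blast)
  have "cst v V \<in> twist_sections 0 V" using ideal.Icarr[OF ideal_sections[OF V(1)] s] by simp
  then have "x = germ Proj_topology (Str P1Z) P V (cst v V)"
    using germ_Str_eq[OF V(1,2)] eta_in_open[OF V(1,2)] v(2) by simp
  then show "x \<in> ideal_stalk P1Z (cs L) P" unfolding ideal_stalk_def using V s by auto
qed

text \<open>The Koszul complex as a presentation with two generators and the one relation
  \<open>(g, - f)\<close>. The labels \<open>k\<close>, \<open>j1\<close>, \<open>j2\<close> are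
  kept arbitrary because the definition of quasi-coherence prescribes the types of the index
  sets.\<close>

lemma presentation:
  assumes U: "openin Proj_topology U" and fg: "f \<noteq> 0 \<or> g \<noteq> 0"
    and LU: "\<And>Q. Q \<in> U \<Longrightarrow> L Q = {f * x + g * y | x y. x \<in> loc 0 Q \<and> y \<in> loc 0 Q}"
    and syz: "\<And>Q x y. Q \<in> U \<Longrightarrow> x \<in> loc 0 Q \<Longrightarrow> y \<in> loc 0 Q \<Longrightarrow> f * x + g * y = 0 \<Longrightarrow>
      \<exists>r\<in>loc 0 Q. x = r * g \<and> y = - r * f"
    and jj: "j1 \<noteq> j2"
  shows "right_exact_seq (open_subspace P1Z U)
    (free_sheaf (open_subspace P1Z U) {k}) (free_sheaf (open_subspace P1Z U) {j1, j2}) (latt L (*))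
    (\<lambda>V c. \<lambda>j\<in>{j1, j2}. \<lambda>P\<in>V. (if j = j1 then g else - f) * c k P)
    (\<lambda>V d. \<lambda>P\<in>V. f * d j1 P + g * d j2 P)"
proof -
  let ?X = "open_subspace P1Z U" and ?J = "{j1, j2}"
  let ?\<phi> = "\<lambda>V c. \<lambda>j\<in>?J. \<lambda>P\<in>V. (if j = j1 then g else - f) * c k P"
  let ?\<psi> = "\<lambda>V d. \<lambda>P\<in>V. f * d j1 P + g * d j2 P"
  note os = open_subspace_simps[OF U] and ops = free_sheaf_ops[OF U]
  have Proj: "Q \<in> Proj_ZXY" if "Q \<in> U" for Q using U open_Proj_subset that by blast
  have fgL: "f \<in> L Q" "g \<in> L Q" if "Q \<in> U" for Q
    unfolding LU[OF that] using loc_0[OF Proj[OF that]] loc_1[OF Proj[OF that]]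
    by (force intro: exI[of _ 0] exI[of _ 1])+
  have fgloc: "f \<in> loc 0 Q" "g \<in> loc 0 Q" if "Q \<in> U" for Q
    using fgL[OF that] L_loc[OF Proj[OF that]] by auto
  have car1: "c \<in> carrier (Sec (free_sheaf ?X {k}) V) \<longleftrightarrow> (\<exists>x. c = (\<lambda>j\<in>{k}. cst x V) \<and> (\<forall>Q\<in>V. x \<in> loc 0 Q))"
    if V: "openin Proj_topology V" "V \<subseteq> U" for V c
  proof
    assume "c \<in> carrier (Sec (free_sheaf ?X {k}) V)"
    then have c: "c \<in> {k} \<rightarrow>\<^sub>E twist_sections 0 V" using free_sheaf_carrier[OF U _ V, of "{k}"] by simp
    then have "c k \<in> cs (loc 0) V" using PiE_mem[OF c, of k] by (simp add: twist_sections_eq_cs)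
    then obtain x where x: "c k = cst x V" "\<And>Q. Q \<in> V \<Longrightarrow> x \<in> loc 0 Q" using csE[OF V(1)] by metis
    have "c = (\<lambda>j\<in>{k}. cst x V)"
      by (rule extensionalityI[of _ "{k}"]) (use c x in \<open>auto simp: PiE_def\<close>)
    then show "\<exists>x. c = (\<lambda>j\<in>{k}. cst x V) \<and> (\<forall>Q\<in>V. x \<in> loc 0 Q)" using x by blast
  next
    assume "\<exists>x. c = (\<lambda>j\<in>{k}. cst x V) \<and> (\<forall>Q\<in>V. x \<in> loc 0 Q)"
    then obtain x where "c = (\<lambda>j\<in>{k}. cst x V)" "\<And>Q. Q \<in> V \<Longrightarrow> x \<in> loc 0 Q" by blast
    then show "c \<in> carrier (Sec (free_sheaf ?X {k}) V)"
      using cst_twist[OF V(1), of x 0] free_sheaf_carrier[OF U _ V, of "{k}"] by simp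
  qed
  define pr where "pr x y V = (\<lambda>j\<in>?J. cst (if j = j1 then x else y) V)" for x y :: "zxy fract" and V
  have car2: "d \<in> carrier (Sec (free_sheaf ?X ?J) V) \<longleftrightarrow>
      (\<exists>x y. d = pr x y V \<and> (\<forall>Q\<in>V. x \<in> loc 0 Q \<and> y \<in> loc 0 Q))"
    if V: "openin Proj_topology V" "V \<subseteq> U" for V d
  proof
    assume "d \<in> carrier (Sec (free_sheaf ?X ?J) V)"
    then have d: "d \<in> ?J \<rightarrow>\<^sub>E twist_sections 0 V" using free_sheaf_carrier[OF U _ V, of ?J] by simp
    have "d j1 \<in> cs (loc 0) V" "d j2 \<in> cs (loc 0) V"
      using PiE_mem[OF d, of j1] PiE_mem[OF d, of j2] by (simp_all add: twist_sections_eq_cs)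
    then obtain x y where x: "d j1 = cst x V" "\<forall>Q\<in>V. x \<in> loc 0 Q" and y: "d j2 = cst y V" "\<forall>Q\<in>V. y \<in> loc 0 Q"
      using csE[OF V(1)] by metis
    have "d = pr x y V"
      unfolding pr_def by (rule extensionalityI[of _ ?J]) (use d x y jj in \<open>auto simp: PiE_def\<close>)
    then show "\<exists>x y. d = pr x y V \<and> (\<forall>Q\<in>V. x \<in> loc 0 Q \<and> y \<in> loc 0 Q)" using x y by blast
  next
    assume "\<exists>x y. d = pr x y V \<and> (\<forall>Q\<in>V. x \<in> loc 0 Q \<and> y \<in> loc 0 Q)"
    then obtain x y where "d = pr x y V" "\<And>Q. Q \<in> V \<Longrightarrow> x \<in> loc 0 Q" "\<And>Q. Q \<in> V \<Longrightarrow> y \<in> loc 0 Q" by blast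
    then show "d \<in> carrier (Sec (free_sheaf ?X ?J) V)"
      using cst_twist[OF V(1), of x 0] cst_twist[OF V(1), of y 0] free_sheaf_carrier[OF U _ V, of ?J]
      by (simp add: pr_def)
  qed
  have \<phi>_cst: "?\<phi> V (\<lambda>j\<in>{k}. cst x V) = pr (g * x) (- f * x) V" for x V
    unfolding pr_def by (rule restrict_ext) (auto simp: cst_def fun_eq_iff)
  have \<psi>_pr: "?\<psi> V (pr x y V) = cst (f * x + g * y) V" for x y V
    unfolding pr_def using jj by (auto simp: cst_def fun_eq_iff)
  have inL: "f * x + g * y \<in> L Q" if "Q \<in> U" "x \<in> loc 0 Q" "y \<in> loc 0 Q" for x y Q
    unfolding LU[OF that(1)] using that by blast
  have pr_eq: "pr x y V = pr x' y' V \<longleftrightarrow> x = x' \<and> y = y'" if "V \<noteq> {}" for x y x' y' V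
  proof
    assume eq: "pr x y V = pr x' y' V"
    show "x = x' \<and> y = y'"
      using fun_cong[OF eq, of j1] fun_cong[OF eq, of j2] jj by (auto simp: pr_def cst_eq_iff[OF that])
  qed simp
  show ?thesis
    unfolding right_exact_seq_def os
  proof (intro conjI allI impI)
    show "mod_morphism ?X (free_sheaf ?X {k}) (free_sheaf ?X ?J) ?\<phi>"
    proof (rule mod_morphismI, unfold os)
      fix V c assume V: "openin Proj_topology V \<and> V \<subseteq> U" and c: "c \<in> carrier (Sec (free_sheaf ?X {k}) V)"
      then obtain x where x: "c = (\<lambda>j\<in>{k}. cst x V)" "\<forall>Q\<in>V. x \<in> loc 0 Q" using car1 by blast
      have V1: "openin Proj_topology V" and V2: "V \<subseteq> U" using V by auto
      have "\<forall>Q\<in>V. g * x \<in> loc 0 Q \<and> - f * x \<in> loc 0 Q"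
        using V2 x(2) fgloc Proj by (auto intro!: loc_mult0 loc_uminus)
      then show "?\<phi> V c \<in> carrier (Sec (free_sheaf ?X ?J) V)"
        unfolding x(1) \<phi>_cst car2[OF V1 V2] by blast
    next
      fix V c d
      show "?\<phi> V (c \<oplus>\<^bsub>Sec (free_sheaf ?X {k}) V\<^esub> d) = ?\<phi> V c \<oplus>\<^bsub>Sec (free_sheaf ?X ?J) V\<^esub> ?\<phi> V d"
        unfolding ops by (rule restrict_ext) (auto simp: fun_eq_iff algebra_simps)
    next
      fix V r c
      show "?\<phi> V (r \<odot>\<^bsub>Sec (free_sheaf ?X {k}) V\<^esub> c) = r \<odot>\<^bsub>Sec (free_sheaf ?X ?J) V\<^esub> ?\<phi> V c"
        unfolding ops by (rule restrict_ext) (auto simp: fun_eq_iff algebra_simps)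
    next
      fix V W :: "zxy set set" and c assume "W \<subseteq> V"
      then show "Res (free_sheaf ?X ?J) V W (?\<phi> V c) = ?\<phi> W (Res (free_sheaf ?X {k}) V W c)"
        unfolding ops by (intro restrict_ext) (auto simp: fun_eq_iff restrict_def)
    qed
    show "mod_morphism ?X (free_sheaf ?X ?J) (latt L (*)) ?\<psi>"
    proof (rule mod_morphismI, unfold os)
      fix V d assume V: "openin Proj_topology V \<and> V \<subseteq> U" and d: "d \<in> carrier (Sec (free_sheaf ?X ?J) V)"
      have V1: "openin Proj_topology V" and V2: "V \<subseteq> U" using V by auto
      obtain x y where x: "d = pr x y V" "\<And>Q. Q \<in> V \<Longrightarrow> x \<in> loc 0 Q" "\<And>Q. Q \<in> V \<Longrightarrow> y \<in> loc 0 Q"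
        using d unfolding car2[OF V1 V2] by blast
      show "?\<psi> V d \<in> carrier (Sec (latt L (*)) V)"
        unfolding x(1) \<psi>_pr latt_simps using V x(2,3) inL by (intro cs_cst) auto
    next
      fix V c d
      show "?\<psi> V (c \<oplus>\<^bsub>Sec (free_sheaf ?X ?J) V\<^esub> d) = ?\<psi> V c \<oplus>\<^bsub>Sec (latt L (*)) V\<^esub> ?\<psi> V d"
        unfolding ops latt_simps by (rule restrict_ext) (auto simp: algebra_simps)
    next
      fix V r d
      show "?\<psi> V (r \<odot>\<^bsub>Sec (free_sheaf ?X ?J) V\<^esub> d) = r \<odot>\<^bsub>Sec (latt L (*)) V\<^esub> ?\<psi> V d"
        unfolding ops latt_simps by (rule restrict_ext) (auto simp: algebra_simps)
    next
      fix V W :: "zxy set set" and d assume "W \<subseteq> V"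
      then show "Res (latt L (*)) V W (?\<psi> V d) = ?\<psi> W (Res (free_sheaf ?X ?J) V W d)"
        unfolding ops latt_simps by (auto simp: fun_eq_iff restrict_def)
    qed
  next
    fix V assume "openin Proj_topology V \<and> V \<subseteq> U"
    then have V: "openin Proj_topology V" "V \<subseteq> U" by auto
    show "image_sheaf ?X (free_sheaf ?X {k}) (free_sheaf ?X ?J) ?\<phi> V = kernel_sheaf (free_sheaf ?X ?J) (latt L (*)) ?\<psi> V"
    proof (intro equalityI subsetI)
      fix d assume "d \<in> image_sheaf ?X (free_sheaf ?X {k}) (free_sheaf ?X ?J) ?\<phi> V"
      then have d: "d \<in> carrier (Sec (free_sheaf ?X ?J) V)"
        and im: "\<And>p. p \<in> V \<Longrightarrow> \<exists>W. (openin Proj_topology W \<and> W \<subseteq> U) \<and> p \<in> W \<and> W \<subseteq> V \<and>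
          Res (free_sheaf ?X ?J) V W d \<in> ?\<phi> W ` carrier (Sec (free_sheaf ?X {k}) W)"
        by (auto simp: image_sheaf_def os)
      obtain x y where x: "d = pr x y V" using d car2[OF V] by blast
      have "cst (f * x + g * y) V = cst 0 V"
      proof (cases "V = {}")
        case False
        then obtain p where "p \<in> V" by blast
        then obtain W c where W: "openin Proj_topology W" "W \<subseteq> U" "p \<in> W" "W \<subseteq> V"
          "Res (free_sheaf ?X ?J) V W d = ?\<phi> W c" "c \<in> carrier (Sec (free_sheaf ?X {k}) W)"
          using im by blast
        obtain z where z: "c = (\<lambda>j\<in>{k}. cst z W)" using W(6) car1[OF W(1,2)] by blast
        have "Res (free_sheaf ?X ?J) V W d = pr x y W"
          unfolding ops x pr_def using W(4) by (intro restrict_ext) auto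
        then have "pr x y W = pr (g * z) (- f * z) W" using W(5) unfolding z \<phi>_cst by simp
        then have "x = g * z" "y = - f * z" using pr_eq W(3) by blast+
        then show ?thesis by simp
      qed (use cst_empty in auto)
      then have "?\<psi> V d = cst 0 V" unfolding x \<psi>_pr .
      then show "d \<in> kernel_sheaf (free_sheaf ?X ?J) (latt L (*)) ?\<psi> V"
        using d unfolding kernel_sheaf_def a_kernel_def' by simp
    next
      fix d assume "d \<in> kernel_sheaf (free_sheaf ?X ?J) (latt L (*)) ?\<psi> V"
      then have d: "d \<in> carrier (Sec (free_sheaf ?X ?J) V)" and 0: "?\<psi> V d = cst 0 V"
        by (simp_all add: kernel_sheaf_def a_kernel_def')
      obtain x y where x: "d = pr x y V" "\<And>Q. Q \<in> V \<Longrightarrow> x \<in> loc 0 Q" "\<And>Q. Q \<in> V \<Longrightarrow> y \<in> loc 0 Q"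
        using d car2[OF V] by blast
      have "\<exists>W. (openin Proj_topology W \<and> W \<subseteq> U) \<and> p \<in> W \<and> W \<subseteq> V \<and>
          Res (free_sheaf ?X ?J) V W d \<in> ?\<phi> W ` carrier (Sec (free_sheaf ?X {k}) W)" if p: "p \<in> V" for p
      proof -
        have V0: "V \<noteq> {}" using p by blast
        have rel: "f * x + g * y = 0" using 0 unfolding x(1) \<psi>_pr using cst_eq_iff[OF V0] by metis
        obtain r where r: "x = r * g" "y = - r * f" using syz[of p x y] x(2,3)[OF p] rel V p by blast
        \<comment> \<open>Since \<open>f\<close> and \<open>g\<close> are not both zero, the
          coefficient of the Koszul relation is unique; the coefficients found at different points
          agree, so \<open>r\<close> is regular on all of \<open>V\<close>.\<close>
        have rQ: "r \<in> loc 0 Q" if Q: "Q \<in> V" for Q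
        proof -
          obtain r' where r': "r' \<in> loc 0 Q" "x = r' * g" "y = - r' * f"
            using syz[of Q x y] x(2,3)[OF Q] rel V Q by blast
          have "r' = r" using r r' fg by auto
          then show ?thesis using r' by simp
        qed
        have "(\<lambda>j\<in>{k}. cst r V) \<in> carrier (Sec (free_sheaf ?X {k}) V)" using car1[OF V] rQ by blast
        moreover have "Res (free_sheaf ?X ?J) V V d = ?\<phi> V (\<lambda>j\<in>{k}. cst r V)"
          unfolding \<phi>_cst unfolding ops x(1) r pr_def by (rule restrict_ext) (auto simp: mult.commute)
        ultimately show ?thesis using V p by blast
      qed
      then show "d \<in> image_sheaf ?X (free_sheaf ?X {k}) (free_sheaf ?X ?J) ?\<phi> V"
        using d by (simp add: image_sheaf_def os)
    qed
    show "image_sheaf ?X (free_sheaf ?X ?J) (latt L (*)) ?\<psi> V = carrier (Sec (latt L (*)) V)"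
    proof (intro equalityI subsetI)
      fix t assume t: "t \<in> carrier (Sec (latt L (*)) V)"
      then obtain v where v: "t = cst v V" "\<And>Q. Q \<in> V \<Longrightarrow> v \<in> L Q" using csE[OF V(1)] unfolding latt_simps by metis
      have "\<exists>W. (openin Proj_topology W \<and> W \<subseteq> U) \<and> p \<in> W \<and> W \<subseteq> V \<and>
          Res (latt L (*)) V W t \<in> ?\<psi> W ` carrier (Sec (free_sheaf ?X ?J) W)" if p: "p \<in> V" for p
      proof -
        have pU: "p \<in> U" using p V by blast
        obtain x y where xy: "v = f * x + g * y" "x \<in> loc 0 p" "y \<in> loc 0 p" using v(2)[OF p] unfolding LU[OF pU] by blast
        obtain A where A: "openin Proj_topology A" "p \<in> A" "\<forall>R\<in>A. x \<in> loc 0 R" using loc_open[OF Proj[OF pU] xy(2)] by blast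
        obtain B where B: "openin Proj_topology B" "p \<in> B" "\<forall>R\<in>B. y \<in> loc 0 R" using loc_open[OF Proj[OF pU] xy(3)] by blast
        define W where "W = V \<inter> A \<inter> B"
        have W: "openin Proj_topology W" "p \<in> W" "W \<subseteq> V" "W \<subseteq> U" using V A B p by (auto simp: W_def)
        have "pr x y W \<in> carrier (Sec (free_sheaf ?X ?J) W)"
          unfolding car2[OF W(1,4)] using A B by (intro exI[of _ x] exI[of _ y]) (auto simp: W_def)
        moreover have "Res (latt L (*)) V W t = ?\<psi> W (pr x y W)"
          unfolding \<psi>_pr latt_simps v(1) using W(3) xy(1) by simp
        ultimately show ?thesis using W by blast
      qed
      then show "t \<in> image_sheaf ?X (free_sheaf ?X ?J) (latt L (*)) ?\<psi> V"
        using t by (simp add: image_sheaf_def os)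
    qed (simp add: image_sheaf_def)
  qed
qed

lemma closed_subscheme: "closed_subscheme P1Z (cs L)"
  unfolding closed_subscheme_def quasi_coherent_sheaf_def ideal_as_module_eq_latt
proof (intro conjI allI impI ballI sheaf_latt)
  show "ideal (cs L U) (ring_at P1Z U)" if "is_open P1Z U" for U
    using ideal_sections that by simp
  fix P assume "P \<in> points P1Z"
  then have P: "P \<in> Proj_ZXY" by (simp add: topspace_Proj)
  obtain U f g where U: "openin Proj_topology U" "P \<in> U" and fg: "f \<noteq> 0 \<or> g \<noteq> 0"
    and *: "\<forall>Q\<in>U. L Q = {f * x + g * y | x y. x \<in> loc 0 Q \<and> y \<in> loc 0 Q} \<and>
        (\<forall>x\<in>loc 0 Q. \<forall>y\<in>loc 0 Q. f * x + g * y = 0 \<longrightarrow> (\<exists>r\<in>loc 0 Q. x = r * g \<and> y = - r * f))"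
    using gen[OF P] by blast
  \<comment> \<open>These are labels of the types that quasi-coherence asks for; any choice with
    distinct \<open>j1\<close> and \<open>j2\<close> would do.\<close>
  define k :: "zxy_section \<Rightarrow> zxy_section" where "k = (\<lambda>s. s)"
  define j1 j2 :: zxy_section where "j1 = (\<lambda>_. 0)" and "j2 = (\<lambda>_. 1)"
  have jj: "j1 \<noteq> j2" by (simp add: fun_eq_iff j1_def j2_def)
  have "right_exact_seq (open_subspace P1Z U) (free_sheaf (open_subspace P1Z U) {k})
    (free_sheaf (open_subspace P1Z U) {j1, j2}) (latt L (*))
    (\<lambda>V c. \<lambda>j\<in>{j1, j2}. \<lambda>P\<in>V. (if j = j1 then g else - f) * c k P)
    (\<lambda>V d. \<lambda>P\<in>V. f * d j1 P + g * d j2 P)"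
    by (rule presentation[OF U(1) fg _ _ jj]) (use * in blast)+
  then show "\<exists>U. is_open P1Z U \<and> P \<in> U \<and>
      (\<exists>(K :: (zxy_section \<Rightarrow> zxy_section) set) (J :: zxy_section set) \<phi> \<psi>.
        right_exact_seq (open_subspace P1Z U) (free_sheaf (open_subspace P1Z U) K)
          (free_sheaf (open_subspace P1Z U) J) (latt L (*)) \<phi> \<psi>)"
    using U unfolding is_open_P1Z by blast
qed

text \<open>The stalks are domains, so a nonzero \<open>f\<close> is a nonzerodivisor, and the
  description of the relations says that \<open>g\<close> is one modulo \<open>f\<close>.\<close>

lemma lci: "lci_codim_two P1Z (cs L)"
  unfolding lci_codim_two_def
proof (intro conjI closed_subscheme ballI)
  fix P assume "P \<in> subscheme_points P1Z (cs L)"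
  then have P: "P \<in> Proj_ZXY" and proper: "stalk_elem P ` L P \<noteq> stalk_elem P ` loc 0 P"
    using ideal_stalk_eq stalk_ring_carrier by (auto simp: subscheme_points_def topspace_Proj)
  let ?S = "stalk_ring P1Z P"
  interpret S: cring ?S by (rule cring_stalk[OF P])
  obtain U f g where U: "openin Proj_topology U" "P \<in> U"
    and *: "\<forall>Q\<in>U. L Q = {f * x + g * y | x y. x \<in> loc 0 Q \<and> y \<in> loc 0 Q} \<and>
        (\<forall>x\<in>loc 0 Q. \<forall>y\<in>loc 0 Q. f * x + g * y = 0 \<longrightarrow> (\<exists>r\<in>loc 0 Q. x = r * g \<and> y = - r * f))"
    using gen[OF P] by blast
  have LP: "L P = {f * x + g * y | x y. x \<in> loc 0 P \<and> y \<in> loc 0 P}"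
    and syz: "\<And>x y. x \<in> loc 0 P \<Longrightarrow> y \<in> loc 0 P \<Longrightarrow> f * x + g * y = 0 \<Longrightarrow> \<exists>r\<in>loc 0 P. x = r * g \<and> y = - r * f"
    using * U(2) by blast+
  note [simp] = loc_0[OF P] loc_1[OF P]
  have fL: "f \<in> L P" "g \<in> L P" unfolding LP by (force intro: exI[of _ 0] exI[of _ 1])+
  then have fl: "f \<in> loc 0 P" "g \<in> loc 0 P" using L_loc[OF P] by auto
  note ops = stalk_ring_ops[OF P] and car = stalk_ring_carrier[OF P]
  define e where "e = stalk_elem P"
  have eS: "e x \<in> carrier ?S" if "x \<in> loc 0 P" for x using that by (simp add: car e_def)
  have e_inj: "x = y" if "e x = e y" "x \<in> loc 0 P" for x y
    using stalk_elem_inj[OF P that(2)] that(1) by (simp add: e_def)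
  \<comment> \<open>If \<open>f\<close> were 0, the relation \<open>(1, 0)\<close> would be a
    multiple of \<open>(g, 0)\<close>, making \<open>g\<close> a unit and the ideal
    improper.\<close>
  have f0: "f \<noteq> 0"
  proof
    assume f: "f = 0"
    then obtain r where r: "r \<in> loc 0 P" "1 = r * g" using syz[of 1 0] by auto
    have "1 \<in> L P" using L_sm[OF P r(1) fL(2)] r(2) by simp
    then have "x \<in> L P" if "x \<in> loc 0 P" for x using L_sm[OF P that, of 1] by simp
    then have "L P = loc 0 P" using L_loc[OF P] by blast
    then show False using proper by simp
  qed
  have id2: "genideal ?S {e f, e g} = e ` L P"
  proof
    show "genideal ?S {e f, e g} \<subseteq> e ` L P"
    proof (rule S.genideal_minimal)
      show "ideal (e ` L P) ?S"
        unfolding e_def by (rule ideal_stalk_ring[OF P L_loc[OF P] L_0[OF P] L_add[OF P] L_sm[OF P]])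
    qed (use fL in auto)
    have I: "ideal (genideal ?S {e f, e g}) ?S" using eS fl by (intro S.genideal_ideal) auto
    have mem: "e f \<in> genideal ?S {e f, e g}" "e g \<in> genideal ?S {e f, e g}"
      using S.genideal_self[of "{e f, e g}"] eS fl by auto
    show "e ` L P \<subseteq> genideal ?S {e f, e g}"
    proof
      fix z assume "z \<in> e ` L P"
      then obtain x y where xy: "z = e (f * x + g * y)" "x \<in> loc 0 P" "y \<in> loc 0 P" unfolding LP by blast
      have "z = e x \<otimes>\<^bsub>?S\<^esub> e f \<oplus>\<^bsub>?S\<^esub> e y \<otimes>\<^bsub>?S\<^esub> e g"
        unfolding xy(1) e_def using xy(2,3) fl by (simp add: ops loc_mult0[OF P] mult.commute)
      then show "z \<in> genideal ?S {e f, e g}"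
        using ideal.I_l_closed[OF I mem(1) eS[OF xy(2)]] ideal.I_l_closed[OF I mem(2) eS[OF xy(3)]]
          additive_subgroup.a_closed[OF ideal.axioms(1)[OF I]] by simp
    qed
  qed
  have id1: "genideal ?S {e f} = e ` {x * f | x. x \<in> loc 0 P}"
  proof
    show "genideal ?S {e f} \<subseteq> e ` {x * f | x. x \<in> loc 0 P}"
    proof (rule S.genideal_minimal)
      show "ideal (e ` {x * f | x. x \<in> loc 0 P}) ?S"
        unfolding e_def
      proof (rule ideal_stalk_ring[OF P])
        show "{x * f | x. x \<in> loc 0 P} \<subseteq> loc 0 P" using fl(1) loc_mult0[OF P] by auto
        show "0 \<in> {x * f | x. x \<in> loc 0 P}" by (auto intro: exI[of _ 0])
        show "x + y \<in> {x * f | x. x \<in> loc 0 P}" if xy: "x \<in> {x * f | x. x \<in> loc 0 P}" "y \<in> {x * f | x. x \<in> loc 0 P}" for x y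
        proof -
          obtain a b where "x = a * f" "y = b * f" "a \<in> loc 0 P" "b \<in> loc 0 P" using xy by blast
          then show ?thesis using loc_add[OF P] by (intro CollectI exI[of _ "a + b"]) (simp add: algebra_simps)
        qed
        show "r * x \<in> {x * f | x. x \<in> loc 0 P}" if rx: "r \<in> loc 0 P" "x \<in> {x * f | x. x \<in> loc 0 P}" for r x
        proof -
          obtain a where "x = a * f" "a \<in> loc 0 P" using rx by blast
          then show ?thesis using loc_mult0[OF P rx(1)] by (intro CollectI exI[of _ "r * a"]) simp
        qed
      qed
      show "{e f} \<subseteq> e ` {x * f | x. x \<in> loc 0 P}" by (force intro: exI[of _ 1])
    qed
    have I: "ideal (genideal ?S {e f}) ?S" using eS fl by (intro S.genideal_ideal) auto
    have mem: "e f \<in> genideal ?S {e f}" using S.genideal_self[of "{e f}"] eS fl by auto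
    show "e ` {x * f | x. x \<in> loc 0 P} \<subseteq> genideal ?S {e f}"
    proof
      fix z assume "z \<in> e ` {x * f | x. x \<in> loc 0 P}"
      then obtain x where x: "z = e (x * f)" "x \<in> loc 0 P" by blast
      have "z = e x \<otimes>\<^bsub>?S\<^esub> e f" unfolding x(1) e_def using x(2) fl by (simp add: ops)
      then show "z \<in> genideal ?S {e f}" using ideal.I_l_closed[OF I mem eS[OF x(2)]] by simp
    qed
  qed
  have id0: "genideal ?S {} \<subseteq> {e 0}"
  proof (rule S.genideal_minimal)
    show "ideal {e 0} ?S" using S.zeroideal stalk_ring_consts(2)[OF P] by (simp add: e_def)
  qed auto
  have zero: "e 0 \<in> genideal ?S {}"
    using additive_subgroup.zero_closed[OF ideal.axioms(1)[OF S.genideal_ideal[of "{}"]]]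
      stalk_ring_consts(2)[OF P] by (simp add: e_def)
  have "regular_sequence ?S [e f, e g]"
    unfolding regular_sequence_def
  proof (intro conjI allI impI ballI)
    show "set [e f, e g] \<subseteq> carrier ?S" using eS fl by simp
    show "genideal ?S (set [e f, e g]) \<noteq> carrier ?S" using proper id2 by (simp add: car e_def)
    fix i a assume i: "i < length [e f, e g]" and a: "a \<in> carrier ?S"
      and mem: "[e f, e g] ! i \<otimes>\<^bsub>?S\<^esub> a \<in> genideal ?S (set (take i [e f, e g]))"
    obtain x where x: "a = e x" "x \<in> loc 0 P" using a by (auto simp: car e_def)
    have "i = 0 \<or> i = 1" using i by auto
    then show "a \<in> genideal ?S (set (take i [e f, e g]))"
    proof
      assume i0: "i = 0"
      then have "e (f * x) = e 0" using mem id0 x fl by (auto simp: e_def ops)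
      then have "f * x = 0" using e_inj loc_mult0[OF P fl(1) x(2)] by blast
      then show ?thesis using f0 i0 zero x by simp
    next
      assume i1: "i = 1"
      then have "e (g * x) \<in> e ` {x * f | x. x \<in> loc 0 P}" using mem id1 x fl by (simp add: e_def ops)
      then obtain y where y: "e (g * x) = e (y * f)" "y \<in> loc 0 P" by blast
      have "g * x = y * f" using e_inj[OF y(1)] loc_mult0[OF P fl(2) x(2)] by blast
      then have "f * (- y) + g * x = 0" by (simp add: mult.commute)
      then obtain r where r: "r \<in> loc 0 P" "x = - r * f" using syz[of "- y" x] loc_uminus[OF y(2)] x(2) by blast
      have "e (- r * f) \<in> e ` {x * f | x. x \<in> loc 0 P}" using loc_uminus[OF r(1)] by blast
      then show ?thesis using i1 x(1) r(2) id1 by simp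
    qed
  qed
  moreover have "ideal_stalk P1Z (cs L) P = genideal ?S {e f, e g}"
    using id2 ideal_stalk_eq[OF P] by (simp add: e_def)
  ultimately show "\<exists>f g. regular_sequence ?S [f, g] \<and> ideal_stalk P1Z (cs L) P = genideal ?S {f, g}" by blast
qed

end

section \<open>The quotient by a primitive section\<close>

text \<open>
  The quotient by the saturated line subbundle spanned by \<open>s\<close>. The map \<open>v \<mapsto> s \<and> v / \<delta>\<close>
  embeds it into \<open>\<O>(c + n)\<close>; its image is the ideal \<open>fitting\<close> of the zero scheme of \<open>s\<close>, twisted.
\<close>

locale line_quotient = lattice_det u w \<delta> c for u w :: "zxy set \<Rightarrow> kvec" and \<delta> c +
  fixes s :: kvec and n :: int
  assumes s: "s \<in> sections n" "s \<noteq> 0"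
    and primitive: "\<And>p k. prime_elem p \<Longrightarrow> homogeneous k p \<Longrightarrow>
      sv (inverse (to_fract p)) s \<notin> lat (n - int k) (pri p)"
begin

definition proj :: "kvec \<Rightarrow> zxy fract" where "proj v = wd s v / \<delta>"

definition quot :: "zxy set \<Rightarrow> zxy fract set" where "quot P = proj ` lat 0 P"

text \<open>Dividing \<open>quot\<close> by a generator of \<O>(c + n) undoes the twist. Demanding
  the condition for all generators avoids a choice; by \<open>fitting_iff\<close> a single one
  decides.\<close>

definition fitting :: "zxy set \<Rightarrow> zxy fract set" where
  "fitting P = {x. \<forall>g. loc_unit (c + n) P g \<longrightarrow> x * g \<in> quot P}"

lemma proj_add: "proj (v + v') = proj v + proj v'" and proj_sv: "proj (sv r v) = r * proj v"
  by (simp_all add: proj_def wd_simps add_divide_distrib)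

lemma quot_loc: "P \<in> Proj_ZXY \<Longrightarrow> quot P \<subseteq> loc (c + n) P"
  unfolding quot_def proj_def using wd_lat[OF _ sections_lat[OF s(1)], of P _ 0]
  by (auto simp: add.commute)

lemma klattice_quot: "klattice quot (*)"
proof (rule klattice.intro)
  show "vector_space ((*) :: zxy fract \<Rightarrow> zxy fract \<Rightarrow> zxy fract)"
    using klattice.vs[OF klattice_loc] .
  fix P assume P: "P \<in> Proj_ZXY"
  show "0 \<in> quot P" using lat_0[OF P] unfolding quot_def by (force simp: proj_def wd_def)
  show "x + y \<in> quot P" if "x \<in> quot P" "y \<in> quot P" for x y
    using that lat_add[OF P] unfolding quot_def by (auto simp flip: proj_add)
  show "r * x \<in> quot P" if "r \<in> loc 0 P" "x \<in> quot P" for r x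
    using that lat_sv[OF P, of r 0 _ 0] unfolding quot_def by (auto simp flip: proj_sv)
  fix x assume "x \<in> quot P"
  then obtain v where v: "v \<in> lat 0 P" "x = proj v" by (auto simp: quot_def)
  then show "\<exists>V. openin Proj_topology V \<and> P \<in> V \<and> (\<forall>Q\<in>V. x \<in> quot Q)"
    using klattice.L_open[OF klattice_lat P v(1)] unfolding quot_def by blast
qed

lemma quot_smult: "P \<in> Proj_ZXY \<Longrightarrow> r \<in> loc 0 P \<Longrightarrow> x \<in> quot P \<Longrightarrow> r * x \<in> quot P"
  by (rule klattice.L_sm[OF klattice_quot])

text \<open>Two generators of a twist differ by a factor regular at \<open>P\<close>, and
  \<open>quot P\<close> absorbs such factors.\<close>

lemma fitting_iff:
  assumes P: "P \<in> Proj_ZXY" and g: "loc_unit (c + n) P g"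
  shows "x \<in> fitting P \<longleftrightarrow> x * g \<in> quot P"
proof
  assume x: "x * g \<in> quot P"
  show "x \<in> fitting P"
    unfolding fitting_def
  proof (intro CollectI allI impI)
    fix h assume "loc_unit (c + n) P h"
    then have "h / g \<in> loc 0 P"
      using loc_unit_divide[OF P _ g, of "c + n" h] by (simp add: loc_unit_def)
    from quot_smult[OF P this x] show "x * h \<in> quot P" using g by (simp add: loc_unit_def mult.commute)
  qed
qed (use g in \<open>simp add: fitting_def\<close>)

lemma klattice_fitting: "klattice fitting (*)"
proof (rule klattice.intro)
  show "vector_space ((*) :: zxy fract \<Rightarrow> zxy fract \<Rightarrow> zxy fract)"
    using klattice.vs[OF klattice_loc] .
  note Q = klattice.L_0[OF klattice_quot] klattice.L_add[OF klattice_quot] klattice.L_open[OF klattice_quot]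
  fix P assume P: "P \<in> Proj_ZXY"
  obtain g where g: "loc_unit (c + n) P g" using ex_loc_unit[OF P] by blast
  note iff = fitting_iff[OF P g]
  show "0 \<in> fitting P" using Q(1)[OF P] by (simp add: iff)
  show "x + y \<in> fitting P" if "x \<in> fitting P" "y \<in> fitting P" for x y
    using that Q(2)[OF P, of "x * g" "y * g"] by (simp add: iff distrib_right)
  show "r * x \<in> fitting P" if "r \<in> loc 0 P" "x \<in> fitting P" for r x
    using that quot_smult[OF P, of r "x * g"] by (simp add: iff mult.assoc)
  fix x assume "x \<in> fitting P"
  then have xg: "x * g \<in> quot P" by (simp add: iff)
  obtain A where A: "openin Proj_topology A" "P \<in> A" "\<forall>Q\<in>A. x * g \<in> quot Q" using Q(3)[OF P xg] by blast
  obtain B where B: "openin Proj_topology B" "P \<in> B" "\<forall>Q\<in>B. loc_unit (c + n) Q g" using loc_unit_open[OF P g] by blast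
  have "x \<in> fitting Q" if "Q \<in> A \<inter> B" for Q
    using that A B fitting_iff[of Q g x] open_Proj_subset[OF A(1)] by blast
  then show "\<exists>V. openin Proj_topology V \<and> P \<in> V \<and> (\<forall>Q\<in>V. x \<in> fitting Q)"
    using A B by (intro exI[of _ "A \<inter> B"]) auto
qed

text \<open>In a local basis the generators are, up to units, the coordinates of \<open>s\<close>. A
  relation between them is a lattice vector whose wedge product with \<open>s\<close> vanishes; by
  saturation it is a multiple of \<open>s\<close>, and this makes the relation a multiple of the
  Koszul relation.\<close>

lemma koszul_fitting: "koszul_ideal fitting"
proof (rule koszul_ideal.intro[OF klattice_fitting], rule koszul_ideal_axioms.intro)
  fix P assume P: "P \<in> Proj_ZXY"
  show sub: "fitting P \<subseteq> loc 0 P"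
  proof
    fix x assume x: "x \<in> fitting P"
    obtain g where g: "loc_unit (c + n) P g" using ex_loc_unit[OF P] by blast
    have "x * g \<in> loc (c + n) P" using x fitting_iff[OF P g] quot_loc[OF P] by blast
    then show "x \<in> loc 0 P" using loc_unit_cancel[OF P g, of x 0] by (simp add: mult.commute)
  qed
next
  fix P assume P: "P \<in> Proj_ZXY"
  obtain z where z: "z \<in> {xx, yy}" "z \<notin> P" using Proj_coord[OF P] by blast
  have hz: "homogeneous (Suc 0) z" using z by auto
  obtain U where U: "openin Proj_topology U" "P \<in> U"
    "\<And>Q m. Q \<in> U \<Longrightarrow> lat m Q = span2 m Q (u P) (w P)"
    "\<And>Q. Q \<in> U \<Longrightarrow> loc_unit 0 Q (det P / det Q)" using lat_local[OF P] by metis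
  define W where "W = U \<inter> Dplus z"
  define g where "g = to_fract z powi (c + n)"
  define f1 f2 where "f1 = proj (u P) / g" and "f2 = proj (w P) / g"
  have W: "openin Proj_topology W" "P \<in> W" using U z P openin_Dplus[OF hz] by (auto simp: W_def Dplus_def)
  have WP: "Q \<in> Proj_ZXY" if "Q \<in> W" for Q using that W(1) open_Proj_subset by blast
  have g: "loc_unit (c + n) Q g" if "Q \<in> W" for Q
    unfolding g_def using that z by (intro loc_unit_gen) (auto simp: W_def Dplus_def)
  have g0: "g \<noteq> 0" using g[OF W(2)] by (simp add: loc_unit_def)
  have D0: "det P \<noteq> 0" by (rule det_nonzero[OF P])
  have wds: "wd s (u P) = f1 * g * \<delta>" "wd s (w P) = f2 * g * \<delta>"
    using g0 delta(1) by (simp_all add: f1_def f2_def proj_def)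
  have lin: "proj (sv x (u P) + sv y (w P)) = (f1 * x + f2 * y) * g" for x y
    using g0 by (simp add: proj_add proj_sv f1_def f2_def algebra_simps)
  have "f1 \<noteq> 0 \<or> f2 \<noteq> 0"
  proof (rule ccontr)
    assume "\<not> (f1 \<noteq> 0 \<or> f2 \<noteq> 0)"
    then have "wd s (u P) = 0" "wd s (w P) = 0" using wds by auto
    then have "s = 0"
      using wd_Cramer[OF basis[OF P], of s] by (simp add: wd_commute[of "u P" s] prod_eq_iff)
    then show False using s(2) by simp
  qed
  moreover have fit: "fitting Q = {f1 * x + f2 * y | x y. x \<in> loc 0 Q \<and> y \<in> loc 0 Q}" if Q: "Q \<in> W" for Q
  proof -
    have lat: "lat 0 Q = span2 0 Q (u P) (w P)" using U(3) Q by (simp add: W_def)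
    have "quot Q = {(f1 * x + f2 * y) * g | x y. x \<in> loc 0 Q \<and> y \<in> loc 0 Q}"
    proof (intro equalityI subsetI)
      fix t assume "t \<in> quot Q"
      then obtain v where v: "v \<in> span2 0 Q (u P) (w P)" "t = proj v" unfolding quot_def lat by blast
      obtain x y where "v = sv x (u P) + sv y (w P)" "x \<in> loc 0 Q" "y \<in> loc 0 Q" using v(1) by (rule span2E)
      then show "t \<in> {(f1 * x + f2 * y) * g | x y. x \<in> loc 0 Q \<and> y \<in> loc 0 Q}" using v(2) lin by blast
    next
      fix t assume "t \<in> {(f1 * x + f2 * y) * g | x y. x \<in> loc 0 Q \<and> y \<in> loc 0 Q}"
      then obtain x y where "t = (f1 * x + f2 * y) * g" "x \<in> loc 0 Q" "y \<in> loc 0 Q" by blast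
      then show "t \<in> quot Q" unfolding quot_def lat using span2I lin[symmetric] by blast
    qed
    then show ?thesis using g0 by (intro Set.set_eqI) (simp add: fitting_iff[OF WP[OF Q] g[OF Q]])
  qed
  moreover have syz: "\<exists>r\<in>loc 0 Q. x = r * f2 \<and> y = - r * f1"
    if Q: "Q \<in> W" and xy: "x \<in> loc 0 Q" "y \<in> loc 0 Q" and eq: "f1 * x + f2 * y = 0" for Q x y
  proof -
    let ?v = "sv x (u P) + sv y (w P)"
    have QU: "Q \<in> U" using Q by (simp add: W_def)
    have "?v \<in> lat 0 Q" unfolding U(3)[OF QU] using xy by (rule span2I)
    moreover have "wd s ?v = 0" using lin[of x y] eq delta(1) by (simp add: proj_def)
    ultimately obtain \<tau> where \<tau>: "\<tau> \<in> loc (0 - n) Q" "?v = sv \<tau> s"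
      using primitive_section_saturated[OF s primitive WP[OF Q]] by metis
    \<comment> \<open>\<open>\<tau>\<close> has degree \<open>- n\<close>; the generator
      \<open>g\<close> of degree \<open>c + n\<close> and the inverse of
      \<open>det P / \<delta>\<close>, of degree \<open>- c\<close>, bring it to degree 0. The
      formulas for \<open>x\<close> and \<open>y\<close> come from wedging the vector with the
      basis.\<close>
    define r where "r = \<tau> * (g * inverse (det P / \<delta>))"
    have "wd ?v (w P) = x * det P" "wd (u P) ?v = y * det P"
      by (simp_all add: det_def wd_simps)
    moreover have "wd ?v (w P) = \<tau> * (f2 * g * \<delta>)" "wd (u P) ?v = - \<tau> * (f1 * g * \<delta>)"
      unfolding \<tau>(2) using wds by (simp_all add: wd_simps wd_commute[of "u P" s])
    ultimately have "x = r * f2" "y = - r * f1"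
      using D0 delta(1) by (simp_all add: r_def field_simps)
    moreover have "r \<in> loc 0 Q"
    proof -
      have "loc_unit (0 + c) Q (det P / det Q * (det Q / \<delta>))"
        by (intro loc_unit_mult WP[OF Q] U(4)[OF QU] delta(2))
      then have "loc_unit c Q (det P / \<delta>)" using det_nonzero[OF WP[OF Q]] by simp
      then have "inverse (det P / \<delta>) \<in> loc (- c) Q" by (simp add: loc_unit_def)
      moreover have "g \<in> loc (c + n) Q" using g[OF Q] by (simp add: loc_unit_def)
      ultimately have "\<tau> * (g * inverse (det P / \<delta>)) \<in> loc (0 - n + (c + n + - c)) Q"
        using \<tau>(1) by (intro loc_mult WP[OF Q])
      then show ?thesis by (simp add: r_def)
    qed
    ultimately show ?thesis by blast
  qed
  ultimately show "\<exists>U f g. openin Proj_topology U \<and> P \<in> U \<and> (f \<noteq> 0 \<or> g \<noteq> 0) \<and>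
      (\<forall>Q\<in>U. fitting Q = {f * x + g * y | x y. x \<in> loc 0 Q \<and> y \<in> loc 0 Q} \<and>
        (\<forall>x\<in>loc 0 Q. \<forall>y\<in>loc 0 Q. f * x + g * y = 0 \<longrightarrow> (\<exists>r\<in>loc 0 Q. x = r * g \<and> y = - r * f)))"
    using W fit syz by (intro exI[of _ W] exI[of _ f1] exI[of _ f2] conjI ballI impI) assumption+
qed

lemma twisted_fitting: "P \<in> Proj_ZXY \<Longrightarrow> twisted_lattice.J fitting (c + n) P = quot P"
proof -
  assume P: "P \<in> Proj_ZXY"
  interpret T: twisted_lattice fitting "c + n"
    by (rule twisted_lattice.intro[OF klattice_fitting])
  obtain g where g: "loc_unit (c + n) P g" using ex_loc_unit[OF P] by blast
  have "g \<noteq> 0" using g by (simp add: loc_unit_def)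
  then show ?thesis
    using T.J_iff[OF P g] fitting_iff[OF P g] by (intro Set.set_eqI) simp
qed

text \<open>By saturation the kernel of \<open>proj\<close> consists of the multiples of
  \<open>s\<close>, with factors in \<O>(- n). Its image is \<open>quot\<close> by definition, and
  \<open>twisted_fitting\<close> recognises this as the twisted ideal.\<close>

lemma short_exact:
  "short_exact_seq P1Z (latt (loc (- n)) (*)) (latt (lat 0) sv) (latt (twisted_lattice.J fitting (c + n)) (*))
     (kmap (\<lambda>\<tau>. sv \<tau> s)) (kmap proj)"
proof (rule kmap_short_exact)
  interpret T: twisted_lattice fitting "c + n"
    by (rule twisted_lattice.intro[OF klattice_fitting])
  show "klattice (loc (- n)) (*)" by (rule klattice_loc)
  show "klattice (lat 0) sv" by (rule klattice_lat)
  show "klattice T.J (*)" by (rule T.klattice_J)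
  show "sv (v + w) s = sv v s + sv w s" for v w by (rule sv_add_left)
  show "sv (r * v) s = sv r (sv v s)" for r v by simp
  show "proj (v + w) = proj v + proj w" for v w by (rule proj_add)
  show "proj (sv r v) = r * proj v" for r v by (rule proj_sv)
  show "sv v s = 0 \<longleftrightarrow> v = 0" for v using s(2) by (auto simp: prod_eq_iff)
  fix P assume P: "P \<in> Proj_ZXY"
  show "sv v s \<in> lat 0 P \<and> proj (sv v s) = 0" if "v \<in> loc (- n) P" for v
    using lat_sv[OF P that sections_lat[OF s(1) P]] by (simp add: proj_def wd_simps)
  show "v \<in> (\<lambda>\<tau>. sv \<tau> s) ` loc (- n) P" if v: "v \<in> lat 0 P" "proj v = 0" for v
  proof -
    have "wd s v = 0" using v(2) delta(1) by (simp add: proj_def)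
    then obtain \<tau> where "\<tau> \<in> loc (0 - n) P" "v = sv \<tau> s"
      using primitive_section_saturated[OF s primitive P v(1)] by metis
    then show ?thesis by simp
  qed
  show "proj ` lat 0 P = T.J P" using twisted_fitting[OF P] by (simp add: quot_def)
qed

end

section \<open>Assembly of the exact sequence\<close>

theorem lemma1p4:
  fixes E :: "(zxy set, zxy_section, 'a) mod_presheaf"
  assumes "locally_free_sheaf P1Z 2 E"
  shows "\<exists>(a :: int) (b :: int) I \<alpha> \<beta>.
           a \<ge> b \<and> lci_codim_two P1Z I \<and>
           short_exact_seq P1Z (twisting_sheaf a) E (twisted_ideal_sheaf I b) \<alpha> \<beta>"
proof -
  obtain dom triv where "trivialized_sheaf E dom triv"
    using locally_free_trivialized[OF assms] by blast
  then interpret E: trivialized_sheaf E dom triv .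
  obtain \<delta> c where \<delta>: "\<delta> \<noteq> 0" "\<And>P. P \<in> Proj_ZXY \<Longrightarrow> loc_unit c P (E.det P / \<delta>)"
    using E.ex_det_generator by metis
  interpret D: lattice_det E.bu E.bw \<delta> c by unfold_locales (use \<delta> in auto)
  obtain n s where s: "s \<in> E.sections n" "s \<noteq> 0" "2 * n \<le> - c"
    "\<And>p k. prime_elem p \<Longrightarrow> homogeneous k p \<Longrightarrow> sv (inverse (to_fract p)) s \<notin> E.lat (n - int k) (pri p)"
    using D.ex_primitive_section by metis
  interpret Q: line_quotient E.bu E.bw \<delta> c s n by unfold_locales (use s in auto)
  interpret T: twisted_lattice Q.fitting "c + n"
    by (rule twisted_lattice.intro[OF Q.klattice_fitting])
  have target: "twisted_ideal_sheaf (cs Q.fitting) (c + n) = T.TS"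
    unfolding twisted_ideal_sheaf_def ideal_as_module_eq_latt twisting_sheaf_eq_latt ..
  have pre: "presheaf_of_modules P1Z (latt (E.lat 0) sv)"
    using klattice.sheaf_latt[OF E.klattice_lat] by (simp add: sheaf_of_modules_def)
  \<comment> \<open>A section \<open>s\<close> of the \<open>n\<close>-th twist is a map from \<O>(-
    n), so \<open>a = - n\<close>. The quotient maps into \<O>(c + n), so \<open>b = c + n\<close>,
    and \<open>a + b\<close> is the degree \<open>c\<close> of the determinant.\<close>
  have "\<exists>\<alpha> \<beta>. short_exact_seq P1Z (twisting_sheaf (- n)) E (twisted_ideal_sheaf (cs Q.fitting) (c + n)) \<alpha> \<beta>"
    unfolding target twisting_sheaf_eq_latt
  proof (intro exI)
    show "short_exact_seq P1Z (latt (loc (- n)) (*)) E T.TS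
      (\<lambda>U s'. inv_into (carrier (Sec E U)) (\<lambda>s. cst (E.val U s) U) (kmap (\<lambda>\<tau>. sv \<tau> s) U s'))
      (\<lambda>U s. T.gsec U (kmap Q.proj U (cst (E.val U s) U)))"
    proof (rule short_exact_seq_transport[OF Q.short_exact E.presheaf pre E.iso_lattice_sheaf T.iso_tensor_sheaf])
      fix U assume "is_open P1Z U"
      then have U: "openin Proj_topology U" by simp
      show "\<zero>\<^bsub>Sec (latt T.J (*)) U\<^esub> \<in> carrier (Sec (latt T.J (*)) U)"
        using abelian_group.axioms(1)[OF T.Jl.abelian_group_latt[OF U]]
        by (rule abelian_monoid.zero_closed)
      show "T.gsec U \<zero>\<^bsub>Sec (latt T.J (*)) U\<^esub> = \<zero>\<^bsub>Sec T.TS U\<^esub>" by (rule T.gsec_zero[OF U])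
    qed
  qed
  moreover have "lci_codim_two P1Z (cs Q.fitting)"
    using koszul_ideal.lci[OF Q.koszul_fitting] .
  \<comment> \<open>The bound \<open>2 * n \<le> - c\<close> on the primitive section is exactly the
    inequality \<open>a \<ge> b\<close>.\<close>
  moreover have "- n \<ge> c + n" using s(3) by simp
  ultimately show ?thesis by blast
qed

end
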